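(* Suppose that assumptions (A1), (A2), (A3) in the context hold, and fix $x_0\in[0,L]$. Then there exist $\hat T>0$ (with $\hat T\le T_0$), $\hat h>0$ and $q\in(0,1)$ such that for every $T\le\hat T$, every $\nu,\nu'\in\mathcal P_{T,L}$ and every (admissible) $h\in(0,\hat h\wedge\hat T)$, $$W_1^2(\Phi^h(\nu),\Phi^h(\nu'))\le q\big(h^2+W_1^2(\nu,\nu')\big).$$
   Context: **Notation.** $L,\sigma>0$ are fixed, $U\subset\mathbb R$ is compact. $\mathcal P(S)$ is the space of probability measures on $S$ with the weak topology; $\mathcal C([0,T]:[0,L])$ has the uniform metric. $\mathcal P_{T,L}\doteq\mathcal P(\mathcal C([0,T]:[0,L]))$, and for $\nu\in\mathcal P_{T,L}$, $\nu(t)$ is its time-$t$ marginal. $W_1$ is the Wasserstein distance of order 1 (on $\mathcal P([0,L])$, and on $\mathcal P_{T,L}$ with respect to the uniform metric); $W_1^2$ is its square. **Data and assumptions.** The data are $b,f:[0,T_0]\times\mathcal P([0,L])\times[0,L]\times U\to\mathbb R$, $g:\mathcal P([0,L])\times[0,L]\to\mathbb R$ and functions $y,r$ of $(t,\eta)\in[0,T_0]\times\mathcal P([0,L])$, where $T_0>0$ is a fixed horizon on which the assumptions below hold; only time horizons $T\in(0,T_0]$ are considered. (A1) (i) there is $c_L<\infty$ such that $|f(t,\eta,x,\alpha)-f(t',\eta',x',\alpha')|+|g(\eta,x)-g(\eta',x')|+|b(t,\eta,x,\alpha)-b(t',\eta',x',\alpha')|+|y(t,\eta)-y(t',\eta')|+|r(t,\eta)-r(t',\eta')|\le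 c_L(|t-t'|+W_1(\eta,\eta')+|x-x'|+|\alpha-\alpha'|)$; (ii) for every $(t,\eta,x,p)\in[0,T_0]\times\mathcal P([0,L])\times[0,L]\times\mathbb R$ there is a unique minimizer $\hat\alpha(t,\eta,x,p)\in U$ of $u\mapsto f(t,\eta,x,u)+b(t,\eta,x,u)p$ over $U$. (A2) $y,r$ do not depend on $\eta$: $y(t,\eta)=y(t)$, $r(t,\eta)=r(t)$. (A3) there is $c_\alpha<\infty$ with $|\hat\alpha(t,\eta,x,p)-\hat\alpha(t,\eta',x',p')|\le c_\alpha(W_1(\eta,\eta')+|x-x'|+|p-p'|)$ for all $t\in[0,T_0]$, $\eta,\eta'\in\mathcal P([0,L])$, $x,x'\in[0,L]$, $p,p'\in\mathbb R$. Put $c_B=\sup|b|<\infty$. **Discretization.** For a horizon $T$, $h>0$ is admissible if, with $\Delta^h=h^2/\sigma^2$, both $L/h$ and $I(h)=T/\Delta^h$ are integers and $hc_B<\sigma^2$. Let $\mathbb S^h=\{-h,0,h,\dots,L,L+h\}$, $\mathbb S^h_0=\{0,h,\dots,L\}$, $\mathbb T^h=\{0,\Delta^h,\dots,T-\Delta^h\}$, $l^h(s)=\lfloor s/\Delta^h\rfloor\Delta^h$. Transition kernel: for $x\in\mathbb S^h_0$, $q^h(t,\eta,u;x,x\pm h)=\frac{\pm hb(t,\eta,x,u)+\sigma^2}{2\sigma^2}$; and $q^h(t,\eta,u;L+h,L)=q^h(t,\eta,u;-h,0)=1$. **Controlled chain.** Given $\nu\in\mathcal P_{T,L}$ and $x_0\in[0,L]$: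 $X^{h,\nu}_0=\lfloor x_0/h\rfloor h$, $t_0^{h,\nu}=0$, $\alpha_{-1}^{h,\nu}\in U$ fixed; with $\mathcal F^{h,\nu}_n=\sigma\{X^{h,\nu}_j,\alpha^{h,\nu}_{j-1}:j\le n\}$, an admissible control $\alpha_n^{h,\nu}$ is $U$-valued and $\mathcal F_n^{h,\nu}$-measurable, the conditional law of $X^{h,\nu}_{n+1}$ given $\mathcal F_n^{h,\nu}$ is $q^h(t_n^{h,\nu},\nu(t_n^{h,\nu}),\alpha_n^{h,\nu};X_n^{h,\nu},\cdot)$, and $t_{n+1}^{h,\nu}=t_n^{h,\nu}+\Delta^h1_{\{X_n^{h,\nu}\notin\{-h,L+h\}\}}$. The chain is run up to time $T$ (including a possible reflection step at time $T$). Let $n^{h,\nu}(t)=\max\{n:t_n^{h,\nu}=j\Delta^h\}$ for $t\in[j\Delta^h,(j+1)\Delta^h)$ (and likewise at $t=T$ with $j=I(h)$), and $X^{h,\nu}(t)=X^{h,\nu}_{n^{h,\nu}(t)}$, $\alpha^{h,\nu}(t)=\alpha^{h,\nu}_{n^{h,\nu}(t)}$, $Y^{h,\nu}(t)=h\sum_{j=0}^{n^{h,\nu}(t)-1}1_{\{X^{h,\nu}_j=-h\}}$, $R^{h,\nu}(t)=h\sum_{j=0}^{n^{h,\nu}(t)-1}1_{\{X^{h,\nu}_j=L+h\}}$. **Discrete control problem.** $J^{h,\nu}(t,x,\alpha^{h,\nu})=\mathbb E\big[\int_t^Tf(l^h(s),\nu(l^h(s)),X^{h,\nu}(s),\alpha^{h,\nu}(s))ds+g(\nu(T),X^{h,\nu}(T))+\int_t^Ty(s)dY^{h,\nu}(s)+\int_t^Tr(s)dR^{h,\nu}(s)\mid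 X^{h,\nu}(t)=x\big]$ and $V^h_\nu(t,x)=\inf J^{h,\nu}(t,x,\cdot)$ over admissible controls. With $V^h_\nu(t+\Delta^h,L+h)\doteq r(t+\Delta^h)h+V^h_\nu(t+\Delta^h,L)$ and $V^h_\nu(t+\Delta^h,-h)\doteq y(t+\Delta^h)h+V^h_\nu(t+\Delta^h,0)$, put $\mathcal D^h_xV^h_\nu(t,x)=\frac1{2h}\big(V^h_\nu(t+\Delta^h,x+h)-V^h_\nu(t+\Delta^h,x-h)\big)$ for $(t,x)\in\mathbb T^h\times\mathbb S^h_0$. The optimal feedback control is $\vartheta^{h,\nu}(t,x)=\hat\alpha(t,\nu(t),x,\mathcal D^h_xV^h_\nu(t,x))$, and $\hat\alpha^{h,\nu}(t,x)=\vartheta^{h,\nu}(l^h(t),x)$. **The map $\Phi^h$.** For the chain controlled by the optimal feedback control $\hat\alpha^{h,\nu}$, let $\hat X^{h,\nu}$ be the continuous process on $[0,T]$ that is linear on each $[j\Delta^h,(j+1)\Delta^h]$ and equals $X^{h,\nu}_{n^{h,\nu}(j\Delta^h)}$ at $j\Delta^h$. Then $\Phi^h(\nu)=\mathbb P\circ(\hat X^{h,\nu})^{-1}\in\mathcal P_{T,L}$. *)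

theory Defs
  imports "HOL-Probability.Probability"
begin

text \<open>
  For a measurable space \<open>S\<close>, the space of probability measures on \<open>S\<close> is
  \<open>space (prob_algebra S)\<close>.
\<close>

definition couplings :: "'a measure \<Rightarrow> 'a measure \<Rightarrow> ('a \<times> 'a) measure set" where
  "couplings M N =
     {\<pi> \<in> space (prob_algebra (M \<Otimes>\<^sub>M N)). distr \<pi> M fst = M \<and> distr \<pi> N snd = N}"

definition W1 :: "'a::metric_space measure \<Rightarrow> 'a measure \<Rightarrow> real" where
  "W1 M N = enn2real
     (INF \<pi>\<in>couplings M N. \<integral>\<^sup>+ p. ennreal (dist (fst p) (snd p)) \<partial>\<pi>)"

definition segment_space :: "real \<Rightarrow> real measure" where
  "segment_space L = restrict_space borel {0..L}"

text \<open>
  A continuous path on \<open>[0,T]\<close> is represented by its extension to the whole line which is constant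
  on each side of \<open>[0,T]\<close>. On these extensions the supremum distance of the type of bounded
  continuous functions is the uniform distance on \<open>[0,T]\<close>.
\<close>

definition paths :: "real \<Rightarrow> real \<Rightarrow> (real \<Rightarrow>\<^sub>C real) set" where
  "paths T L = {w. \<forall>s. apply_bcontfun w s \<in> {0..L} \<and>
                       apply_bcontfun w s = apply_bcontfun w (max 0 (min T s))}"

definition path_space :: "real \<Rightarrow> real \<Rightarrow> (real \<Rightarrow>\<^sub>C real) measure" where
  "path_space T L = restrict_space borel (paths T L)"

definition marginal :: "real \<Rightarrow> (real \<Rightarrow>\<^sub>C real) measure \<Rightarrow> real \<Rightarrow> real measure" where
  "marginal L \<nu> t = distr \<nu> (segment_space L) (\<lambda>w. apply_bcontfun w t)"


subsection \<open>Data and assumptions\<close>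

text \<open>
  The data are total functions; only their values for \<open>t \<in> [0,T0]\<close>, \<open>\<eta>\<close> a probability measure on
  \<open>[0,L]\<close>, \<open>x \<in> [0,L]\<close> and controls in \<open>U\<close> matter.
\<close>

locale mfg =
  fixes L \<sigma> T0 :: real
    and U :: "real set"
    and b f :: "real \<Rightarrow> real measure \<Rightarrow> real \<Rightarrow> real \<Rightarrow> real"
    and g :: "real measure \<Rightarrow> real \<Rightarrow> real"
    and y r :: "real \<Rightarrow> real measure \<Rightarrow> real"
begin

definition A1_lipschitz :: bool where
  "A1_lipschitz \<longleftrightarrow> (\<exists>c. \<forall>t\<in>{0..T0}. \<forall>t'\<in>{0..T0}.
     \<forall>\<eta>\<in>space (prob_algebra (segment_space L)). \<forall>\<eta>'\<in>space (prob_algebra (segment_space L)).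
     \<forall>x\<in>{0..L}. \<forall>x'\<in>{0..L}. \<forall>a\<in>U. \<forall>a'\<in>U.
       \<bar>f t \<eta> x a - f t' \<eta>' x' a'\<bar> + \<bar>g \<eta> x - g \<eta>' x'\<bar> + \<bar>b t \<eta> x a - b t' \<eta>' x' a'\<bar>
         + \<bar>y t \<eta> - y t' \<eta>'\<bar> + \<bar>r t \<eta> - r t' \<eta>'\<bar>
       \<le> c * (\<bar>t - t'\<bar> + W1 \<eta> \<eta>' + \<bar>x - x'\<bar> + \<bar>a - a'\<bar>))"

definition A1_minimizer :: bool where
  "A1_minimizer \<longleftrightarrow> (\<forall>t\<in>{0..T0}. \<forall>\<eta>\<in>space (prob_algebra (segment_space L)). \<forall>x\<in>{0..L}. \<forall>p.
     \<exists>!u. is_arg_min (\<lambda>u. f t \<eta> x u + b t \<eta> x u * p) (\<lambda>u. u \<in> U) u)"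

definition A1 :: bool where
  "A1 \<longleftrightarrow> A1_lipschitz \<and> A1_minimizer"

definition alpha_hat :: "real \<Rightarrow> real measure \<Rightarrow> real \<Rightarrow> real \<Rightarrow> real" where
  "alpha_hat t \<eta> x p = arg_min_on (\<lambda>u. f t \<eta> x u + b t \<eta> x u * p) U"

definition A2 :: bool where
  "A2 \<longleftrightarrow> (\<forall>t\<in>{0..T0}.
     \<forall>\<eta>\<in>space (prob_algebra (segment_space L)). \<forall>\<eta>'\<in>space (prob_algebra (segment_space L)).
       y t \<eta> = y t \<eta>' \<and> r t \<eta> = r t \<eta>')"

definition A3 :: bool where
  "A3 \<longleftrightarrow> (\<exists>c. \<forall>t\<in>{0..T0}.
     \<forall>\<eta>\<in>space (prob_algebra (segment_space L)). \<forall>\<eta>'\<in>space (prob_algebra (segment_space L)).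
     \<forall>x\<in>{0..L}. \<forall>x'\<in>{0..L}. \<forall>p p'.
       \<bar>alpha_hat t \<eta> x p - alpha_hat t \<eta>' x' p'\<bar> \<le> c * (W1 \<eta> \<eta>' + \<bar>x - x'\<bar> + \<bar>p - p'\<bar>))"

definition c_B :: real where
  "c_B = Sup {\<bar>b t \<eta> x u\<bar> | t \<eta> x u.
     t \<in> {0..T0} \<and> \<eta> \<in> space (prob_algebra (segment_space L)) \<and> x \<in> {0..L} \<and> u \<in> U}"

definition admissible_step :: "real \<Rightarrow> real \<Rightarrow> bool" where
  "admissible_step T h \<longleftrightarrow>
     h > 0 \<and> L / h \<in> \<int> \<and> T / (h\<^sup>2 / \<sigma>\<^sup>2) \<in> \<int> \<and> h * c_B < \<sigma>\<^sup>2"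

end


subsection \<open>The controlled chain\<close>

text \<open>
  The filtration generated by the states up to step \<open>n\<close> and the controls before step \<open>n\<close>; the
  deterministic control with index \<open>-1\<close> would not contribute to it and is omitted.
\<close>

definition history :: "'w measure \<Rightarrow> (nat \<Rightarrow> 'w \<Rightarrow> real) \<Rightarrow> (nat \<Rightarrow> 'w \<Rightarrow> real) \<Rightarrow> nat \<Rightarrow> 'w measure" where
  "history M X \<alpha> n = sigma (space M)
     ({X j -` B \<inter> space M | j B. j \<le> n \<and> B \<in> sets borel} \<union>
      {\<alpha> j -` B \<inter> space M | j B. j < n \<and> B \<in> sets borel})"

locale mfg_chain = mfg L \<sigma> T0 U b f g y r
  for L \<sigma> T0 :: real
    and U :: "real set"
    and b f :: "real \<Rightarrow> real measure \<Rightarrow> real \<Rightarrow> real \<Rightarrow> real"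
    and g :: "real measure \<Rightarrow> real \<Rightarrow> real"
    and y r :: "real \<Rightarrow> real measure \<Rightarrow> real" +
  fixes x0 T h :: real
    and \<nu> :: "(real \<Rightarrow>\<^sub>C real) measure"
begin

abbreviation marg :: "real \<Rightarrow> real measure" where
  "marg s \<equiv> marginal L \<nu> s"

definition Delta :: real where
  "Delta = h\<^sup>2 / \<sigma>\<^sup>2"

definition S0 :: "real set" where
  "S0 = {real k * h | k::nat. real k * h \<le> L}"

definition S :: "real set" where
  "S = {-h} \<union> S0 \<union> {L + h}"

definition grid_floor :: "real \<Rightarrow> real" where
  "grid_floor s = real_of_int \<lfloor>s / Delta\<rfloor> * Delta"

definition kernel :: "real \<Rightarrow> real measure \<Rightarrow> real \<Rightarrow> real \<Rightarrow> real \<Rightarrow> real" where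
  "kernel t \<eta> u x z =
     (if x \<in> S0 then
        (if z = x + h then (h * b t \<eta> x u + \<sigma>\<^sup>2) / (2 * \<sigma>\<^sup>2)
         else if z = x - h then (- h * b t \<eta> x u + \<sigma>\<^sup>2) / (2 * \<sigma>\<^sup>2)
         else 0)
      else if x = L + h then (if z = L then 1 else 0)
      else if x = - h then (if z = 0 then 1 else 0)
      else 0)"

text \<open>
  The next definitions concern a single trajectory \<open>\<xi>\<close> of states, started at time \<open>t0\<close>.
\<close>

primrec clock :: "real \<Rightarrow> (nat \<Rightarrow> real) \<Rightarrow> nat \<Rightarrow> real" where
  "clock t0 \<xi> 0 = t0"
| "clock t0 \<xi> (Suc n) = clock t0 \<xi> n + (if \<xi> n \<in> {-h, L + h} then 0 else Delta)"

definition step_at :: "real \<Rightarrow> (nat \<Rightarrow> real) \<Rightarrow> real \<Rightarrow> nat" where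
  "step_at t0 \<xi> s = Max {n. clock t0 \<xi> n = grid_floor s}"

definition refl_Y :: "real \<Rightarrow> (nat \<Rightarrow> real) \<Rightarrow> real \<Rightarrow> real" where
  "refl_Y t0 \<xi> s = h * (\<Sum>j<step_at t0 \<xi> s. if \<xi> j = - h then 1 else 0)"

definition refl_R :: "real \<Rightarrow> (nat \<Rightarrow> real) \<Rightarrow> real \<Rightarrow> real" where
  "refl_R t0 \<xi> s = h * (\<Sum>j<step_at t0 \<xi> s. if \<xi> j = L + h then 1 else 0)"

text \<open>
  \<open>controlled_chain t0 x M X \<alpha>\<close>: on the probability space \<open>M\<close>, \<open>X\<close> is the chain started from state
  \<open>x\<close> at time \<open>t0\<close> and controlled by the admissible control \<open>\<alpha>\<close>. The transition law is imposed as
  long as the chain runs, that is, before time \<open>T\<close> and in a reflection step at time \<open>T\<close>. The steps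
  after that are unconstrained, and nothing below depends on them: the clock of step \<open>n\<close> is then
  past \<open>T\<close>, so that the last step at time \<open>T\<close> is almost surely well defined.
\<close>

definition controlled_chain ::
  "real \<Rightarrow> real \<Rightarrow> 'w measure \<Rightarrow> (nat \<Rightarrow> 'w \<Rightarrow> real) \<Rightarrow> (nat \<Rightarrow> 'w \<Rightarrow> real) \<Rightarrow> bool" where
  "controlled_chain t0 x M X \<alpha> \<longleftrightarrow>
     prob_space M \<and>
     (\<forall>n. X n \<in> borel_measurable M \<and> (\<forall>\<omega>\<in>space M. X n \<omega> \<in> S)) \<and>
     (\<forall>\<omega>\<in>space M. X 0 \<omega> = x) \<and>
     (\<forall>n. \<alpha> n \<in> borel_measurable (history M X \<alpha> n) \<and> (\<forall>\<omega>\<in>space M. \<alpha> n \<omega> \<in> U)) \<and>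
     (\<forall>n. \<forall>z\<in>S. AE \<omega> in M.
        (let \<tau> = clock t0 (\<lambda>j. X j \<omega>) n in
           \<tau> < T \<or> (\<tau> = T \<and> X n \<omega> \<in> {-h, L + h}) \<longrightarrow>
           real_cond_exp M (history M X \<alpha> n) (indicator {\<omega>' \<in> space M. X (Suc n) \<omega>' = z}) \<omega>
             = kernel \<tau> (marg \<tau>) (\<alpha> n \<omega>) (X n \<omega>) z))"


subsection \<open>The discrete control problem\<close>

text \<open>
  Pathwise cost over \<open>[t,T]\<close> of a state trajectory \<open>\<xi>\<close> with control trajectory \<open>a\<close>. The reflection
  terms are Lebesgue-Stieltjes integrals; the right-continuous integrators are frozen outside
  \<open>[t,T]\<close> because \<open>interval_measure\<close> expects a distribution function on the whole line.
\<close>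

definition path_cost :: "real \<Rightarrow> (nat \<Rightarrow> real) \<Rightarrow> (nat \<Rightarrow> real) \<Rightarrow> real" where
  "path_cost t \<xi> a =
     (LINT s:{t..T}|lborel.
        f (grid_floor s) (marg (grid_floor s)) (\<xi> (step_at t \<xi> s)) (a (step_at t \<xi> s)))
     + g (marg T) (\<xi> (step_at t \<xi> T))
     + (LINT s:{t<..T}|interval_measure (\<lambda>s. refl_Y t \<xi> (max t (min T s))). y s (marg s))
     + (LINT s:{t<..T}|interval_measure (\<lambda>s. refl_R t \<xi> (max t (min T s))). r s (marg s))"

definition J :: "real \<Rightarrow> 'w measure \<Rightarrow> (nat \<Rightarrow> 'w \<Rightarrow> real) \<Rightarrow> (nat \<Rightarrow> 'w \<Rightarrow> real) \<Rightarrow> real" where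
  "J t M X \<alpha> = (\<integral>\<omega>. path_cost t (\<lambda>n. X n \<omega>) (\<lambda>n. \<alpha> n \<omega>) \<partial>M)"

text \<open>
  Conditioning on the state being \<open>x\<close> at time \<open>t\<close> means starting the chain from \<open>x\<close> at time \<open>t\<close>.
  The underlying sample spaces are the probability spaces over \<open>nat \<Rightarrow> real\<close>; this is no loss of
  generality, since an admissible control is a functional of the trajectory of the chain.
\<close>

definition V :: "real \<Rightarrow> real \<Rightarrow> real" where
  "V t x = Inf {J t M X \<alpha> | (M :: (nat \<Rightarrow> real) measure) X \<alpha>. controlled_chain t x M X \<alpha>}"

definition V_ext :: "real \<Rightarrow> real \<Rightarrow> real" where
  "V_ext s x =
     (if x = L + h then r s (marg s) * h + V s L
      else if x = - h then y s (marg s) * h + V s 0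
      else V s x)"

definition D_V :: "real \<Rightarrow> real \<Rightarrow> real" where
  "D_V t x = (V_ext (t + Delta) (x + h) - V_ext (t + Delta) (x - h)) / (2 * h)"

definition theta :: "real \<Rightarrow> real \<Rightarrow> real" where
  "theta t x = alpha_hat t (marg t) x (D_V t x)"

definition opt_control :: "real \<Rightarrow> real \<Rightarrow> real" where
  "opt_control t x = theta (grid_floor t) x"


subsection \<open>The map \<open>\<Phi>\<close>\<close>

text \<open>
  In a reflection step the kernel does not depend on the control, so the feedback is prescribed
  at the states of \<open>S0\<close> only.
\<close>

definition optimal_chain ::
  "'w measure \<Rightarrow> (nat \<Rightarrow> 'w \<Rightarrow> real) \<Rightarrow> (nat \<Rightarrow> 'w \<Rightarrow> real) \<Rightarrow> bool" where
  "optimal_chain M X \<alpha> \<longleftrightarrow>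
     controlled_chain 0 (real_of_int \<lfloor>x0 / h\<rfloor> * h) M X \<alpha> \<and>
     (\<forall>n. \<forall>\<omega>\<in>space M. let \<tau> = clock 0 (\<lambda>j. X j \<omega>) n in
        \<tau> < T \<and> X n \<omega> \<in> S0 \<longrightarrow> \<alpha> n \<omega> = opt_control \<tau> (X n \<omega>))"

definition interpolation :: "(nat \<Rightarrow> real) \<Rightarrow> real \<Rightarrow> real" where
  "interpolation \<xi> s =
     (let j = \<lfloor>s / Delta\<rfloor>;
          \<theta> = s / Delta - of_int j;
          v = (\<lambda>i. \<xi> (step_at 0 \<xi> (of_int i * Delta)))
      in (1 - \<theta>) * v j + \<theta> * v (j + 1))"

definition X_hat :: "(nat \<Rightarrow> real) \<Rightarrow> (real \<Rightarrow>\<^sub>C real)" where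
  "X_hat \<xi> = Bcontfun (\<lambda>s. interpolation \<xi> (max 0 (min T s)))"

text \<open>
  The law of the interpolated optimal chain is the same on every probability space carrying it.
  The interpolation lies in \<open>paths T L\<close> only almost surely, hence the law is first formed on the
  surrounding type and then restricted.
\<close>

definition Phi :: "(real \<Rightarrow>\<^sub>C real) measure" where
  "Phi = (THE \<mu>. \<exists>(M :: (nat \<Rightarrow> real) measure) X \<alpha>. optimal_chain M X \<alpha> \<and>
     \<mu> = restrict_space (distr M borel (\<lambda>\<omega>. X_hat (\<lambda>n. X n \<omega>))) (paths T L))"

end

end

theory Submission
  imports Defs
begin

text \<open>
  In terms of the states outside the reflection steps the chain is a nearest neighbour walk on the
  grid that is clamped at the ends. Driving two such walks by the same randomness, their distance
  grows by at most \<open>2 h\<close> in a step in which they move differently, which has probability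
  \<open>h |b - b'| / (2 \<sigma>\<^sup>2)\<close>. Hence the expected supremum distance is at most the integral of the expected
  difference of the drifts under optimal feedback, and it remains to control the difference quotients
  \<open>D V\<close> of the value functions: one needs
  \<open>|D V(t,x) - D V'(t,x')| \<le> C (T - t) powr (-1/2) (|x - x'| + W1(\<nu>,\<nu>'))\<close> with \<open>C\<close> independent
  of \<open>h\<close>. The singularity is integrable, so a discrete Gronwall argument then gives a contraction
  factor that tends to \<open>0\<close> with \<open>T\<close>.

  By dynamic programming the value function solves a discrete Hamilton--Jacobi--Bellman equation
  whose linear part is the average over the two neighbours. A Lipschitz bound follows by using the
  optimal control of one state for its neighbour. Difference quotients of the \<open>n\<close>-th power of the
  average are of order \<open>n powr (-1/2)\<close>, by the size of the central binomial coefficient. In Duhamel's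
  formula this estimate, applied to the differences of the value function in space (after removing
  the boundary fluxes, which by (A2) do not depend on the measure) and to the difference of two value
  functions, gives the two bounds on \<open>D V\<close>.
\<close>

subsection \<open>Smoothing by averaging\<close>

text \<open>The terminal cost is only Lipschitz, so second differences of the value function are not
  controlled near the horizon; the regularity of the feedback in the state has to be gained from the
  averaging. It is needed because two coupled walks come to occupy different states, where the two
  feedback controls are then compared. The averaging links \<open>k\<close> only to
  \<open>k + 1\<close> and \<open>k - 1\<close>, which is why the smoothing estimates concern
  differences over two grid points; the central quotient \<open>D V\<close> is of this kind. The
  other obstacle is the form of the statement: \<open>V\<close> is an infimum over chains on
  probability spaces, \<open>Phi\<close> is a definite description of a law, and reflection steps
  take no time. All of this is reduced to finite trees. A control adapted to the history is a
  function of the trajectory, hence constant on cylinders, so the expected cost of any chain is a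
  finite sum over walks. Comparing these sums with the recursion identifies \<open>V\<close>, and
  the same sums show that the law of the optimal chain is unique. The scaling
  \<open>Delta = h^2 / \<sigma>^2\<close> turns \<open>h * sqrt n\<close> into a multiple of the
  square root of the remaining time, so that no constant depends on \<open>h\<close>.\<close>

definition avg :: "(int \<Rightarrow> real) \<Rightarrow> int \<Rightarrow> real" where
  "avg \<phi> k = (\<phi> (k + 1) + \<phi> (k - 1)) / 2"

lemma avg_power:
  "(avg ^^ n) \<phi> k = (\<Sum>i\<le>n. real (n choose i) / 2 ^ n * \<phi> (k + 2 * int i - int n))"
proof (induction n arbitrary: k)
  case (Suc n)
  define F where "F i = \<phi> (k + 2 * int i - int (Suc n))" for i
  have 1: "(avg ^^ n) \<phi> (k + 1) = (\<Sum>i\<le>n. real (n choose i) * F (Suc i)) / 2 ^ n"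
    by (simp add: Suc F_def sum_divide_distrib algebra_simps)
  have 2: "(avg ^^ n) \<phi> (k - 1) = (\<Sum>i\<le>n. real (n choose i) * F i) / 2 ^ n"
    by (simp add: Suc F_def sum_divide_distrib algebra_simps)
  have "(\<Sum>i\<le>Suc n. real (Suc n choose i) * F i)
      = F 0 + (\<Sum>i\<le>n. real (n choose Suc i) * F (Suc i)) + (\<Sum>i\<le>n. real (n choose i) * F (Suc i))"
    by (simp add: sum.atMost_Suc_shift algebra_simps sum.distrib del: sum.atMost_Suc)
  also have "F 0 + (\<Sum>i\<le>n. real (n choose Suc i) * F (Suc i)) = (\<Sum>i\<le>Suc n. real (n choose i) * F i)"
    by (simp only: sum.atMost_Suc_shift) simp
  also have "\<dots> = (\<Sum>i\<le>n. real (n choose i) * F i)"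
    by simp
  finally have 3: "(\<Sum>i\<le>Suc n. real (Suc n choose i) * F i)
      = (\<Sum>i\<le>n. real (n choose i) * F i) + (\<Sum>i\<le>n. real (n choose i) * F (Suc i))" .
  have "(avg ^^ Suc n) \<phi> k = ((avg ^^ n) \<phi> (k + 1) + (avg ^^ n) \<phi> (k - 1)) / 2"
    by (simp add: avg_def)
  also have "\<dots> = (\<Sum>i\<le>Suc n. real (Suc n choose i) * F i) / 2 ^ Suc n"
    unfolding 1 2 3 by (simp add: field_simps)
  also have "\<dots> = (\<Sum>i\<le>Suc n. real (Suc n choose i) / 2 ^ Suc n * F i)"
    by (simp only: sum_divide_distrib) simp
  finally show ?case
    by (simp only: F_def)
qed simp

section \<open>Variation and size of the binomial weights\<close>

lemma summation_by_parts:
  fixes c G :: "nat \<Rightarrow> real"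
  shows "(\<Sum>i\<le>n. c i * (G (Suc i) - G i))
      = c n * G (Suc n) - c 0 * G 0 - (\<Sum>i<n. (c (Suc i) - c i) * G (Suc i))"
  by (induction n) (simp_all add: algebra_simps)

text \<open>A row of Pascal's triangle increases up to its middle entry and decreases after it, so
  the absolute increments telescope to the climb from \<open>1\<close> to the peak and the descent
  back to \<open>1\<close>.\<close>

lemma binomial_total_variation:
  "(\<Sum>i<n. \<bar>real (n choose Suc i) - real (n choose i)\<bar>) = 2 * real (n choose (n div 2)) - 2"
proof -
  let ?c = "\<lambda>i. real (n choose i)"
  let ?d = "n div 2"
  have 1: "e \<le> ?d \<Longrightarrow> (\<Sum>i<e. \<bar>?c (Suc i) - ?c i\<bar>) = ?c e - 1" for e
  proof (induction e)
    case (Suc e)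
    then have "n choose e \<le> n choose Suc e"
      by (intro binomial_mono) auto
    with Suc show ?case by simp
  qed simp
  have 2: "?d + e \<le> n \<Longrightarrow> (\<Sum>i<?d + e. \<bar>?c (Suc i) - ?c i\<bar>) = 2 * ?c ?d - 1 - ?c (?d + e)" for e
  proof (induction e)
    case 0
    then show ?case using 1[of ?d] by simp
  next
    case (Suc e)
    then have "n choose (?d + e) \<ge> n choose Suc (?d + e)"
      by (intro binomial_antimono) auto
    with Suc show ?case by simp
  qed
  show ?thesis using 2[of "n - ?d"] by simp
qed

lemma central_binomial_Suc:
  "(k + 1) * ((2 * k + 2) choose (k + 1)) = 2 * (2 * k + 1) * ((2 * k) choose k)"
proof -
  have a: "Suc (2 * k) choose Suc k = Suc (2 * k) choose k"
    using binomial_symmetric[of k "Suc (2 * k)"] by simp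
  have 1: "(2 * k + 2) choose (k + 1) = 2 * (Suc (2 * k) choose Suc k)"
    using a by simp
  have 2: "Suc (2 * k) * (2 * k choose k) = (Suc (2 * k) choose Suc k) * Suc k"
    by (rule Suc_times_binomial_eq)
  show ?thesis unfolding 1 using 2 by (simp only: Suc_eq_plus1 mult.commute mult.left_commute)
qed

text \<open>The factor \<open>2 * k + 1\<close> is chosen to survive the induction: passing to the
  next \<open>k\<close> multiplies the quotient by \<open>(2k + 1) / (2k + 2)\<close>, and
  \<open>(2k + 1) (2k + 3) \<le> (2k + 2)^2\<close>.\<close>

lemma central_binomial_even: "(real ((2 * k) choose k) / 4 ^ k)\<^sup>2 * (2 * k + 1) \<le> 1"
proof (induction k)
  case (Suc k)
  let ?x = "real ((2 * k) choose k) / 4 ^ k" and ?y = "real ((2 * Suc k) choose Suc k) / 4 ^ Suc k"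
  have "real (k + 1) * real ((2 * k + 2) choose (k + 1)) = 2 * (2 * real k + 1) * real ((2 * k) choose k)"
    using arg_cong[OF central_binomial_Suc[of k], of real] by (simp only: of_nat_mult) simp
  then have "real ((2 * Suc k) choose Suc k) = 2 * (2 * real k + 1) * real ((2 * k) choose k) / real (k + 1)"
    by (simp add: nonzero_eq_divide_eq mult.commute del: binomial_Suc_Suc)
  then have *: "?y = ?x * ((2 * k + 1) / (2 * k + 2))"
    by (simp add: divide_simps del: binomial_Suc_Suc) (simp add: algebra_simps)
  have "(2 * real k + 1) * (2 * real k + 3) \<le> (2 * real k + 2)\<^sup>2"
    by (simp add: power2_eq_square algebra_simps)
  then have "((2 * real k + 1) / (2 * k + 2))\<^sup>2 * (2 * real k + 3) \<le> 2 * real k + 1"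
    by (simp add: power_divide divide_le_eq power2_eq_square add.commute)
  then have "?x\<^sup>2 * (((2 * real k + 1) / (2 * k + 2))\<^sup>2 * (2 * real k + 3)) \<le> ?x\<^sup>2 * (2 * real k + 1)"
    by (intro mult_left_mono) auto
  also have "\<dots> \<le> 1" using Suc by (simp add: add.commute)
  finally show ?case unfolding * power_mult_distrib by (simp add: mult.assoc algebra_simps)
qed simp

text \<open>For odd \<open>n\<close> the middle coefficient is half of the central coefficient of
  the next row, so the even case for that row applies.\<close>

lemma central_binomial_upper: "real (n choose (n div 2)) / 2 ^ n \<le> 1 / sqrt (real n + 1)"
proof -
  have even_case: "real ((2 * k) choose k) / 4 ^ k \<le> 1 / sqrt (2 * real k + 1)" for k
  proof -
    have "(real ((2 * k) choose k) / 4 ^ k * sqrt (2 * real k + 1))\<^sup>2 \<le> 1\<^sup>2"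
      using central_binomial_even[of k] by (simp only: power_mult_distrib) (simp add: add.commute)
    then have "real ((2 * k) choose k) / 4 ^ k * sqrt (2 * real k + 1) \<le> 1"
      by (rule power2_le_imp_le) simp
    then show ?thesis by (simp add: field_simps)
  qed
  show ?thesis
  proof (cases "even n")
    case True
    then obtain k where "n = 2 * k" by blast
    then show ?thesis using even_case[of k] by (simp add: power_mult)
  next
    case False
    then obtain k where n: "n = 2 * k + 1" by (auto elim: oddE)
    have "Suc (2 * k) choose Suc k = Suc (2 * k) choose k"
      using binomial_symmetric[of k "Suc (2 * k)"] by simp
    then have "(2 * Suc k) choose Suc k = 2 * (n choose (n div 2))"
      by (simp add: n)
    then have "real (n choose (n div 2)) / 2 ^ n = real ((2 * Suc k) choose Suc k) / 4 ^ Suc k"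
      by (simp add: n power_mult del: binomial_Suc_Suc)
    also have "\<dots> \<le> 1 / sqrt (2 * real (Suc k) + 1)" by (rule even_case)
    also have "\<dots> \<le> 1 / sqrt (real n + 1)"
      by (intro divide_left_mono) (auto simp: n)
    finally show ?thesis .
  qed
qed

text \<open>Shifting the argument by two shifts the summation index by one. Summation by parts
  therefore moves the difference from \<open>\<phi>\<close> to the binomial coefficients, whose
  total variation is governed by the central one; of \<open>\<phi>\<close> only the bound
  \<open>A\<close> is used. The boundary terms contribute at most \<open>2 * A\<close>, which the
  summand \<open>- 2\<close> in the total variation makes up for.\<close>

lemma avg_power_difference:
  assumes "\<And>k. \<bar>\<phi> k\<bar> \<le> A"
  shows "\<bar>(avg ^^ n) \<phi> (k + 1) - (avg ^^ n) \<phi> (k - 1)\<bar> \<le> 2 * A / sqrt (real n + 1)"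
proof -
  define G where "G i = \<phi> (k - 1 + 2 * int i - int n)" for i
  let ?c = "\<lambda>i. real (n choose i)"
  have A0: "0 \<le> A" using assms[of 0] by linarith
  have "(avg ^^ n) \<phi> (k + 1) - (avg ^^ n) \<phi> (k - 1) = (\<Sum>i\<le>n. ?c i * (G (Suc i) - G i)) / 2 ^ n"
    unfolding avg_power G_def sum_subtractf[symmetric] sum_divide_distrib
    by (rule sum.cong) (auto simp: field_simps)
  also have "\<bar>\<dots>\<bar> \<le> (2 * A * ?c (n div 2)) / 2 ^ n"
  proof -
    have G: "\<bar>G i\<bar> \<le> A" for i using assms by (simp add: G_def)
    have "\<bar>\<Sum>i<n. (?c (Suc i) - ?c i) * G (Suc i)\<bar> \<le> (\<Sum>i<n. \<bar>?c (Suc i) - ?c i\<bar> * A)"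
      by (intro order_trans[OF sum_abs] sum_mono) (auto simp: abs_mult intro!: mult_left_mono G)
    also have "\<dots> = (2 * ?c (n div 2) - 2) * A"
      unfolding sum_distrib_right[symmetric] binomial_total_variation ..
    finally have "\<bar>\<Sum>i\<le>n. ?c i * (G (Suc i) - G i)\<bar> \<le> 2 * A * ?c (n div 2)"
      using G[of 0] G[of "Suc n"] summation_by_parts[of ?c G n]
      by (simp add: left_diff_distrib) (simp add: algebra_simps)
    then show ?thesis by (simp add: divide_right_mono)
  qed
  also have "\<dots> = 2 * A * (?c (n div 2) / 2 ^ n)" by simp
  also have "\<dots> \<le> 2 * A * (1 / sqrt (real n + 1))"
    by (intro mult_left_mono central_binomial_upper) (use A0 in auto)
  finally show ?thesis by simp
qed

text \<open>Duhamel's formula in discrete time: the source of step \<open>i\<close> passes through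
  the \<open>n - Suc i\<close> averagings that follow it.\<close>

lemma avg_recursion_unfold:
  assumes "\<And>i k. i < n \<Longrightarrow> u (Suc i) k = avg (u i) k + s i k"
  shows "u n k = (avg ^^ n) (u 0) k + (\<Sum>i<n. (avg ^^ (n - Suc i)) (s i) k)"
  using assms
proof (induction n arbitrary: k)
  case (Suc n)
  have IH: "u n k = (avg ^^ n) (u 0) k + (\<Sum>i<n. (avg ^^ (n - Suc i)) (s i) k)" for k
    using Suc by simp
  have 1: "(avg ^^ (Suc n - Suc i)) (s i) k
      = ((avg ^^ (n - Suc i)) (s i) (k + 1) + (avg ^^ (n - Suc i)) (s i) (k - 1)) / 2" if "i < n" for i
  proof -
    from that have "Suc n - Suc i = Suc (n - Suc i)" by simp
    then show ?thesis by (simp only: funpow.simps o_apply) (simp add: avg_def)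
  qed
  have "u (Suc n) k = avg (u n) k + s n k" using Suc.prems by simp
  also have "avg (u n) k = (avg ^^ Suc n) (u 0) k + (\<Sum>i<n. (avg ^^ (Suc n - Suc i)) (s i) k)"
  proof -
    have "(\<Sum>i<n. (avg ^^ (Suc n - Suc i)) (s i) k)
       = (\<Sum>i<n. ((avg ^^ (n - Suc i)) (s i) (k + 1) + (avg ^^ (n - Suc i)) (s i) (k - 1)) / 2)"
      by (rule sum.cong[OF refl]) (use 1 in auto)
    then show ?thesis
      by (simp add: avg_def IH sum.distrib sum_divide_distrib add_divide_distrib)
  qed
  finally show ?case by simp
qed simp

text \<open>The source of step \<open>i\<close> has been averaged \<open>n - Suc i\<close> times,
  whence the denominator \<open>sqrt (n - i)\<close>; for the newest source it is
  \<open>1\<close>.\<close>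

lemma smoothing:
  assumes "\<And>i k. i < n \<Longrightarrow> u (Suc i) k = avg (u i) k + s i k"
    and "\<And>k. \<bar>u 0 k\<bar> \<le> A" and s: "\<And>i k. i < n \<Longrightarrow> \<bar>s i k\<bar> \<le> e i"
  shows "\<bar>u n (k + 1) - u n (k - 1)\<bar> \<le> 2 * A / sqrt (real n + 1) + (\<Sum>i<n. 2 * e i / sqrt (real (n - i)))"
proof -
  have "u n (k + 1) - u n (k - 1) = ((avg ^^ n) (u 0) (k + 1) - (avg ^^ n) (u 0) (k - 1))
     + (\<Sum>i<n. (avg ^^ (n - Suc i)) (s i) (k + 1) - (avg ^^ (n - Suc i)) (s i) (k - 1))"
    by (simp add: avg_recursion_unfold[of n u s, OF assms(1)] sum_subtractf)
  also have "\<bar>\<dots>\<bar> \<le> 2 * A / sqrt (real n + 1) + (\<Sum>i<n. 2 * e i / sqrt (real (n - i)))"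
  proof (intro order_trans[OF abs_triangle_ineq] add_mono avg_power_difference assms(2)
      order_trans[OF sum_abs] sum_mono)
    fix i assume "i \<in> {..<n}"
    then show "\<bar>(avg ^^ (n - Suc i)) (s i) (k + 1) - (avg ^^ (n - Suc i)) (s i) (k - 1)\<bar>
         \<le> 2 * e i / sqrt (real (n - i))"
      using avg_power_difference[of "s i" "e i" "n - Suc i" k] s
      by (simp add: of_nat_diff)
  qed
  finally show ?thesis .
qed

section \<open>Sums with inverse square root singularities\<close>

lemma sum_inverse_sqrt: "(\<Sum>i<n. 1 / sqrt (real i + 1)) \<le> 2 * sqrt (real n)"
proof (induction n)
  case (Suc n)
  have "2 * sqrt (real n) * sqrt (real n + 1) \<le> real n + (real n + 1)"
    using sum_squares_bound[of "sqrt (real n)" "sqrt (real n + 1)"] by simp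
  then have "2 * sqrt (real n) + 1 / sqrt (real n + 1) \<le> 2 * sqrt (real n + 1)"
    by (simp add: field_simps)
  with Suc show ?case by (simp add: add.commute)
qed simp

lemma sum_inverse_sqrt_rev: "(\<Sum>i<n. 1 / sqrt (real (n - i))) \<le> 2 * sqrt (real n)"
proof -
  have "(\<Sum>i<n. 1 / sqrt (real (n - i))) = (\<Sum>i<n. 1 / sqrt (real (n - (n - Suc i))))"
    by (rule sum.nat_diff_reindex[symmetric])
  also have "\<dots> = (\<Sum>i<n. 1 / sqrt (real i + 1))"
    by (rule sum.cong) (auto simp: add.commute of_nat_diff)
  finally show ?thesis using sum_inverse_sqrt by simp
qed

text \<open>A discrete Beta integral with both exponents \<open>1/2\<close>, hence bounded
  independently of \<open>n\<close>. The two arguments of the roots add up to \<open>n + 1\<close>,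
  so the larger one is at least half of that; its root is taken out, which leaves single inverse
  roots to be summed.\<close>

lemma sum_beta: "(\<Sum>i<n. 1 / (sqrt (real i + 1) * sqrt (real (n - i)))) \<le> 6"
proof -
  have aux: "1 / (sqrt p * sqrt q) \<le> sqrt 2 / sqrt (p + q) * (1 / sqrt p + 1 / sqrt q)"
    if "0 < p" "0 < q" for p q :: real
  proof -
    have w: "1 / (sqrt p * sqrt q) \<le> sqrt 2 / sqrt (p + q) * (1 / sqrt p + 1 / sqrt q)"
      if "0 < p" "p \<le> q" for p q :: real
    proof -
      have "sqrt (p + q) \<le> sqrt (2 * q)" using that by simp
      then have "1 / sqrt q \<le> sqrt 2 / sqrt (p + q)"
        using that by (simp add: real_sqrt_mult field_simps)
      then have "1 / sqrt q * (1 / sqrt p) \<le> sqrt 2 / sqrt (p + q) * (1 / sqrt p)"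
        using that by (intro mult_right_mono) auto
      moreover have "0 \<le> sqrt 2 / sqrt (p + q) * (1 / sqrt q)" using that by simp
      ultimately show ?thesis by (simp add: distrib_left mult.commute add_divide_distrib)
    qed
    show ?thesis
      using w[of p q] w[of q p] that by (cases "p \<le> q") (auto simp: add.commute mult.commute)
  qed
  have "(\<Sum>i<n. 1 / (sqrt (real i + 1) * sqrt (real (n - i))))
      \<le> (\<Sum>i<n. sqrt 2 / sqrt (real n + 1) * (1 / sqrt (real i + 1) + 1 / sqrt (real (n - i))))"
  proof (rule sum_mono)
    fix i assume "i \<in> {..<n}"
    then have e: "(real i + 1) + real (n - i) = real n + 1" by (simp add: of_nat_diff)
    then show "1 / (sqrt (real i + 1) * sqrt (real (n - i)))
       \<le> sqrt 2 / sqrt (real n + 1) * (1 / sqrt (real i + 1) + 1 / sqrt (real (n - i)))"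
      using aux[of "real i + 1" "real (n - i)", unfolded e] \<open>i \<in> {..<n}\<close> by simp
  qed
  also have "\<dots> = sqrt 2 / sqrt (real n + 1) * ((\<Sum>i<n. 1 / sqrt (real i + 1)) + (\<Sum>i<n. 1 / sqrt (real (n - i))))"
    by (simp only: sum_distrib_left[symmetric] sum.distrib)
  also have "\<dots> \<le> sqrt 2 / sqrt (real n + 1) * (2 * sqrt (real n) + 2 * sqrt (real n))"
    by (intro mult_left_mono add_mono sum_inverse_sqrt sum_inverse_sqrt_rev) simp
  also have "\<dots> = 4 * sqrt 2 * (sqrt (real n) / sqrt (real n + 1))" by simp
  also have "\<dots> \<le> 4 * sqrt 2 * 1"
    by (intro mult_left_mono) auto
  also have "\<dots> \<le> 6"
  proof -
    have "sqrt 2 \<le> 3 / 2" by (rule real_le_lsqrt) (auto simp: power2_eq_square)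
    then show ?thesis by simp
  qed
  finally show ?thesis .
qed

text \<open>
  The Gronwall argument with the integrable singularity \<open>1 / sqrt\<close>; \<open>X\<close> stands for a bound of the
  central difference quotient, on which the source term is allowed to depend.
\<close>

lemma singular_gronwall:
  fixes u s :: "nat \<Rightarrow> int \<Rightarrow> real"
  assumes pos: "0 < h" "0 < \<sigma>" "0 \<le> e" "0 \<le> A" "0 \<le> C" "0 \<le> B"
    and Delta: "\<Delta> = h\<^sup>2 / \<sigma>\<^sup>2"
    and rec: "\<And>n k. n < N \<Longrightarrow> u (Suc n) k = avg (u n) k + s n k"
    and init: "\<And>k. \<bar>u 0 k\<bar> \<le> e * A"
    and src: "\<And>n X k. n < N \<Longrightarrow> 0 \<le> X \<Longrightarrow> (\<And>k. \<bar>u n (k + 1) - u n (k - 1)\<bar> \<le> 2 * h * e * X)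
       \<Longrightarrow> \<bar>s n k\<bar> \<le> e * \<Delta> * (C + B * X)"
    and small: "12 * B * sqrt (real (N + 1) * \<Delta>) \<le> \<sigma>" "real (N + 1) * \<Delta> \<le> \<tau>"
    and "n \<le> N"
  shows "\<bar>u n (k + 1) - u n (k - 1)\<bar> \<le> 2 * h * e * ((2 * A + 4 * C * \<tau>) / (h * sqrt (real n + 1)))"
  using \<open>n \<le> N\<close>
proof (induction n arbitrary: k rule: less_induct)
  case (less n)
  \<comment> \<open>\<open>M\<close> is the solution of
    \<open>A + 2 * C * \<tau> + M / 2 = M\<close>. The part \<open>M / 2\<close> is the feedback of
    the difference quotient through the source. Assumption \<open>small\<close> is what bounds it
    so: its constant \<open>12\<close> is twice the \<open>6\<close> of
    \<open>sum_beta\<close>.\<close>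
  define M where "M = 2 * A + 4 * C * \<tau>"
  have D0: "0 < \<Delta>" using pos by (simp add: Delta)
  have "0 \<le> real (N + 1) * \<Delta>" using D0 by simp
  then have "0 \<le> \<tau>" using small by linarith
  then have M0: "0 \<le> M" using pos by (simp add: M_def)
  let ?X = "\<lambda>i. M / (h * sqrt (real i + 1))"
  have s: "\<bar>s i k\<bar> \<le> e * \<Delta> * (C + B * ?X i)" if "i < n" for i k
  proof (rule src)
    show "i < N" "0 \<le> ?X i" using that less.prems M0 pos by auto
    show "\<bar>u i (k + 1) - u i (k - 1)\<bar> \<le> 2 * h * e * ?X i" for k
      using less.IH[of i k] that less.prems by (simp add: M_def)
  qed
  have sn: "0 < sqrt (real n + 1)" by simp
  have "\<bar>u n (k + 1) - u n (k - 1)\<bar>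
      \<le> 2 * (e * A) / sqrt (real n + 1) + (\<Sum>i<n. 2 * (e * \<Delta> * (C + B * ?X i)) / sqrt (real (n - i)))"
    by (rule smoothing[where u = u and s = s]) (use less.prems rec init s in auto)
  also have "(\<Sum>i<n. 2 * (e * \<Delta> * (C + B * ?X i)) / sqrt (real (n - i)))
     = 2 * e * \<Delta> * C * (\<Sum>i<n. 1 / sqrt (real (n - i)))
       + 2 * e * \<Delta> * B * M / h * (\<Sum>i<n. 1 / (sqrt (real i + 1) * sqrt (real (n - i))))"
    unfolding sum_distrib_left sum.distrib[symmetric]
    using pos by (intro sum.cong) (auto simp: field_simps)
  also have "\<dots> \<le> 2 * e * \<Delta> * C * (2 * sqrt (real n)) + 2 * e * \<Delta> * B * M / h * 6"
    using pos D0 M0 by (intro add_mono mult_left_mono sum_inverse_sqrt_rev sum_beta) auto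
  also have "\<dots> = 2 * e * (\<Delta> * C * (2 * sqrt (real n)) + 6 * \<Delta> * B * M / h)"
    by (simp add: algebra_simps)
  also have "\<dots> \<le> 2 * e * ((2 * C * \<tau> + M / 2) / sqrt (real n + 1))"
  proof (rule mult_left_mono)
    have nD: "real (n + 1) * \<Delta> \<le> real (N + 1) * \<Delta>"
      using less.prems D0 by (intro mult_right_mono) auto
    have "sqrt (real n) * sqrt (real n + 1) \<le> sqrt (real n + 1) * sqrt (real n + 1)"
      by (intro mult_right_mono) auto
    then have "\<Delta> * C * (2 * sqrt (real n)) * sqrt (real n + 1) \<le> 2 * C * (real (n + 1) * \<Delta>)"
      using mult_left_mono[of "sqrt (real n) * sqrt (real n + 1)" "real n + 1" "2 * \<Delta> * C"] D0 pos
      by (simp add: algebra_simps)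
    also have "\<dots> \<le> 2 * C * \<tau>" using nD small(2) pos by (intro mult_left_mono) auto
    finally have 1: "\<Delta> * C * (2 * sqrt (real n)) * sqrt (real n + 1) \<le> 2 * C * \<tau>" .
    \<comment> \<open>Parabolic scaling: \<open>h * sqrt (n + 1)\<close> is \<open>\<sigma>\<close>
      times the square root of the time taken by \<open>n + 1\<close> steps.\<close>
    have "sqrt (real (n + 1) * \<Delta>) = sqrt (real n + 1) * h / \<sigma>"
      using pos by (simp add: Delta real_sqrt_mult real_sqrt_divide add.commute)
    then have eq: "\<Delta> / h * sqrt (real n + 1) = sqrt (real (n + 1) * \<Delta>) / \<sigma>"
      using pos by (simp add: Delta power2_eq_square)
    have "sqrt (real (n + 1) * \<Delta>) \<le> sqrt (real (N + 1) * \<Delta>)"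
      using nD by simp
    then have "12 * B * sqrt (real (n + 1) * \<Delta>) \<le> 12 * B * sqrt (real (N + 1) * \<Delta>)"
      using pos by (intro mult_left_mono) auto
    then have "12 * B * (\<Delta> / h * sqrt (real n + 1)) \<le> 1"
      unfolding eq using small(1) pos by (simp add: field_simps)
    then have "M / 2 * (12 * B * (\<Delta> / h * sqrt (real n + 1))) \<le> M / 2 * 1"
      using M0 by (intro mult_left_mono) auto
    then have 2: "6 * \<Delta> * B * M / h * sqrt (real n + 1) \<le> M / 2"
      by (simp add: algebra_simps)
    show "\<Delta> * C * (2 * sqrt (real n)) + 6 * \<Delta> * B * M / h \<le> (2 * C * \<tau> + M / 2) / sqrt (real n + 1)"
      unfolding pos_le_divide_eq[OF sn] using 1 2 by (simp only: distrib_right)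
  qed (use pos in auto)
  also have "2 * (e * A) / sqrt (real n + 1) + 2 * e * ((2 * C * \<tau> + M / 2) / sqrt (real n + 1))
      = 2 * e * (M / sqrt (real n + 1))"
    by (simp add: M_def field_simps)
  also have "\<dots> = 2 * h * e * (M / (h * sqrt (real n + 1)))"
    using pos by simp
  finally show ?case by (simp add: M_def)
qed

subsection \<open>Folding the line onto a segment\<close>

text \<open>
  Composition with \<open>fold_map\<close> is the even reflection about \<open>-1/2\<close> and \<open>m + 1/2\<close>: it turns the
  average over the neighbours of the reflecting walk on \<open>{0..m}\<close> into \<open>avg\<close> on all integers.
\<close>

definition clamp :: "int \<Rightarrow> int \<Rightarrow> int" where
  "clamp m k = max 0 (min m k)"

definition fold_map :: "int \<Rightarrow> int \<Rightarrow> int" where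
  "fold_map m k = (let q = k mod (2 * (m + 1)) in if q \<le> m then q else 2 * m + 1 - q)"

lemma fold_map_range: "0 \<le> m \<Longrightarrow> fold_map m k \<in> {0..m}"
proof -
  assume "0 \<le> m"
  moreover define q where "q = k mod (2 * (m + 1))"
  ultimately have "0 \<le> q" "q < 2 * (m + 1)" by simp_all
  then show ?thesis
    unfolding fold_map_def Let_def q_def[symmetric] by auto
qed

lemma fold_map_id: "k \<in> {0..m} \<Longrightarrow> fold_map m k = k"
  by (simp add: fold_map_def)

lemma mod_succ_int: "0 < P \<Longrightarrow> (k + 1) mod P = (if k mod P + 1 = P then 0 else k mod (P::int) + 1)"
  by (smt (verit) mod_add_left_eq mod_pos_pos_trivial mod_self pos_mod_bound pos_mod_sign)

lemma mod_pred_int: "0 < P \<Longrightarrow> (k - 1) mod P = (if k mod P = 0 then P - 1 else k mod (P::int) - 1)"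
  using mod_succ_int[of P "k - 1"] pos_mod_bound[of P "k - 1"] pos_mod_sign[of P "k - 1"]
  by (smt (verit))

text \<open>On the mirrored copies of the segment the orientation is reversed, so the two neighbours
  may be exchanged. The symmetric \<open>avg\<close> does not notice this, nor does the absolute
  value of a difference over two points.\<close>

lemma fold_map_step:
  assumes "0 \<le> m"
  shows "fold_map m (k + 1) = clamp m (fold_map m k + 1) \<and> fold_map m (k - 1) = clamp m (fold_map m k - 1) \<or>
    fold_map m (k + 1) = clamp m (fold_map m k - 1) \<and> fold_map m (k - 1) = clamp m (fold_map m k + 1)"
proof -
  have P: "0 < 2 * (m + 1)" using assms by simp
  define q where "q = k mod (2 * (m + 1))"
  have q: "0 \<le> q" "q < 2 * (m + 1)" using P by (simp_all add: q_def)
  have "q < m \<or> q = m \<or> (m < q \<and> q < 2 * m + 1) \<or> q = 2 * m + 1" using q by presburger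
  then consider "q < m" | "q = m" | "m < q" "q < 2 * m + 1" | "q = 2 * m + 1" by blast
  then show ?thesis
    using q assms
    unfolding fold_map_def Let_def mod_succ_int[OF P] mod_pred_int[OF P] clamp_def q_def[symmetric]
    by cases auto
qed

lemma fold_map_neighbours:
  assumes "k \<in> {0..m}"
  shows "fold_map m (k + 1) = clamp m (k + 1)" "fold_map m (k - 1) = clamp m (k - 1)"
proof -
  have P: "0 < 2 * (m + 1)" using assms by simp
  have k: "k mod (2 * (m + 1)) = k" using assms by simp
  show "fold_map m (k + 1) = clamp m (k + 1)" "fold_map m (k - 1) = clamp m (k - 1)"
    using assms unfolding fold_map_def Let_def mod_succ_int[OF P] mod_pred_int[OF P] clamp_def k
    by (auto split: if_splits)
qed

lemma clamp_range: "0 \<le> m \<Longrightarrow> clamp m k \<in> {0..m}"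
  by (auto simp: clamp_def)

lemma clamp_id: "k \<in> {0..m} \<Longrightarrow> clamp m k = k"
  by (auto simp: clamp_def)

subsection \<open>The dynamic programming recursion on a grid\<close>

text \<open>
  The state \<open>k\<close> stands for the position \<open>k * h\<close> in \<open>[0, m * h]\<close>. The time index counts the
  remaining steps: \<open>f n\<close>, \<open>b n\<close>, \<open>a n\<close> belong to the step from \<open>Suc n\<close> to \<open>n\<close> remaining steps,
  whereas \<open>y n\<close>, \<open>r n\<close> are reflection costs paid when \<open>n\<close> steps remain.
\<close>

locale grid_problem =
  fixes m :: int and h \<sigma> \<Delta> :: real and U :: "real set"
    and f b :: "nat \<Rightarrow> int \<Rightarrow> real \<Rightarrow> real" and g :: "int \<Rightarrow> real" and y r :: "nat \<Rightarrow> real"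
    and a :: "nat \<Rightarrow> int \<Rightarrow> real \<Rightarrow> real" and c R B :: real
  assumes m_pos: "1 \<le> m" and h_pos: "0 < h" and \<sigma>_pos: "0 < \<sigma>" and Delta_eq: "\<Delta> = h\<^sup>2 / \<sigma>\<^sup>2"
    and hB: "h * B \<le> \<sigma>\<^sup>2" and c_nonneg: "0 \<le> c" and B_nonneg: "0 \<le> B" and R_nonneg: "0 \<le> R"
    and f_lip: "\<lbrakk>k \<in> {0..m}; k' \<in> {0..m}; u \<in> U\<rbrakk> \<Longrightarrow> \<bar>f n k u - f n k' u\<bar> \<le> c * (h * \<bar>k - k'\<bar>)"
    and b_lip: "\<lbrakk>k \<in> {0..m}; k' \<in> {0..m}; u \<in> U\<rbrakk> \<Longrightarrow> \<bar>b n k u - b n k' u\<bar> \<le> c * (h * \<bar>k - k'\<bar>)"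
    and g_lip: "\<lbrakk>k \<in> {0..m}; k' \<in> {0..m}\<rbrakk> \<Longrightarrow> \<bar>g k - g k'\<bar> \<le> c * (h * \<bar>k - k'\<bar>)"
    and b_bound: "\<lbrakk>k \<in> {0..m}; u \<in> U\<rbrakk> \<Longrightarrow> \<bar>b n k u\<bar> \<le> B"
    and y_bound: "\<bar>y n\<bar> \<le> R" and r_bound: "\<bar>r n\<bar> \<le> R"
    and y_time: "\<bar>y (Suc n) - y n\<bar> \<le> c * \<Delta>" and r_time: "\<bar>r (Suc n) - r n\<bar> \<le> c * \<Delta>"
    and a_in: "k \<in> {0..m} \<Longrightarrow> a n k p \<in> U"
    and a_min: "\<lbrakk>k \<in> {0..m}; u \<in> U\<rbrakk> \<Longrightarrow>
       f n k (a n k p) + b n k (a n k p) * p \<le> f n k u + b n k u * p"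
begin

definition ext :: "nat \<Rightarrow> (int \<Rightarrow> real) \<Rightarrow> int \<Rightarrow> real" where
  "ext n \<phi> k = (if m < k then r n * h + \<phi> m else if k < 0 then y n * h + \<phi> 0 else \<phi> k)"

definition slope :: "nat \<Rightarrow> (int \<Rightarrow> real) \<Rightarrow> int \<Rightarrow> real" where
  "slope n \<phi> k = (ext n \<phi> (k + 1) - ext n \<phi> (k - 1)) / (2 * h)"

definition ham :: "nat \<Rightarrow> int \<Rightarrow> real \<Rightarrow> real" where
  "ham n k p = f n k (a n k p) + b n k (a n k p) * p"

primrec val :: "nat \<Rightarrow> int \<Rightarrow> real" where
  "val 0 = g"
| "val (Suc n) = (\<lambda>k. avg (ext n (val n)) k + \<Delta> * ham n k (slope n (val n) k))"

abbreviation val_slope :: "nat \<Rightarrow> int \<Rightarrow> real" where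
  "val_slope n \<equiv> slope n (val n)"

definition prob_up :: "nat \<Rightarrow> int \<Rightarrow> real \<Rightarrow> real" where
  "prob_up n k u = (h * b n k u + \<sigma>\<^sup>2) / (2 * \<sigma>\<^sup>2)"

lemma Delta_pos: "0 < \<Delta>"
  using h_pos \<sigma>_pos by (simp add: Delta_eq)

lemma prob_up_range: "k \<in> {0..m} \<Longrightarrow> u \<in> U \<Longrightarrow> prob_up n k u \<in> {0..1}"
proof -
  assume "k \<in> {0..m}" "u \<in> U"
  then have "\<bar>h * b n k u\<bar> \<le> h * B"
    using b_bound[of k u n] h_pos by (simp add: abs_mult)
  then have "\<bar>h * b n k u\<bar> \<le> \<sigma>\<^sup>2" using hB by linarith
  then show ?thesis
    using \<sigma>_pos unfolding prob_up_def by (auto simp: divide_simps abs_le_iff)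
qed

text \<open>A biased step is an unbiased one plus drift times central difference quotient; with
  \<open>\<Delta> = h^2 / \<sigma>^2\<close> the weight of the drift is exactly
  \<open>\<Delta>\<close>. This translates between the Hamilton--Jacobi--Bellman form of
  \<open>val\<close> and the transition probabilities.\<close>

lemma step_as_drift:
  "prob_up n k u * \<phi> (k + 1) + (1 - prob_up n k u) * \<phi> (k - 1)
     = avg \<phi> k + \<Delta> * (b n k u * ((\<phi> (k + 1) - \<phi> (k - 1)) / (2 * h)))"
  using h_pos \<sigma>_pos
  by (simp add: prob_up_def avg_def Delta_eq power2_eq_square field_simps)

lemma ham_le: "k \<in> {0..m} \<Longrightarrow> u \<in> U \<Longrightarrow> ham n k p \<le> f n k u + b n k u * p"
  unfolding ham_def by (rule a_min)

text \<open>The recursion read as a one-step Bellman inequality. With the equality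
  \<open>val_Suc_eq\<close> for the minimizing control it serves twice: for the Lipschitz bound and
  for the verification that \<open>val\<close> is the value of the control problem.\<close>

lemma val_Suc_le:
  assumes "k \<in> {0..m}" "u \<in> U"
  shows "val (Suc n) k \<le> \<Delta> * f n k u + prob_up n k u * ext n (val n) (k + 1)
     + (1 - prob_up n k u) * ext n (val n) (k - 1)"
proof -
  have "val (Suc n) k \<le> avg (ext n (val n)) k + \<Delta> * (f n k u + b n k u * val_slope n k)"
    using ham_le[OF assms, of n "val_slope n k"] Delta_pos by simp
  also have "\<dots> = \<Delta> * f n k u + (prob_up n k u * ext n (val n) (k + 1)
     + (1 - prob_up n k u) * ext n (val n) (k - 1))"
    unfolding step_as_drift slope_def by (simp add: algebra_simps)
  finally show ?thesis by simp
qed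

lemma val_Suc_eq:
  assumes "u = a n k (val_slope n k)"
  shows "val (Suc n) k = \<Delta> * f n k u + prob_up n k u * ext n (val n) (k + 1)
     + (1 - prob_up n k u) * ext n (val n) (k - 1)"
proof -
  have "val (Suc n) k = \<Delta> * f n k u + (avg (ext n (val n)) k + \<Delta> * (b n k u * val_slope n k))"
    unfolding val.simps ham_def assms[symmetric] by (simp add: algebra_simps)
  then show ?thesis
    unfolding slope_def step_as_drift[symmetric] by simp
qed

text \<open>Each minimizer is a competitor in the other minimization, so no continuity of
  \<open>a\<close> enters.\<close>

lemma ham_diff_le:
  assumes "k \<in> {0..m}" "k' \<in> {0..m}"
  shows "\<bar>ham n k p - ham n k' p'\<bar> \<le> c * (h * \<bar>k - k'\<bar>) * (1 + \<bar>p\<bar>) + B * \<bar>p - p'\<bar>"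
proof -
  \<comment> \<open>Both orientations carry the weight \<open>1 + \<bar>q\<bar>\<close> of the same
    slope \<open>q\<close>. The second one is for the exchanged states: the bound must still contain
    \<open>\<bar>p\<bar>\<close> there, not \<open>\<bar>p'\<bar>\<close>.\<close>
  have main: "f n k u + b n k u * q - (f n k' u + b n k' u * q')
       \<le> c * (h * \<bar>k - k'\<bar>) * (1 + \<bar>q\<bar>) + B * \<bar>q - q'\<bar>"
    "f n k u + b n k u * q' - (f n k' u + b n k' u * q)
       \<le> c * (h * \<bar>k - k'\<bar>) * (1 + \<bar>q\<bar>) + B * \<bar>q - q'\<bar>"
    if "u \<in> U" "k \<in> {0..m}" "k' \<in> {0..m}" for u q q' k k'
  proof -
    have 1: "\<bar>b n k u * q - b n k' u * q\<bar> \<le> c * (h * \<bar>k - k'\<bar>) * \<bar>q\<bar>"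
      using b_lip[OF that(2,3,1), of n] by (simp add: left_diff_distrib[symmetric] abs_mult mult_right_mono)
    have 2: "\<bar>b n k' u * q - b n k' u * q'\<bar> \<le> B * \<bar>q - q'\<bar>" "\<bar>b n k u * q' - b n k u * q\<bar> \<le> B * \<bar>q - q'\<bar>"
      using b_bound[OF that(3,1), of n] b_bound[OF that(2,1), of n]
      by (simp_all add: right_diff_distrib[symmetric] abs_mult mult_right_mono abs_minus_commute)
    have 3: "\<bar>f n k u - f n k' u\<bar> \<le> c * (h * \<bar>k - k'\<bar>)" by (rule f_lip[OF that(2,3,1)])
    show "f n k u + b n k u * q - (f n k' u + b n k' u * q')
       \<le> c * (h * \<bar>k - k'\<bar>) * (1 + \<bar>q\<bar>) + B * \<bar>q - q'\<bar>"
      "f n k u + b n k u * q' - (f n k' u + b n k' u * q)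
       \<le> c * (h * \<bar>k - k'\<bar>) * (1 + \<bar>q\<bar>) + B * \<bar>q - q'\<bar>"
      unfolding distrib_left using 1 2 3 by linarith+
  qed
  have "ham n k p - ham n k' p' \<le> c * (h * \<bar>k - k'\<bar>) * (1 + \<bar>p\<bar>) + B * \<bar>p - p'\<bar>"
    using ham_le[OF assms(1) a_in[OF assms(2)], of n p n p'] main(1)[OF a_in[OF assms(2), of n p'] assms, where q = p and q' = p']
    unfolding ham_def by linarith
  moreover have "ham n k' p' - ham n k p \<le> c * (h * \<bar>k - k'\<bar>) * (1 + \<bar>p\<bar>) + B * \<bar>p - p'\<bar>"
    using ham_le[OF assms(2) a_in[OF assms(1)], of n p' n p] main(2)[OF a_in[OF assms(1), of n p] assms(2,1), where q = p and q' = p']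
    unfolding ham_def by (simp add: abs_minus_commute)
  ultimately show ?thesis by linarith
qed

subsubsection \<open>Lipschitz bound\<close>

text \<open>The solution of \<open>K (Suc n) + 1 = (1 + c * \<Delta>) * (K n + 1)\<close>. The start
  \<open>max c R\<close> takes account of the terminal cost, with Lipschitz constant
  \<open>c\<close>, and of the values beyond the ends in \<open>ext\<close>, which have slope at
  most \<open>R\<close>.\<close>

definition lip_const :: "nat \<Rightarrow> real" where
  "lip_const n = (max c R + 1) * (1 + c * \<Delta>) ^ n - 1"

lemma lip_const_ge: "max c R \<le> lip_const n"
proof -
  have "1 \<le> (1 + c * \<Delta>) ^ n"
    using c_nonneg Delta_pos by (simp add: one_le_power)
  then have "(max c R + 1) * 1 \<le> (max c R + 1) * (1 + c * \<Delta>) ^ n"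
    using c_nonneg by (intro mult_left_mono) auto
  then have "max c R + 1 \<le> (max c R + 1) * (1 + c * \<Delta>) ^ n" by (simp only: mult_1_right)
  then show ?thesis unfolding lip_const_def by (simp only: le_diff_eq)
qed

lemma lip_const_Suc: "lip_const (Suc n) = lip_const n + c * \<Delta> * (lip_const n + 1)"
  by (simp add: lip_const_def algebra_simps)

lemma lip_const_le:
  assumes "real n * \<Delta> \<le> \<tau>"
  shows "lip_const n \<le> (max c R + 1) * exp (c * \<tau>)"
proof -
  have "(1 + c * \<Delta>) ^ n \<le> exp (c * \<Delta>) ^ n"
    using c_nonneg Delta_pos by (intro power_mono exp_ge_add_one_self) auto
  also have "\<dots> = exp (c * (real n * \<Delta>))"
    by (simp add: exp_of_nat_mult[symmetric] mult.assoc mult.left_commute)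
  also have "\<dots> \<le> exp (c * \<tau>)"
    using assms c_nonneg by (simp add: mult_left_mono)
  finally have "(max c R + 1) * (1 + c * \<Delta>) ^ n \<le> (max c R + 1) * exp (c * \<tau>)"
    using c_nonneg by (intro mult_left_mono) auto
  then show ?thesis by (simp add: lip_const_def)
qed

lemma ext_lip:
  assumes "\<And>k. 0 \<le> k \<Longrightarrow> k < m \<Longrightarrow> \<bar>\<phi> (k + 1) - \<phi> k\<bar> \<le> K * h" "R \<le> K" "k \<in> {-1..m}"
  shows "\<bar>ext n \<phi> (k + 1) - ext n \<phi> k\<bar> \<le> K * h"
proof -
  have "\<bar>r n * h\<bar> \<le> K * h" "\<bar>y n * h\<bar> \<le> K * h"
    using r_bound[of n] y_bound[of n] assms(2) h_pos by (auto simp: abs_mult)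
  moreover have "k = -1 \<or> k = m \<or> (0 \<le> k \<and> k < m)" using assms(3) by auto
  ultimately show ?thesis
    using assms(1)[of k] m_pos by (auto simp: ext_def)
qed

lemma val_lip: "0 \<le> k \<Longrightarrow> k < m \<Longrightarrow> \<bar>val n (k + 1) - val n k\<bar> \<le> lip_const n * h"
proof (induction n arbitrary: k)
  case 0
  then have "\<bar>g (k + 1) - g k\<bar> \<le> c * h" using g_lip[of "k + 1" k] by simp
  also have "\<dots> \<le> lip_const 0 * h"
    using lip_const_ge[of 0] h_pos by (intro mult_right_mono) auto
  finally show ?case by simp
next
  case (Suc n)
  let ?E = "ext n (val n)" and ?K = "lip_const n"
  have K: "R \<le> ?K" "0 \<le> ?K" using lip_const_ge[of n] c_nonneg by auto
  have E: "k \<in> {-1..m} \<Longrightarrow> \<bar>?E (k + 1) - ?E k\<bar> \<le> ?K * h" for k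
    by (rule ext_lip) (use Suc.IH K in auto)
  have E2: "\<bar>?E (k + 1) - ?E (k - 1)\<bar> \<le> 2 * ?K * h" if "k \<in> {0..m}" for k
    using E[of k] E[of "k - 1"] that by (auto simp: abs_le_iff)
  have main: "val (Suc n) k' \<le> val (Suc n) k + lip_const (Suc n) * h"
    if "k \<in> {0..m}" "k' \<in> {0..m}" "\<bar>k - k'\<bar> = 1" for k k'
  proof -
    define u where "u = a n k (val_slope n k)"
    have u: "u \<in> U" using a_in that by (simp add: u_def)
    let ?P = "prob_up n k u" and ?P' = "prob_up n k' u"
    have kk: "\<bar>real_of_int k' - real_of_int k\<bar> = 1" using that(3) by linarith
    have P: "0 \<le> ?P" "?P \<le> 1" using prob_up_range[OF that(1) u, of n] by auto
    have f: "\<bar>f n k' u - f n k u\<bar> \<le> c * h" and b: "\<bar>b n k' u - b n k u\<bar> \<le> c * h"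
      using f_lip[OF that(2,1) u, of n] b_lip[OF that(2,1) u, of n] kk by simp_all
    have "\<bar>?P' - ?P\<bar> = h / (2 * \<sigma>\<^sup>2) * \<bar>b n k' u - b n k u\<bar>"
    proof -
      have "?P' - ?P = h / (2 * \<sigma>\<^sup>2) * (b n k' u - b n k u)"
        unfolding prob_up_def using \<sigma>_pos by (simp add: field_simps)
      then show ?thesis using h_pos by (simp add: abs_mult)
    qed
    also have "\<dots> \<le> h / (2 * \<sigma>\<^sup>2) * (c * h)" using b h_pos by (intro mult_left_mono) auto
    finally have P': "\<bar>?P' - ?P\<bar> \<le> h / (2 * \<sigma>\<^sup>2) * (c * h)" .
    have "(?P' - ?P) * (?E (k' + 1) - ?E (k' - 1)) \<le> \<bar>?P' - ?P\<bar> * \<bar>?E (k' + 1) - ?E (k' - 1)\<bar>"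
      by (metis abs_ge_self abs_mult)
    also have "\<dots> \<le> h / (2 * \<sigma>\<^sup>2) * (c * h) * (2 * ?K * h)"
      using P' E2[OF that(2)] h_pos K c_nonneg by (intro mult_mono) auto
    also have "\<dots> = c * \<Delta> * ?K * h" by (simp add: Delta_eq power2_eq_square)
    finally have 1: "(?P' - ?P) * (?E (k' + 1) - ?E (k' - 1)) \<le> c * \<Delta> * ?K * h" .
    have s: "k' = k + 1 \<or> k' = k - 1" using that(3) by linarith
    have up: "?E (k' + 1) - ?E (k + 1) \<le> ?K * h"
      using s E[of "k + 1"] E[of k] that(1,2) by (auto simp: abs_le_iff)
    have dn: "?E (k' - 1) - ?E (k - 1) \<le> ?K * h"
      using s E[of "k - 1"] E[of "k - 2"] that(1,2) by (auto simp: abs_le_iff)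
    have 2: "?P * (?E (k' + 1) - ?E (k + 1)) \<le> ?P * (?K * h)"
      "(1 - ?P) * (?E (k' - 1) - ?E (k - 1)) \<le> (1 - ?P) * (?K * h)"
      using up dn P by (auto intro!: mult_left_mono)
    have 3: "\<Delta> * (f n k' u - f n k u) \<le> \<Delta> * (c * h)"
      using f Delta_pos by (intro mult_left_mono) auto
    \<comment> \<open>With the control \<open>u\<close> of \<open>k\<close> used at
      \<open>k'\<close>, the change splits into the running cost, the displacement of both targets
      under the same weights, and the change of the weights. The last one is of second order:
      \<open>h / (2 * \<sigma>^2) * (c * h)\<close> times \<open>2 * K * h\<close>, that is
      \<open>c * \<Delta> * K * h\<close>.\<close>
    have "val (Suc n) k' - val (Suc n) k \<le> \<Delta> * (f n k' u - f n k u)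
        + ?P * (?E (k' + 1) - ?E (k + 1)) + (1 - ?P) * (?E (k' - 1) - ?E (k - 1))
        + (?P' - ?P) * (?E (k' + 1) - ?E (k' - 1))"
      using val_Suc_le[OF that(2) u, of n] val_Suc_eq[OF u_def]
      by (simp add: algebra_simps del: val.simps)
    also have "\<dots> \<le> \<Delta> * (c * h) + ?P * (?K * h) + (1 - ?P) * (?K * h) + c * \<Delta> * ?K * h"
      using 1 2 3 by linarith
    also have "\<dots> = lip_const (Suc n) * h"
      by (simp add: lip_const_Suc algebra_simps)
    finally show ?thesis by simp
  qed
  show ?case
    using main[of k "k + 1"] main[of "k + 1" k] Suc.prems by (simp del: val.simps)
qed

lemma val_slope_bound: "k \<in> {0..m} \<Longrightarrow> \<bar>val_slope n k\<bar> \<le> lip_const n"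
proof -
  assume k: "k \<in> {0..m}"
  let ?E = "ext n (val n)"
  have E: "k \<in> {-1..m} \<Longrightarrow> \<bar>?E (k + 1) - ?E k\<bar> \<le> lip_const n * h" for k
    by (rule ext_lip) (use val_lip lip_const_ge[of n] in auto)
  have "\<bar>?E (k + 1) - ?E (k - 1)\<bar> \<le> 2 * lip_const n * h"
    using E[of k] E[of "k - 1"] k by (auto simp: abs_le_iff)
  then show ?thesis
    using h_pos by (simp add: slope_def field_simps)
qed

subsubsection \<open>Second differences\<close>

text \<open>A quadratic profile that carries the boundary fluxes; the averaging maps it to itself plus a constant.\<close>

definition flux_profile :: "nat \<Rightarrow> int \<Rightarrow> real" where
  "flux_profile n k = h * (- y n * k + (r n + y n) * (k * (k + 1)) / (2 * (m + 1)))"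

definition fluxfree :: "nat \<Rightarrow> int \<Rightarrow> real" where
  "fluxfree n k = val n k - flux_profile n k"

lemma flux_profile_Suc:
  "flux_profile n (k + 1) - flux_profile n k = h * (- y n + (r n + y n) * ((k + 1) / (m + 1)))"
  using m_pos unfolding flux_profile_def
  by (simp add: divide_simps) (simp add: algebra_simps)

text \<open>The increments of the profile over the edges are \<open>- y n * h\<close> below and
  \<open>r n * h\<close> above, exactly the reflection costs. What remains satisfies the homogeneous
  reflection condition, for which folding is available.\<close>

lemma ext_val_eq:
  assumes "k \<in> {-1..m + 1}"
  shows "ext n (val n) k = fluxfree n (clamp m k) + flux_profile n k"
proof -
  have "flux_profile n (m + 1) = flux_profile n m + r n * h"
    using flux_profile_Suc[of n m] m_pos by (simp add: algebra_simps)
  moreover have "flux_profile n (-1) = y n * h" "flux_profile n 0 = 0"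
    by (simp_all add: flux_profile_def)
  moreover have "k = -1 \<or> k = m + 1 \<or> k \<in> {0..m}" using assms by auto
  ultimately show ?thesis
    using m_pos by (auto simp: ext_def fluxfree_def clamp_def)
qed

definition fluxfree_source :: "nat \<Rightarrow> int \<Rightarrow> real" where
  "fluxfree_source n k = \<Delta> * ham n k (val_slope n k) + (avg (flux_profile n) k - flux_profile (Suc n) k)"

lemma fluxfree_Suc:
  assumes "k \<in> {0..m}"
  shows "fluxfree (Suc n) k
    = (fluxfree n (clamp m (k + 1)) + fluxfree n (clamp m (k - 1))) / 2 + fluxfree_source n k"
  using assms ext_val_eq[of "k + 1" n] ext_val_eq[of "k - 1" n]
  by (simp add: fluxfree_def[of "Suc n"] fluxfree_source_def avg_def field_simps)

text \<open>Averaging adds a constant to the quadratic profile, and this constant drops out of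
  differences in space. Only the time increments of the fluxes remain: one
  \<open>c * \<Delta>\<close> from \<open>y\<close>, two from \<open>r + y\<close>.\<close>

lemma flux_source_diff:
  assumes "0 \<le> k" "k < m"
  shows "\<bar>(avg (flux_profile n) (k + 1) - flux_profile (Suc n) (k + 1))
     - (avg (flux_profile n) k - flux_profile (Suc n) k)\<bar> \<le> 3 * c * h * \<Delta>"
proof -
  let ?q = "(k + 1) / (m + 1) :: real"
  have q: "0 \<le> ?q" "?q \<le> 1" using assms by auto
  have "avg (flux_profile n) j = flux_profile n j + h * (r n + y n) / (2 * (m + 1))" for j
    using flux_profile_Suc[of n j] flux_profile_Suc[of n "j - 1"] m_pos
    by (simp add: avg_def field_simps)
  then have "(avg (flux_profile n) (k + 1) - flux_profile (Suc n) (k + 1))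
     - (avg (flux_profile n) k - flux_profile (Suc n) k)
    = h * ((y (Suc n) - y n) - ((r (Suc n) - r n) + (y (Suc n) - y n)) * ?q)"
    using flux_profile_Suc[of n k] flux_profile_Suc[of "Suc n" k] by (simp add: algebra_simps)
  also have "\<bar>\<dots>\<bar> \<le> h * (c * \<Delta> + (c * \<Delta> + c * \<Delta>) * 1)"
  proof -
    have "\<bar>(r (Suc n) - r n) + (y (Suc n) - y n)\<bar> * \<bar>?q\<bar> \<le> (c * \<Delta> + c * \<Delta>) * 1"
    proof (rule mult_mono)
      show "\<bar>(r (Suc n) - r n) + (y (Suc n) - y n)\<bar> \<le> c * \<Delta> + c * \<Delta>"
        using y_time[of n] r_time[of n] by linarith
      show "\<bar>?q\<bar> \<le> 1" using q by linarith
      show "0 \<le> c * \<Delta> + c * \<Delta>" using c_nonneg Delta_pos by simp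
    qed simp
    then have "\<bar>((r (Suc n) - r n) + (y (Suc n) - y n)) * ?q\<bar> \<le> (c * \<Delta> + c * \<Delta>) * 1"
      by (simp only: abs_mult)
    moreover have "\<bar>(y (Suc n) - y n) - ((r (Suc n) - r n) + (y (Suc n) - y n)) * ?q\<bar>
        \<le> \<bar>y (Suc n) - y n\<bar> + \<bar>((r (Suc n) - r n) + (y (Suc n) - y n)) * ?q\<bar>"
      by (rule abs_triangle_ineq4)
    ultimately have "\<bar>(y (Suc n) - y n) - ((r (Suc n) - r n) + (y (Suc n) - y n)) * ?q\<bar>
        \<le> c * \<Delta> + (c * \<Delta> + c * \<Delta>) * 1"
      using y_time[of n] by linarith
    then show ?thesis using h_pos by (simp add: abs_mult)
  qed
  finally show ?thesis by (simp add: algebra_simps)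
qed

text \<open>The constant \<open>2 * A + 4 * C * \<tau>\<close> of \<open>singular_gronwall\<close>
  for first differences of \<open>fluxfree\<close>: \<open>c + 3 * R\<close> bounds them initially,
  the bracket bounds the part of their source that is free of the difference quotient. The product
  \<open>h * m\<close> is the length of the segment, so \<open>h\<close> enters only through
  it.\<close>

definition slope_const :: "real \<Rightarrow> real \<Rightarrow> real" where
  "slope_const \<tau> K = 2 * (c + 3 * R) + 4 * (c * (1 + K) + 2 * B * R / (h * m) + 3 * c) * \<tau>"

text \<open>The Gronwall estimate is applied, with \<open>e = h\<close>, to the first differences
  \<open>u\<close> of the folded \<open>fluxfree\<close>. Their central difference is
  \<open>2 * h\<close> times the increment of \<open>val_slope\<close>, up to a flux term of order
  \<open>h\<close>. The source closes the loop because the Hamiltonian is Lipschitz in state and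
  slope, so its increment is bounded through the increment of the slope.\<close>

lemma val_slope_Suc_diff:
  assumes K: "\<And>n. n \<le> N \<Longrightarrow> lip_const n \<le> K"
    and small: "12 * B * sqrt (real (N + 1) * \<Delta>) \<le> \<sigma>" "real (N + 1) * \<Delta> \<le> \<tau>"
    and n: "n \<le> N" and k: "0 \<le> k" "k < m"
  shows "\<bar>val_slope n (k + 1) - val_slope n k\<bar>
    \<le> h * (slope_const \<tau> K / (h * sqrt (real n + 1)) + 2 * R / (h * m))"
proof -
  let ?w = fluxfree and ?\<rho> = "fold_map m"
  define u where "u n k = ?w n (?\<rho> (k + 1)) - ?w n (?\<rho> k)" for n k
  define s where "s n k = fluxfree_source n (?\<rho> (k + 1)) - fluxfree_source n (?\<rho> k)" for n k
  let ?C = "c * (1 + K) + 2 * B * R / (h * m) + 3 * c" and ?A = "c + 3 * R"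
  have K0: "0 \<le> K" using K[of 0] lip_const_ge[of 0] c_nonneg by auto
  have \<rho>: "?\<rho> k \<in> {0..m}" for k using fold_map_range[of m k] m_pos by simp
  have \<rho>_step: "?\<rho> (k + 1) = ?\<rho> k \<or> ?\<rho> (k + 1) = ?\<rho> k + 1 \<or> ?\<rho> k = ?\<rho> (k + 1) + 1" for k
    using fold_map_step[of m k] m_pos \<rho>[of k] \<rho>[of "k + 1"] by (auto simp: clamp_def)
  \<comment> \<open>Adjacent integers fold to equal or adjacent states, so a bound on increments
    inside the segment carries over, whatever the orientation.\<close>
  have adjacent: "\<bar>F (?\<rho> (k + 1)) - F (?\<rho> k)\<bar> \<le> D"
    if "\<And>j. 0 \<le> j \<Longrightarrow> j < m \<Longrightarrow> \<bar>F (j + 1) - F j\<bar> \<le> D" for F :: "int \<Rightarrow> real" and k D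
  proof -
    have "0 \<le> D" using that[of 0] m_pos by (meson abs_ge_zero order_trans zero_less_one less_le_trans order_refl)
    then show ?thesis
      using \<rho>_step[of k] that[of "?\<rho> k"] that[of "?\<rho> (k + 1)"] \<rho>[of k] \<rho>[of "k + 1"]
      by (auto simp: abs_minus_commute)
  qed
  have w_rec: "?w (Suc n) (?\<rho> k) = avg (\<lambda>k. ?w n (?\<rho> k)) k + fluxfree_source n (?\<rho> k)" for n k
    unfolding fluxfree_Suc[OF \<rho>] avg_def using fold_map_step[of m k] m_pos by auto
  have slope_diff: "val_slope n (k + 1) - val_slope n k
     = (u n (k + 1) - u n (k - 1)) / (2 * h) + (r n + y n) / (m + 1)" if "0 \<le> k" "k < m" for n k
  proof -
    have e: "ext n (val n) j = ?w n (?\<rho> j) + flux_profile n j" if "j \<in> {-1..m + 1}" for j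
    proof -
      have "?\<rho> j = clamp m j"
        using that m_pos fold_map_neighbours[of 0 m] fold_map_neighbours[of m m] fold_map_id[of j m] clamp_id[of j m]
        by (cases "j = -1 \<or> j = m + 1") auto
      then show ?thesis using ext_val_eq[OF that, of n] by simp
    qed
    have "flux_profile n (k + 2) - flux_profile n (k + 1) = h * (- y n + (r n + y n) * ((k + 2) / (m + 1)))"
      "flux_profile n (k + 1) - flux_profile n k = h * (- y n + (r n + y n) * ((k + 1) / (m + 1)))"
      "flux_profile n k - flux_profile n (k - 1) = h * (- y n + (r n + y n) * (k / (m + 1)))"
      using flux_profile_Suc[of n "k + 1"] flux_profile_Suc[of n k] flux_profile_Suc[of n "k - 1"]
      by (simp_all add: algebra_simps)
    then have "(flux_profile n (k + 2) - flux_profile n k) - (flux_profile n (k + 1) - flux_profile n (k - 1))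
       = h * (- y n + (r n + y n) * ((k + 2) / (m + 1))) - h * (- y n + (r n + y n) * (k / (m + 1)))"
      by linarith
    also have "\<dots> = h * (r n + y n) * ((k + 2) / (m + 1) - k / (m + 1))"
    proof -
      have "h * (- y n + (r n + y n) * A) - h * (- y n + (r n + y n) * B) = h * (r n + y n) * (A - B)" for A B
        by (simp add: algebra_simps)
      then show ?thesis by blast
    qed
    also have "\<dots> = 2 * h * ((r n + y n) / (m + 1))"
      using m_pos by (simp add: diff_divide_distrib[symmetric])
    finally have fp: "(flux_profile n (k + 2) - flux_profile n k) - (flux_profile n (k + 1) - flux_profile n (k - 1))
       = 2 * h * ((r n + y n) / (m + 1))" .
    have "(val_slope n (k + 1) - val_slope n k) * (2 * h)
       = (ext n (val n) (k + 2) - ext n (val n) k) - (ext n (val n) (k + 1) - ext n (val n) (k - 1))"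
    proof -
      have *: "k + 1 + 1 = k + 2" "k + 1 - 1 = k" by simp_all
      show ?thesis
        unfolding slope_def diff_divide_distrib[symmetric] * using h_pos by simp
    qed
    also have "\<dots> = (u n (k + 1) - u n (k - 1)) + 2 * h * ((r n + y n) / (m + 1))"
      using that e[of "k + 2"] e[of k] e[of "k + 1"] e[of "k - 1"] fp by (simp add: u_def add.commute)
    finally show ?thesis using h_pos by (simp add: field_simps)
  qed
  have flux_bound: "\<bar>(r n + y n) / (m + 1)\<bar> \<le> 2 * R / m" for n
  proof -
    have "\<bar>(r n + y n) / (m + 1)\<bar> = \<bar>r n + y n\<bar> / (m + 1)" using m_pos by (simp add: abs_divide)
    also have "\<dots> \<le> 2 * R / m"
      using r_bound[of n] y_bound[of n] m_pos by (intro frac_le) auto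
    finally show ?thesis .
  qed
  have slope_bound: "\<bar>val_slope n (k + 1) - val_slope n k\<bar> \<le> h * (X + 2 * R / (h * m))"
    if "0 \<le> k" "k < m" "\<bar>u n (k + 1) - u n (k - 1)\<bar> \<le> 2 * h * h * X" for n k X
  proof -
    have "\<bar>(u n (k + 1) - u n (k - 1)) / (2 * h)\<bar> \<le> h * X"
      using that(3) h_pos by (simp add: field_simps)
    moreover have "2 * R / m = h * (2 * R / (h * m))" using h_pos by simp
    ultimately show ?thesis
      unfolding slope_diff[OF that(1,2)] distrib_left
      using flux_bound[of n] by linarith
  qed
  have "\<bar>u n (k + 1) - u n (k - 1)\<bar> \<le> 2 * h * h * ((2 * ?A + 4 * ?C * \<tau>) / (h * sqrt (real n + 1)))"
  proof (rule singular_gronwall[where \<sigma> = \<sigma> and B = B and \<Delta> = \<Delta> and N = N and s = s])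
    show "0 \<le> ?C"
    proof -
      have "0 \<le> 2 * B * R / (h * m)" using B_nonneg R_nonneg h_pos m_pos by simp
      moreover have "0 \<le> c * (1 + K)" using c_nonneg K0 by simp
      ultimately show ?thesis using c_nonneg by linarith
    qed
    show "u (Suc n) k = avg (u n) k + s n k" for n k
      using w_rec[of n k] w_rec[of n "k + 1"] by (simp add: u_def s_def avg_def add_divide_distrib diff_divide_distrib algebra_simps)
    show "\<bar>u 0 k\<bar> \<le> h * ?A" for k
      unfolding u_def
    proof (rule adjacent)
      fix j assume j: "0 \<le> j" "j < m"
      have q: "0 \<le> (j + 1) / (m + 1 :: real)" "(j + 1) / (m + 1 :: real) \<le> 1" using j by auto
      have "\<bar>flux_profile 0 (j + 1) - flux_profile 0 j\<bar> \<le> h * (R + (R + R) * 1)"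
      proof -
        have "\<bar>(r 0 + y 0) * ((j + 1) / (m + 1))\<bar> \<le> (R + R) * 1"
          unfolding abs_mult
        proof (rule mult_mono)
          show "\<bar>r 0 + y 0\<bar> \<le> R + R" using y_bound[of 0] r_bound[of 0] by linarith
          show "\<bar>(j + 1) / (m + 1 :: real)\<bar> \<le> 1" using q by linarith
        qed (use R_nonneg in auto)
        then have "\<bar>- y 0 + (r 0 + y 0) * ((j + 1) / (m + 1))\<bar> \<le> R + (R + R) * 1"
          using y_bound[of 0] by linarith
        then show ?thesis unfolding flux_profile_Suc abs_mult using h_pos by simp
      qed
      moreover have "\<bar>g (j + 1) - g j\<bar> \<le> c * h" using g_lip[of "j + 1" j] j by simp
      ultimately show "\<bar>?w 0 (j + 1) - ?w 0 j\<bar> \<le> h * ?A"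
        by (simp add: fluxfree_def algebra_simps)
    qed
    show "\<bar>s n k\<bar> \<le> h * \<Delta> * (?C + B * X)"
      if "n < N" "0 \<le> X" and X: "\<And>k. \<bar>u n (k + 1) - u n (k - 1)\<bar> \<le> 2 * h * h * X" for n k X
      unfolding s_def
    proof (rule adjacent)
      fix j assume j: "0 \<le> j" "j < m"
      have "\<bar>ham n (j + 1) (val_slope n (j + 1)) - ham n j (val_slope n j)\<bar>
         \<le> c * (h * 1) * (1 + \<bar>val_slope n (j + 1)\<bar>) + B * \<bar>val_slope n (j + 1) - val_slope n j\<bar>"
        using ham_diff_le[of "j + 1" j n] j by simp
      also have "\<dots> \<le> c * (h * 1) * (1 + K) + B * (h * (X + 2 * R / (h * m)))"
        using val_slope_bound[of "j + 1" n] K[of n] j that c_nonneg h_pos B_nonneg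
        by (intro add_mono mult_left_mono slope_bound X) auto
      finally have "\<Delta> * \<bar>ham n (j + 1) (val_slope n (j + 1)) - ham n j (val_slope n j)\<bar>
         \<le> \<Delta> * (c * (h * 1) * (1 + K) + B * (h * (X + 2 * R / (h * m))))"
        using Delta_pos by (intro mult_left_mono) auto
      then have "\<bar>\<Delta> * ham n (j + 1) (val_slope n (j + 1)) - \<Delta> * ham n j (val_slope n j)\<bar>
         \<le> \<Delta> * (c * (h * 1) * (1 + K) + B * (h * (X + 2 * R / (h * m))))"
        using Delta_pos by (simp add: right_diff_distrib[symmetric] abs_mult)
      then have "\<bar>fluxfree_source n (j + 1) - fluxfree_source n j\<bar>
         \<le> \<Delta> * (c * (h * 1) * (1 + K) + B * (h * (X + 2 * R / (h * m)))) + 3 * c * h * \<Delta>"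
        using flux_source_diff[OF j, of n] unfolding fluxfree_source_def by linarith
      also have "\<dots> = h * \<Delta> * (?C + B * X)" by (simp add: algebra_simps)
      finally show "\<bar>fluxfree_source n (j + 1) - fluxfree_source n j\<bar> \<le> h * \<Delta> * (?C + B * X)" .
    qed
  qed (use h_pos \<sigma>_pos c_nonneg R_nonneg B_nonneg Delta_eq small n in auto)
  then show ?thesis
    using slope_bound[OF k] unfolding slope_const_def by blast
qed

lemma val_slope_lip:
  assumes "\<And>n. n \<le> N \<Longrightarrow> lip_const n \<le> K"
    and "12 * B * sqrt (real (N + 1) * \<Delta>) \<le> \<sigma>" "real (N + 1) * \<Delta> \<le> \<tau>"
    and "n \<le> N" and "k \<in> {0..m}" "k' \<in> {0..m}"
  shows "\<bar>val_slope n k - val_slope n k'\<bar>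
    \<le> (slope_const \<tau> K / (h * sqrt (real n + 1)) + 2 * R / (h * m)) * (h * \<bar>k - k'\<bar>)"
proof -
  let ?D = "h * (slope_const \<tau> K / (h * sqrt (real n + 1)) + 2 * R / (h * m))"
  have aux: "\<bar>val_slope n (i + int d) - val_slope n i\<bar> \<le> ?D * d" if "0 \<le> i" "i + int d \<le> m" for i d
    using that
  proof (induction d)
    case (Suc d)
    have "\<bar>val_slope n (i + int d + 1) - val_slope n (i + int d)\<bar> \<le> ?D"
      using Suc.prems by (intro val_slope_Suc_diff[OF assms(1-4)]) auto
    then have "\<bar>val_slope n (i + int d + 1) - val_slope n i\<bar> \<le> ?D + ?D * d"
      using Suc by auto
    then show ?case by (simp add: algebra_simps)
  qed simp
  have *: "\<bar>val_slope n j' - val_slope n j\<bar> \<le> ?D * real_of_int (j' - j)"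
    if "0 \<le> j" "j \<le> j'" "j' \<le> m" for j j'
  proof -
    obtain d where d: "j' = j + int d" using \<open>j \<le> j'\<close> zle_iff_zadd by blast
    show ?thesis using aux[of j d] that unfolding d by (simp only: add_diff_cancel_left' of_int_of_nat_eq)
  qed
  have "\<bar>val_slope n k - val_slope n k'\<bar> \<le> ?D * \<bar>k - k'\<bar>"
    using *[of k k'] *[of k' k] assms(5,6) by (cases "k \<le> k'") (simp_all add: abs_minus_commute)
  then show ?thesis by (simp only: mult_ac)
qed

end

subsubsection \<open>Dependence of the slopes on the data\<close>

text \<open>The reflection costs \<open>y\<close>, \<open>r\<close> are shared: by (A2) they do not
  depend on the measure, so the fluxes cancel in the difference of the two values. Nothing relates
  \<open>a\<close> to \<open>a'\<close>; the two problems are compared through their minima.\<close>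

locale grid_problem_pair =
  P: grid_problem m h \<sigma> \<Delta> U f b g y r a c R B + P': grid_problem m h \<sigma> \<Delta> U f' b' g' y r a' c R B
  for m h \<sigma> \<Delta> U f b g y r a c R B f' b' g' a' +
  fixes W :: real
  assumes W_nonneg: "0 \<le> W"
    and f_diff: "\<lbrakk>k \<in> {0..m}; u \<in> U\<rbrakk> \<Longrightarrow> \<bar>f n k u - f' n k u\<bar> \<le> c * W"
    and b_diff: "\<lbrakk>k \<in> {0..m}; u \<in> U\<rbrakk> \<Longrightarrow> \<bar>b n k u - b' n k u\<bar> \<le> c * W"
    and g_diff: "k \<in> {0..m} \<Longrightarrow> \<bar>g k - g' k\<bar> \<le> c * W"
begin

lemma ham_diff_le:
  assumes k: "k \<in> {0..m}" and p: "\<bar>p\<bar> \<le> K" "\<bar>p'\<bar> \<le> K"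
  shows "\<bar>P.ham n k p - P'.ham n k p'\<bar> \<le> c * W * (1 + K) + B * \<bar>p - p'\<bar>"
proof -
  have main: "\<bar>f n k u + b n k u * p - (f' n k u + b' n k u * p')\<bar> \<le> c * W * (1 + K) + B * \<bar>p - p'\<bar>"
    if "u \<in> U" for u
  proof -
    have 1: "\<bar>b n k u * p - b' n k u * p\<bar> \<le> c * W * K"
      unfolding left_diff_distrib[symmetric] abs_mult
      using b_diff[OF k that, of n] p P.c_nonneg W_nonneg by (intro mult_mono) auto
    have 2: "\<bar>b' n k u * p - b' n k u * p'\<bar> \<le> B * \<bar>p - p'\<bar>"
      unfolding right_diff_distrib[symmetric] abs_mult
      using P'.b_bound[OF k that, of n] by (intro mult_right_mono) auto
    show ?thesis
      unfolding distrib_left using 1 2 f_diff[OF k that, of n] by (simp add: abs_le_iff)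
  qed
  have "P.ham n k p \<le> f n k (a' n k p') + b n k (a' n k p') * p"
    by (intro P.ham_le k P'.a_in)
  moreover have "P'.ham n k p' \<le> f' n k (a n k p) + b' n k (a n k p) * p'"
    by (intro P'.ham_le k P.a_in)
  ultimately show ?thesis
    using main[OF P.a_in[OF k], of n p] main[OF P'.a_in[OF k], of n p']
    unfolding P.ham_def P'.ham_def by (simp add: abs_le_iff)
qed

text \<open>Here the difference of the values is folded itself, not its increments in space: the
  common fluxes cancel, and its central difference is already the difference of the slopes. The
  scale \<open>e\<close> of the Gronwall estimate is \<open>W\<close>.\<close>

lemma val_slope_diff:
  assumes K: "\<And>n. n \<le> N \<Longrightarrow> P.lip_const n \<le> K"
    and small: "12 * B * sqrt (real (N + 1) * \<Delta>) \<le> \<sigma>" "real (N + 1) * \<Delta> \<le> \<tau>"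
    and n: "n \<le> N" and k: "k \<in> {0..m}"
  shows "\<bar>P.val_slope n k - P'.val_slope n k\<bar>
    \<le> (2 * c + 4 * (c * (1 + K)) * \<tau>) / (h * sqrt (real n + 1)) * W"
proof -
  let ?\<rho> = "fold_map m"
  define \<delta> where "\<delta> n k = P.val n k - P'.val n k" for n k
  define u where "u n k = \<delta> n (?\<rho> k)" for n k
  define s where "s n k = \<Delta> * (P.ham n (?\<rho> k) (P.val_slope n (?\<rho> k)) - P'.ham n (?\<rho> k) (P'.val_slope n (?\<rho> k)))" for n k
  have K0: "0 \<le> K" using K[of 0] P.lip_const_ge[of 0] P.c_nonneg by auto
  have \<rho>: "?\<rho> k \<in> {0..m}" for k using fold_map_range[of m k] P.m_pos by simp
  have ext: "P.ext n (P.val n) j - P'.ext n (P'.val n) j = \<delta> n (clamp m j)" for n j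
    using P.m_pos by (auto simp: P.ext_def P'.ext_def \<delta>_def clamp_def)
  have nb: "(u n (k + 1) = \<delta> n (clamp m (?\<rho> k + 1)) \<and> u n (k - 1) = \<delta> n (clamp m (?\<rho> k - 1))) \<or>
     (u n (k + 1) = \<delta> n (clamp m (?\<rho> k - 1)) \<and> u n (k - 1) = \<delta> n (clamp m (?\<rho> k + 1)))" for n k
    using fold_map_step[of m k] P.m_pos by (auto simp: u_def)
  have slope: "P.val_slope n j - P'.val_slope n j = (\<delta> n (clamp m (j + 1)) - \<delta> n (clamp m (j - 1))) / (2 * h)" for n j
    unfolding ext[symmetric] by (simp add: P.slope_def P'.slope_def diff_divide_distrib)
  have slope_abs: "\<bar>P.val_slope n (?\<rho> k) - P'.val_slope n (?\<rho> k)\<bar> = \<bar>u n (k + 1) - u n (k - 1)\<bar> / (2 * h)" for n k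
    unfolding slope using nb[of n k] P.h_pos by (auto simp: abs_divide abs_minus_commute)
  have "\<bar>u n (k + 1) - u n (k - 1)\<bar> \<le> 2 * h * W * ((2 * c + 4 * (c * (1 + K)) * \<tau>) / (h * sqrt (real n + 1)))"
  proof (rule singular_gronwall[where \<sigma> = \<sigma> and B = B and \<Delta> = \<Delta> and N = N and s = s])
    show "u (Suc n) k = avg (u n) k + s n k" for n k
    proof -
      have "u (Suc n) k = (\<delta> n (clamp m (?\<rho> k + 1)) + \<delta> n (clamp m (?\<rho> k - 1))) / 2 + s n k"
        unfolding ext[symmetric] by (simp add: u_def \<delta>_def s_def avg_def field_simps)
      then show ?thesis using nb[of n k] by (auto simp: avg_def)
    qed
    show "\<bar>u 0 k\<bar> \<le> W * c" for k
      using g_diff[OF \<rho>] by (simp add: u_def \<delta>_def mult.commute)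
    show "\<bar>s n k\<bar> \<le> W * \<Delta> * (c * (1 + K) + B * X)"
      if "n < N" "0 \<le> X" and X: "\<And>k. \<bar>u n (k + 1) - u n (k - 1)\<bar> \<le> 2 * h * W * X" for n k X
    proof -
      have "\<bar>P.ham n (?\<rho> k) (P.val_slope n (?\<rho> k)) - P'.ham n (?\<rho> k) (P'.val_slope n (?\<rho> k))\<bar>
         \<le> c * W * (1 + K) + B * (\<bar>u n (k + 1) - u n (k - 1)\<bar> / (2 * h))"
        unfolding slope_abs[symmetric]
        using P.val_slope_bound[OF \<rho>, of n k] P'.val_slope_bound[OF \<rho>, of n k] K[of n] that(1)
        by (intro ham_diff_le[OF \<rho>]) (auto simp: P.lip_const_def P'.lip_const_def)
      also have "\<dots> \<le> c * W * (1 + K) + B * (W * X)"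
        using X[of k] P.h_pos P.B_nonneg by (intro add_left_mono mult_left_mono) (auto simp: field_simps)
      finally have "\<Delta> * \<bar>P.ham n (?\<rho> k) (P.val_slope n (?\<rho> k)) - P'.ham n (?\<rho> k) (P'.val_slope n (?\<rho> k))\<bar>
         \<le> \<Delta> * (c * W * (1 + K) + B * (W * X))"
        using P.Delta_pos by (intro mult_left_mono) auto
      then show ?thesis
        using P.Delta_pos unfolding s_def abs_mult by (simp add: algebra_simps del: right_diff_distrib)
    qed
  qed (use P.h_pos P.\<sigma>_pos P.c_nonneg W_nonneg P.B_nonneg P.Delta_eq small n K0 in auto)
  note bound = this
  have eq: "\<bar>P.val_slope n k - P'.val_slope n k\<bar> = \<bar>u n (k + 1) - u n (k - 1)\<bar> / (2 * h)"
    using slope_abs[of n k] fold_map_id[OF k] by simp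
  have rescale: "x / (2 * h) \<le> q * W" if "x \<le> 2 * h * W * q" for x q
    using that P.h_pos by (simp add: divide_le_eq mult_ac)
  show ?thesis unfolding eq by (rule rescale[OF bound])
qed

text \<open>The triangle inequality through the slope of the second problem at \<open>k\<close>. The
  constant for the change of data is dominated by \<open>slope_const\<close>, so one constant serves
  both the displacement and \<open>W\<close>.\<close>

lemma feedback_slope_diff:
  assumes K: "\<And>n. n \<le> N \<Longrightarrow> P.lip_const n \<le> K"
    and small: "12 * B * sqrt (real (N + 1) * \<Delta>) \<le> \<sigma>" "real (N + 1) * \<Delta> \<le> \<tau>"
    and n: "n \<le> N" and k: "k \<in> {0..m}" "k' \<in> {0..m}"
  shows "\<bar>P.val_slope n k - P'.val_slope n k'\<bar>
    \<le> (P.slope_const \<tau> K / (h * sqrt (real n + 1)) + 2 * R / (h * m)) * (h * \<bar>k - k'\<bar> + W)"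
proof -
  have K0: "0 \<le> K" using K[of 0] P.lip_const_ge[of 0] P.c_nonneg by auto
  have "0 \<le> real (N + 1) * \<Delta>" using P.Delta_pos by simp
  then have \<tau>: "0 \<le> \<tau>" using small by linarith
  have 1: "\<bar>P'.val_slope n k - P'.val_slope n k'\<bar>
    \<le> (P.slope_const \<tau> K / (h * sqrt (real n + 1)) + 2 * R / (h * m)) * (h * \<bar>k - k'\<bar>)"
    using P'.val_slope_lip[of N K \<tau> n k k'] K small n k
    by (simp add: P.lip_const_def P'.lip_const_def P.slope_const_def P'.slope_const_def)
  have "2 * c + 4 * (c * (1 + K)) * \<tau> \<le> P.slope_const \<tau> K"
  proof -
    have "0 \<le> 2 * B * R / (h * m)" using P.B_nonneg P.R_nonneg P.h_pos P.m_pos by simp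
    then have "4 * (c * (1 + K)) * \<tau> \<le> 4 * (c * (1 + K) + 2 * B * R / (h * m) + 3 * c) * \<tau>"
      using \<tau> P.c_nonneg by (intro mult_right_mono) auto
    then show ?thesis unfolding P.slope_const_def using P.R_nonneg by (intro add_mono) auto
  qed
  then have "(2 * c + 4 * (c * (1 + K)) * \<tau>) / (h * sqrt (real n + 1)) * W
     \<le> (P.slope_const \<tau> K / (h * sqrt (real n + 1))) * W"
    using W_nonneg P.h_pos by (intro mult_right_mono divide_right_mono) auto
  also have "\<dots> \<le> (P.slope_const \<tau> K / (h * sqrt (real n + 1)) + 2 * R / (h * m)) * W"
    using W_nonneg P.h_pos P.R_nonneg P.m_pos by (intro mult_right_mono) auto
  finally show ?thesis
    using 1 val_slope_diff[OF K small n k(1)] unfolding distrib_left by linarith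
qed

end

subsection \<open>Wasserstein distances\<close>

lemma W1_nonneg: "0 \<le> W1 M N"
  by (simp add: W1_def)

lemma W1_le:
  assumes "\<pi> \<in> couplings M N" "(\<integral>\<^sup>+ p. ennreal (dist (fst p) (snd p)) \<partial>\<pi>) \<le> ennreal C" "0 \<le> C"
  shows "W1 M N \<le> C"
proof -
  have "(INF \<pi>\<in>couplings M N. \<integral>\<^sup>+ p. ennreal (dist (fst p) (snd p)) \<partial>\<pi>) \<le> ennreal C"
    using INF_lower[OF assms(1)] assms(2) by (rule order_trans)
  then show ?thesis
    unfolding W1_def using assms(3) by (metis enn2real_ennreal enn2real_mono ennreal_less_top)
qed

lemma product_coupling:
  assumes M: "prob_space M" and N: "prob_space N"
  shows "M \<Otimes>\<^sub>M N \<in> couplings M N"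
proof -
  interpret M: prob_space M by fact
  interpret N: prob_space N by fact
  interpret P: pair_prob_space M N ..
  have "distr (M \<Otimes>\<^sub>M N) N snd = N"
  proof (intro measure_eqI)
    fix A assume A: "A \<in> sets (distr (M \<Otimes>\<^sub>M N) N snd)"
    from A have "emeasure (distr (M \<Otimes>\<^sub>M N) N snd) A = emeasure (M \<Otimes>\<^sub>M N) (space M \<times> A)"
      by (auto simp add: emeasure_distr space_pair_measure dest: sets.sets_into_space intro!: arg_cong2[where f=emeasure])
    with A show "emeasure (distr (M \<Otimes>\<^sub>M N) N snd) A = emeasure N A"
      by (simp add: N.emeasure_pair_measure_Times M.emeasure_space_1)
  qed simp
  then show ?thesis
    unfolding couplings_def
    by (auto simp: space_prob_algebra P.prob_space_axioms N.distr_pair_fst)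
qed

lemma integral_dist_le:
  assumes "prob_space \<pi>" "\<And>p. p \<in> space \<pi> \<Longrightarrow> dist (fst p) (snd p) \<le> C"
  shows "(\<integral>\<^sup>+ p. ennreal (dist (fst p) (snd p)) \<partial>\<pi>) \<le> ennreal C"
proof -
  interpret prob_space \<pi> by fact
  have "(\<integral>\<^sup>+ p. ennreal (dist (fst p) (snd p)) \<partial>\<pi>) \<le> (\<integral>\<^sup>+ p. ennreal C \<partial>\<pi>)"
    using assms(2) by (intro nn_integral_mono ennreal_leI) auto
  then show ?thesis by (simp add: emeasure_space_1)
qed

lemma W1_le_diameter:
  assumes "prob_space M" "prob_space N"
    and "\<And>x y. x \<in> space M \<Longrightarrow> y \<in> space N \<Longrightarrow> dist x y \<le> C" "0 \<le> C"
  shows "W1 M N \<le> C"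
proof (rule W1_le[OF product_coupling])
  interpret M: prob_space M by fact
  interpret N: prob_space N by fact
  interpret P: pair_prob_space M N ..
  show "(\<integral>\<^sup>+ p. ennreal (dist (fst p) (snd p)) \<partial>(M \<Otimes>\<^sub>M N)) \<le> ennreal C"
    using assms(3) by (intro integral_dist_le P.prob_space_axioms) (auto simp: space_pair_measure)
qed fact+

text \<open>Without measurability of \<open>g\<close> only this half of the change of variables formula survives.\<close>

lemma nn_integral_distr_le:
  assumes T: "T \<in> M \<rightarrow>\<^sub>M N"
  shows "(\<integral>\<^sup>+ x. g x \<partial>distr M N T) \<le> (\<integral>\<^sup>+ x. g (T x) \<partial>M)"
  unfolding nn_integral_def[of "distr M N T"]
proof (rule SUP_least)
  fix s assume "s \<in> {s. simple_function (distr M N T) s \<and> s \<le> g}"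
  then have s: "simple_function (distr M N T) s" "s \<le> g" by auto
  then have [measurable]: "s \<in> borel_measurable N"
    using borel_measurable_simple_function[OF s(1)] by simp
  have "integral\<^sup>S (distr M N T) s = (\<integral>\<^sup>+ x. s x \<partial>distr M N T)"
    using s by (simp add: nn_integral_eq_simple_integral)
  also have "\<dots> = (\<integral>\<^sup>+ x. s (T x) \<partial>M)"
    using T by (intro nn_integral_distr) auto
  also have "\<dots> \<le> (\<integral>\<^sup>+ x. g (T x) \<partial>M)"
    using s by (intro nn_integral_mono) (auto simp: le_fun_def)
  finally show "integral\<^sup>S (distr M N T) s \<le> (\<integral>\<^sup>+ x. g (T x) \<partial>M)" .
qed

lemma space_segment_space [simp]: "space (segment_space L) = {0..L}"
  by (simp add: segment_space_def space_restrict_space)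

lemma segment_dist_measurable:
  "(\<lambda>p. ennreal (dist (fst p) (snd p))) \<in> borel_measurable (segment_space L \<Otimes>\<^sub>M segment_space L)"
proof -
  have [measurable]: "(\<lambda>x. x) \<in> borel_measurable (segment_space L)"
    by (simp add: segment_space_def measurable_restrict_space1)
  have [measurable]: "fst \<in> borel_measurable (segment_space L \<Otimes>\<^sub>M segment_space L)"
    "snd \<in> borel_measurable (segment_space L \<Otimes>\<^sub>M segment_space L)"
    using measurable_compose[OF measurable_fst, of "\<lambda>x. x" "segment_space L" borel "segment_space L"]
      measurable_compose[OF measurable_snd, of "\<lambda>x. x" "segment_space L" borel "segment_space L"]
    by simp_all
  show ?thesis by measurable
qed

lemma space_path_space [simp]: "space (path_space T L) = paths T L"
  by (simp add: path_space_def space_restrict_space)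

lemma eval_borel_measurable: "(\<lambda>w::real \<Rightarrow>\<^sub>C real. apply_bcontfun w t) \<in> borel_measurable borel"
proof (rule borel_measurable_continuous_onI)
  show "continuous_on UNIV (\<lambda>w::real \<Rightarrow>\<^sub>C real. apply_bcontfun w t)"
    unfolding continuous_on_iff
    using dist_bounded le_less_trans by blast
qed

lemma eval_measurable: "(\<lambda>w. apply_bcontfun w t) \<in> path_space T L \<rightarrow>\<^sub>M segment_space L"
  unfolding path_space_def segment_space_def
  by (intro measurable_restrict_space2 measurable_restrict_space1 eval_borel_measurable)
    (auto simp: space_restrict_space paths_def)

lemma marginal_prob:
  assumes "\<nu> \<in> space (prob_algebra (path_space T L))"
  shows "marginal L \<nu> t \<in> space (prob_algebra (segment_space L))"
proof -
  interpret prob_space \<nu> using assms by (simp add: space_prob_algebra)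
  have "(\<lambda>w. apply_bcontfun w t) \<in> \<nu> \<rightarrow>\<^sub>M segment_space L"
    using assms eval_measurable by (simp add: space_prob_algebra cong: measurable_cong_sets)
  then show ?thesis
    by (simp add: space_prob_algebra marginal_def prob_space_distr)
qed

text \<open>Evaluation at \<open>t\<close> is 1-Lipschitz for the uniform distance, so a coupling of
  path laws is pushed forward to a coupling of the marginals that costs no more.\<close>

lemma W1_marginal_le:
  assumes L: "0 \<le> L" and \<nu>: "\<nu> \<in> space (prob_algebra (path_space T L))"
    and \<nu>': "\<nu>' \<in> space (prob_algebra (path_space T L))"
  shows "W1 (marginal L \<nu> t) (marginal L \<nu>' t) \<le> W1 \<nu> \<nu>'"
proof -
  let ?I = "\<lambda>\<pi>. \<integral>\<^sup>+ p. ennreal (dist (fst p) (snd p)) \<partial>\<pi>"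
  let ?S = "segment_space L"
  have sets: "sets \<nu> = sets (path_space T L)" "sets \<nu>' = sets (path_space T L)"
    and prob: "prob_space \<nu>" "prob_space \<nu>'"
    using \<nu> \<nu>' by (auto simp: space_prob_algebra)
  have [measurable]: "(\<lambda>w. apply_bcontfun w t) \<in> \<nu> \<rightarrow>\<^sub>M ?S" "(\<lambda>w. apply_bcontfun w t) \<in> \<nu>' \<rightarrow>\<^sub>M ?S"
    using eval_measurable sets by (simp_all cong: measurable_cong_sets)
  have le: "(INF \<pi>\<in>couplings (marginal L \<nu> t) (marginal L \<nu>' t). ?I \<pi>) \<le> ?I \<pi>" if \<pi>: "\<pi> \<in> couplings \<nu> \<nu>'" for \<pi>
  proof -
    have sets_\<pi>: "sets \<pi> = sets (\<nu> \<Otimes>\<^sub>M \<nu>')" and prob_\<pi>: "prob_space \<pi>"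
      and marg: "distr \<pi> \<nu> fst = \<nu>" "distr \<pi> \<nu>' snd = \<nu>'"
      using \<pi> by (auto simp: couplings_def space_prob_algebra)
    let ?E = "\<lambda>p. (apply_bcontfun (fst p) t, apply_bcontfun (snd p) t)"
    have E[measurable]: "?E \<in> \<pi> \<rightarrow>\<^sub>M ?S \<Otimes>\<^sub>M ?S"
      unfolding measurable_cong_sets[OF sets_\<pi> refl] by measurable
    have fs: "fst \<in> \<pi> \<rightarrow>\<^sub>M \<nu>" "snd \<in> \<pi> \<rightarrow>\<^sub>M \<nu>'"
      unfolding measurable_cong_sets[OF sets_\<pi> refl] by simp_all
    have "distr \<pi> ?S (\<lambda>p. apply_bcontfun (fst p) t) = marginal L \<nu> t"
      unfolding marginal_def using distr_distr[of "\<lambda>w. apply_bcontfun w t" \<nu> ?S fst \<pi>] fs marg by (simp add: comp_def)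
    moreover have "distr \<pi> ?S (\<lambda>p. apply_bcontfun (snd p) t) = marginal L \<nu>' t"
      unfolding marginal_def using distr_distr[of "\<lambda>w. apply_bcontfun w t" \<nu>' ?S snd \<pi>] fs marg by (simp add: comp_def)
    moreover have "sets (marginal L \<nu> t \<Otimes>\<^sub>M marginal L \<nu>' t) = sets (?S \<Otimes>\<^sub>M ?S)"
      by (intro sets_pair_measure_cong) (simp_all add: marginal_def)
    moreover have "distr (distr \<pi> (?S \<Otimes>\<^sub>M ?S) ?E) (marginal L \<nu> t) fst = distr \<pi> ?S (\<lambda>p. apply_bcontfun (fst p) t)"
      "distr (distr \<pi> (?S \<Otimes>\<^sub>M ?S) ?E) (marginal L \<nu>' t) snd = distr \<pi> ?S (\<lambda>p. apply_bcontfun (snd p) t)"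
      by (simp_all add: distr_distr comp_def marginal_def cong: distr_cong)
    ultimately have "distr \<pi> (?S \<Otimes>\<^sub>M ?S) ?E \<in> couplings (marginal L \<nu> t) (marginal L \<nu>' t)"
      unfolding couplings_def space_prob_algebra
      by (simp add: prob_space.prob_space_distr[OF prob_\<pi> E])
    then have "(INF \<pi>\<in>couplings (marginal L \<nu> t) (marginal L \<nu>' t). ?I \<pi>) \<le> ?I (distr \<pi> (?S \<Otimes>\<^sub>M ?S) ?E)"
      by (rule INF_lower)
    also have "\<dots> = (\<integral>\<^sup>+ p. ennreal (dist (apply_bcontfun (fst p) t) (apply_bcontfun (snd p) t)) \<partial>\<pi>)"
      using segment_dist_measurable E by (subst nn_integral_distr) auto
    also have "\<dots> \<le> ?I \<pi>"
      by (intro nn_integral_mono ennreal_leI dist_bounded)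
    finally show ?thesis .
  qed
  \<comment> \<open>\<open>enn2real\<close> sends infinity to \<open>0\<close>, so its monotonicity
    can be used only once the infimum is known to be finite; the product coupling shows
    this.\<close>
  have "?I (\<nu> \<Otimes>\<^sub>M \<nu>') \<le> ennreal L"
  proof -
    interpret A: prob_space \<nu> by fact
    interpret B: prob_space \<nu>' by fact
    interpret P: pair_prob_space \<nu> \<nu>' ..
    have sp: "space \<nu> = paths T L" "space \<nu>' = paths T L"
      using sets_eq_imp_space_eq[OF sets(1)] sets_eq_imp_space_eq[OF sets(2)] by simp_all
    show ?thesis
    proof (intro integral_dist_le P.prob_space_axioms dist_bound)
      fix p s assume "p \<in> space (\<nu> \<Otimes>\<^sub>M \<nu>')"
      then have "apply_bcontfun (fst p) s \<in> {0..L}" "apply_bcontfun (snd p) s \<in> {0..L}"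
        by (auto simp: space_pair_measure sp paths_def)
      then show "dist (apply_bcontfun (fst p) s) (apply_bcontfun (snd p) s) \<le> L"
        by (auto simp: dist_real_def)
    qed
  qed
  then have "(INF \<pi>\<in>couplings \<nu> \<nu>'. ?I \<pi>) \<le> ennreal L"
    using INF_lower[OF product_coupling[OF prob]] by (rule order_trans[rotated])
  moreover have "(INF \<pi>\<in>couplings (marginal L \<nu> t) (marginal L \<nu>' t). ?I \<pi>) \<le> (INF \<pi>\<in>couplings \<nu> \<nu>'. ?I \<pi>)"
    by (rule INF_greatest) (rule le)
  ultimately show ?thesis
    unfolding W1_def by (intro enn2real_mono) (auto intro: le_less_trans[OF _ ennreal_less_top])
qed

text \<open>Needed for \<open>paths\<close> to be a Borel set, when the law of the interpolated
  chain is restricted to it.\<close>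

lemma closed_paths: "closed (paths T L)"
proof -
  have c: "continuous_on UNIV (\<lambda>w::real \<Rightarrow>\<^sub>C real. apply_bcontfun w s)" for s
    unfolding continuous_on_iff using dist_bounded le_less_trans by blast
  have "paths T L = (\<Inter>s. {w. 0 \<le> apply_bcontfun w s} \<inter> {w. apply_bcontfun w s \<le> L} \<inter>
      {w. apply_bcontfun w s = apply_bcontfun w (max 0 (min T s))})"
    by (auto simp: paths_def)
  also have "closed \<dots>"
    by (intro closed_INT ballI closed_Int closed_Collect_le closed_Collect_eq c continuous_on_const)
  finally show ?thesis .
qed

subsection \<open>Walks and their expansion by reflection steps\<close>

text \<open>
  A walk lists the states of the chain outside the reflection steps. In its expansion the
  reflection states \<open>-1\<close> and \<open>m + 1\<close> are inserted; they are visited exactly when the walk stays put.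
\<close>

inductive walk :: "int \<Rightarrow> int list \<Rightarrow> bool" for m where
  start: "k \<in> {0..m} \<Longrightarrow> walk m [k]"
| up: "walk m ks \<Longrightarrow> walk m (ks @ [clamp m (last ks + 1)])"
| down: "walk m ks \<Longrightarrow> walk m (ks @ [clamp m (last ks - 1)])"

text \<open>For \<open>1 \<le> m\<close> a walk stays put only at an end of the segment, and the
  state tells which end it is.\<close>

definition reflection :: "int \<Rightarrow> int \<Rightarrow> int \<Rightarrow> int list" where
  "reflection m k k' = (if k = k' then [if k = 0 then -1 else m + 1] else [])"

fun expand :: "int \<Rightarrow> int list \<Rightarrow> int list" where
  "expand m (k # k' # ks) = k # reflection m k k' @ expand m (k' # ks)"
| "expand m ks = ks"

lemma expand_snoc: "ks \<noteq> [] \<Longrightarrow> expand m (ks @ [k]) = expand m ks @ reflection m (last ks) k @ [k]"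
  by (induction m ks rule: expand.induct) auto

lemma walk_nonempty: "walk m ks \<Longrightarrow> ks \<noteq> []"
  by (induction rule: walk.induct) auto

lemma walk_range:
  assumes "0 \<le> m" "walk m ks"
  shows "set ks \<subseteq> {0..m}"
  using assms(2)
proof (induction rule: walk.induct)
  case (up ks)
  then show ?case using clamp_range[OF assms(1), of "last ks + 1"] by simp
next
  case (down ks)
  then show ?case using clamp_range[OF assms(1), of "last ks - 1"] by simp
qed auto

lemma walk_last: "0 \<le> m \<Longrightarrow> walk m ks \<Longrightarrow> last ks \<in> {0..m}"
  using walk_range walk_nonempty last_in_set by blast

lemma expand_nonempty: "expand m ks = [] \<longleftrightarrow> ks = []"
  by (induction m ks rule: expand.induct) auto

lemma last_expand: "last (expand m ks) = last ks"
proof (cases ks rule: rev_cases)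
  case (snoc zs k)
  then show ?thesis by (cases "zs = []") (simp_all add: expand_snoc)
qed simp

lemma expand_up:
  assumes "1 \<le> m" "ks \<noteq> []" "last ks \<in> {0..m}"
  shows "expand m (ks @ [clamp m (last ks + 1)])
    = expand m ks @ [last ks + 1] @ (if last ks = m then [m] else [])"
  using assms by (auto simp: expand_snoc reflection_def clamp_def)

lemma expand_down:
  assumes "1 \<le> m" "ks \<noteq> []" "last ks \<in> {0..m}"
  shows "expand m (ks @ [clamp m (last ks - 1)])
    = expand m ks @ [last ks - 1] @ (if last ks = 0 then [0] else [])"
  using assms by (auto simp: expand_snoc reflection_def clamp_def)

subsection \<open>The standing assumptions\<close>

text \<open>The constants \<open>c\<close> and \<open>R\<close> are parameters, although they depend
  only on the data: they can then be fixed before horizon, step and measure, and shared by two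
  measures.\<close>

locale mfg_setup = mfg_chain L \<sigma> T0 U b f g y r x0 T h \<nu>
  for L \<sigma> T0 :: real and U :: "real set"
    and b f :: "real \<Rightarrow> real measure \<Rightarrow> real \<Rightarrow> real \<Rightarrow> real"
    and g :: "real measure \<Rightarrow> real \<Rightarrow> real"
    and y r :: "real \<Rightarrow> real measure \<Rightarrow> real"
    and x0 T h :: real and \<nu> :: "(real \<Rightarrow>\<^sub>C real) measure" +
  fixes c R :: real
  assumes L_pos: "0 < L" and \<sigma>_pos: "0 < \<sigma>" and T_pos: "0 < T" and T_le: "T \<le> T0"
    and c_nonneg: "0 \<le> c"
    and lip: "\<lbrakk>t \<in> {0..T0}; t' \<in> {0..T0}; \<eta> \<in> space (prob_algebra (segment_space L));
        \<eta>' \<in> space (prob_algebra (segment_space L)); x \<in> {0..L}; x' \<in> {0..L}; a \<in> U; a' \<in> U\<rbrakk> \<Longrightarrow>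
       \<bar>f t \<eta> x a - f t' \<eta>' x' a'\<bar> + \<bar>g \<eta> x - g \<eta>' x'\<bar> + \<bar>b t \<eta> x a - b t' \<eta>' x' a'\<bar>
         + \<bar>y t \<eta> - y t' \<eta>'\<bar> + \<bar>r t \<eta> - r t' \<eta>'\<bar>
       \<le> c * (\<bar>t - t'\<bar> + W1 \<eta> \<eta>' + \<bar>x - x'\<bar> + \<bar>a - a'\<bar>)"
    and yr_bound: "\<lbrakk>t \<in> {0..T0}; \<eta> \<in> space (prob_algebra (segment_space L))\<rbrakk> \<Longrightarrow>
       \<bar>y t \<eta>\<bar> \<le> R \<and> \<bar>r t \<eta>\<bar> \<le> R"
    and b_bound: "\<lbrakk>t \<in> {0..T0}; \<eta> \<in> space (prob_algebra (segment_space L)); x \<in> {0..L}; a \<in> U\<rbrakk> \<Longrightarrow>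
       \<bar>b t \<eta> x a\<bar> \<le> c_B"
    and minimizer: A1_minimizer and flux_independent: A2
    and admissible: "admissible_step T h"
    and \<nu>_prob: "\<nu> \<in> space (prob_algebra (path_space T L))"
    and x0_range: "x0 \<in> {0..L}"
begin

section \<open>The grid in space and time\<close>

definition m :: int where "m = \<lfloor>L / h\<rfloor>"

definition N :: nat where "N = nat \<lfloor>T / Delta\<rfloor>"

abbreviation pos :: "int \<Rightarrow> real" where "pos k \<equiv> of_int k * h"

text \<open>The time at which \<open>n\<close> steps remain; \<open>0\<close> for \<open>n > N\<close> because of truncated subtraction.\<close>

definition tm :: "nat \<Rightarrow> real" where "tm n = real (N - n) * Delta"

lemma h_pos: "0 < h" and h_B: "h * c_B < \<sigma>\<^sup>2"
  using admissible by (auto simp: admissible_step_def)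

lemma Delta_pos: "0 < Delta"
  using h_pos \<sigma>_pos by (simp add: Delta_def)

lemma L_eq: "pos m = L"
proof -
  have "L / h \<in> \<int>" using admissible by (simp add: admissible_step_def)
  then obtain z where "L / h = of_int z" by (elim Ints_cases)
  then have "L / h = of_int m" by (simp add: m_def)
  then show ?thesis using h_pos by (simp add: divide_eq_eq)
qed

lemma m_pos: "1 \<le> m"
proof -
  have "0 < pos m" using L_pos by (simp add: L_eq)
  then have "0 < m" using h_pos by (simp add: zero_less_mult_iff)
  then show ?thesis by simp
qed

lemma T_eq: "real N * Delta = T"
proof -
  have "T / Delta \<in> \<int>" using admissible by (simp add: admissible_step_def Delta_def)
  then obtain z where z: "T / Delta = of_int z" by (elim Ints_cases)
  have "0 \<le> T / Delta" using T_pos Delta_pos by simp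
  then have "0 \<le> z" unfolding z by simp
  then have "T / Delta = real N" by (simp add: N_def z)
  then show ?thesis using Delta_pos by (simp add: divide_eq_eq)
qed

lemma N_pos: "1 \<le> N"
proof (rule ccontr)
  assume "\<not> 1 \<le> N"
  then have "N = 0" by simp
  then show False using T_eq T_pos by simp
qed

lemma tm_range: "tm n \<in> {0..T}" "tm n \<in> {0..T0}"
proof -
  have "real (N - n) * Delta \<le> real N * Delta"
    using Delta_pos by (intro mult_right_mono) auto
  then show "tm n \<in> {0..T}" using Delta_pos unfolding T_eq by (simp add: tm_def)
  then show "tm n \<in> {0..T0}" using T_le by simp
qed

lemma tm_Suc: "Suc n \<le> N \<Longrightarrow> tm (Suc n) + Delta = tm n"
proof -
  assume "Suc n \<le> N"
  then have "real (N - n) = real (N - Suc n) + 1" by (simp add: of_nat_diff)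
  then show ?thesis by (simp add: tm_def algebra_simps)
qed

lemma tm_0: "tm 0 = T"
  by (simp add: tm_def T_eq)

lemma marg_prob: "marg s \<in> space (prob_algebra (segment_space L))"
  by (rule marginal_prob[OF \<nu>_prob])

lemma pos_range: "k \<in> {0..m} \<Longrightarrow> pos k \<in> {0..L}"
  using h_pos mult_right_mono[of "of_int k" "of_int m" h] by (auto simp: L_eq)

lemma pos_eq_iff [simp]: "pos k = pos k' \<longleftrightarrow> k = k'"
  using h_pos by simp

lemma S0_eq: "S0 = pos ` {0..m}"
proof -
  have "x \<in> S0 \<longleftrightarrow> (\<exists>k. 0 \<le> k \<and> k \<le> m \<and> x = pos k)" for x
  proof
    assume "x \<in> S0"
    then obtain k :: nat where "x = real k * h" "real k * h \<le> pos m" unfolding S0_def L_eq by blast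
    then show "\<exists>k. 0 \<le> k \<and> k \<le> m \<and> x = pos k"
      using h_pos by (intro exI[of _ "int k"]) auto
  next
    assume "\<exists>k. 0 \<le> k \<and> k \<le> m \<and> x = pos k"
    then obtain k where k: "0 \<le> k" "k \<le> m" "x = pos k" by blast
    then show "x \<in> S0"
      using pos_range[of k] by (auto simp: S0_def intro!: exI[of _ "nat k"])
  qed
  then show ?thesis unfolding set_eq_iff image_iff Bex_def atLeastAtMost_iff by blast
qed

lemma reflection_states: "- h = pos (-1)" "L + h = pos (m + 1)"
  using L_eq by (simp_all add: algebra_simps)

lemma S_eq: "S = pos ` {-1..m + 1}"
proof -
  have "{-1..m + 1} = {-1} \<union> {0..m} \<union> {m + 1}" using m_pos by auto
  then have "pos ` {-1..m + 1} = {pos (-1)} \<union> S0 \<union> {pos (m + 1)}"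
    by (simp only: image_Un S0_eq image_insert image_empty)
  then show ?thesis unfolding S_def reflection_states by (rule sym)
qed

lemma pos_in_S0 [simp]: "pos k \<in> S0 \<longleftrightarrow> k \<in> {0..m}"
  using h_pos by (auto simp: S0_eq)

lemma pos_in_reflection [simp]: "pos k \<in> {- h, L + h} \<longleftrightarrow> k = -1 \<or> k = m + 1"
  unfolding reflection_states insert_iff pos_eq_iff by simp

lemma kernel_interior:
  assumes "k \<in> {0..m}"
  shows "kernel t \<eta> u (pos k) (pos (k + 1)) = (h * b t \<eta> (pos k) u + \<sigma>\<^sup>2) / (2 * \<sigma>\<^sup>2)"
    and "kernel t \<eta> u (pos k) (pos (k - 1)) = 1 - (h * b t \<eta> (pos k) u + \<sigma>\<^sup>2) / (2 * \<sigma>\<^sup>2)"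
proof -
  have *: "pos (k - 1) = pos k - h" "pos (k + 1) = pos k + h" by (simp_all add: algebra_simps)
  show "kernel t \<eta> u (pos k) (pos (k + 1)) = (h * b t \<eta> (pos k) u + \<sigma>\<^sup>2) / (2 * \<sigma>\<^sup>2)"
    using assms unfolding kernel_def pos_in_S0 * by simp
  show "kernel t \<eta> u (pos k) (pos (k - 1)) = 1 - (h * b t \<eta> (pos k) u + \<sigma>\<^sup>2) / (2 * \<sigma>\<^sup>2)"
    using assms h_pos \<sigma>_pos unfolding kernel_def pos_in_S0 * by (simp add: field_simps)
qed

lemma kernel_reflection:
  "kernel t \<eta> u (pos (m + 1)) (pos m) = 1" "kernel t \<eta> u (pos (-1)) (pos 0) = 1"
proof -
  have "pos (-1) \<noteq> L + h" unfolding reflection_states pos_eq_iff using m_pos by simp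
  then show "kernel t \<eta> u (pos (-1)) (pos 0) = 1"
    unfolding kernel_def pos_in_S0 by simp
  show "kernel t \<eta> u (pos (m + 1)) (pos m) = 1"
    unfolding kernel_def pos_in_S0 reflection_states pos_eq_iff using m_pos L_eq by simp
qed

lemma W1_segment_self: "W1 \<eta> \<eta> = 0" if "\<eta> \<in> space (prob_algebra (segment_space L))"
proof -
  have p: "prob_space \<eta>" and s: "sets \<eta> = sets (segment_space L)" using that by (auto simp: space_prob_algebra)
  have id: "(\<lambda>x. (x, x)) \<in> \<eta> \<rightarrow>\<^sub>M \<eta> \<Otimes>\<^sub>M \<eta>" by measurable
  let ?\<pi> = "distr \<eta> (\<eta> \<Otimes>\<^sub>M \<eta>) (\<lambda>x. (x, x))"
  have "?\<pi> \<in> couplings \<eta> \<eta>"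
    unfolding couplings_def space_prob_algebra
    by (auto simp: prob_space.prob_space_distr[OF p id] distr_distr comp_def distr_id)
  moreover have "(\<integral>\<^sup>+ p. ennreal (dist (fst p) (snd p)) \<partial>?\<pi>) \<le> ennreal 0"
    by (rule order_trans[OF nn_integral_distr_le[OF id]]) simp
  ultimately have "W1 \<eta> \<eta> \<le> 0" by (rule W1_le) simp
  then show ?thesis using W1_nonneg[of \<eta> \<eta>] by simp
qed

lemma alpha_hat_minimizes:
  assumes "t \<in> {0..T0}" "\<eta> \<in> space (prob_algebra (segment_space L))" "x \<in> {0..L}"
  shows "alpha_hat t \<eta> x p \<in> U"
    and "u \<in> U \<Longrightarrow> f t \<eta> x (alpha_hat t \<eta> x p) + b t \<eta> x (alpha_hat t \<eta> x p) * p \<le> f t \<eta> x u + b t \<eta> x u * p"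
proof -
  have "\<exists>u. is_arg_min (\<lambda>u. f t \<eta> x u + b t \<eta> x u * p) (\<lambda>u. u \<in> U) u"
    using minimizer assms unfolding A1_minimizer_def by blast
  then have "is_arg_min (\<lambda>u. f t \<eta> x u + b t \<eta> x u * p) (\<lambda>u. u \<in> U) (alpha_hat t \<eta> x p)"
    unfolding alpha_hat_def arg_min_on_def arg_min_def by (rule someI_ex)
  then show "alpha_hat t \<eta> x p \<in> U"
    and "u \<in> U \<Longrightarrow> f t \<eta> x (alpha_hat t \<eta> x p) + b t \<eta> x (alpha_hat t \<eta> x p) * p \<le> f t \<eta> x u + b t \<eta> x u * p"
    by (auto simp: is_arg_min_def not_less)
qed

lemma U_nonempty: "U \<noteq> {}"
proof -
  have "0 \<in> {0..T0}" "0 \<in> {0..L}" using T_pos T_le L_pos by auto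
  then show ?thesis using alpha_hat_minimizes(1)[OF _ marg_prob] by blast
qed

text \<open>Nothing is known about the regularity of \<open>marg\<close> in time. By (A2) the
  measure at time \<open>t'\<close> may be replaced by the one at time \<open>t\<close>, and then
  only the time argument changes.\<close>

lemma yr_lip:
  assumes "t \<in> {0..T0}" "t' \<in> {0..T0}"
  shows "\<bar>y t (marg t) - y t' (marg t')\<bar> \<le> c * \<bar>t - t'\<bar>" "\<bar>r t (marg t) - r t' (marg t')\<bar> \<le> c * \<bar>t - t'\<bar>"
proof -
  obtain u where u: "u \<in> U" using U_nonempty by blast
  have z: "0 \<in> {0..L}" using L_pos by simp
  have eq: "y t' (marg t') = y t' (marg t)" "r t' (marg t') = r t' (marg t)"
    using flux_independent assms marg_prob unfolding A2_def by blast+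
  show "\<bar>y t (marg t) - y t' (marg t')\<bar> \<le> c * \<bar>t - t'\<bar>" "\<bar>r t (marg t) - r t' (marg t')\<bar> \<le> c * \<bar>t - t'\<bar>"
    unfolding eq using lip[OF assms marg_prob[of t] marg_prob[of t] z z u u] W1_segment_self[OF marg_prob[of t]]
    by auto
qed

definition fd :: "nat \<Rightarrow> int \<Rightarrow> real \<Rightarrow> real" where
  "fd n k u = f (tm (Suc n)) (marg (tm (Suc n))) (pos k) u"
definition bd :: "nat \<Rightarrow> int \<Rightarrow> real \<Rightarrow> real" where
  "bd n k u = b (tm (Suc n)) (marg (tm (Suc n))) (pos k) u"
definition gd :: "int \<Rightarrow> real" where
  "gd k = g (marg T) (pos k)"
definition yd :: "nat \<Rightarrow> real" where
  "yd n = y (tm n) (marg (tm n))"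
definition rd :: "nat \<Rightarrow> real" where
  "rd n = r (tm n) (marg (tm n))"
definition ad :: "nat \<Rightarrow> int \<Rightarrow> real \<Rightarrow> real" where
  "ad n k p = alpha_hat (tm (Suc n)) (marg (tm (Suc n))) (pos k) p"

lemma grid: "grid_problem m h \<sigma> Delta U fd bd gd yd rd ad c R c_B"
proof
  show "1 \<le> m" "0 < h" "0 < \<sigma>" "Delta = h\<^sup>2 / \<sigma>\<^sup>2" "h * c_B \<le> \<sigma>\<^sup>2" "0 \<le> c"
    using m_pos h_pos \<sigma>_pos h_B c_nonneg by (auto simp: Delta_def)
  obtain u where u: "u \<in> U" using U_nonempty by blast
  have z: "0 \<in> {0..L}" using L_pos by simp
  have "\<bar>b (tm 0) (marg 0) 0 u\<bar> \<le> c_B" by (rule b_bound[OF tm_range(2) marg_prob z u])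
  then show "0 \<le> c_B" by linarith
  have "\<bar>y (tm 0) (marg 0)\<bar> \<le> R" using yr_bound[OF tm_range(2) marg_prob] by blast
  then show "0 \<le> R" by linarith
  have lp: "\<bar>f t (marg t) (pos k) u - f t (marg t) (pos k') u\<bar> \<le> c * (h * \<bar>k - k'\<bar>) \<and>
      \<bar>b t (marg t) (pos k) u - b t (marg t) (pos k') u\<bar> \<le> c * (h * \<bar>k - k'\<bar>) \<and>
      \<bar>g (marg t) (pos k) - g (marg t) (pos k')\<bar> \<le> c * (h * \<bar>k - k'\<bar>)"
    if "k \<in> {0..m}" "k' \<in> {0..m}" "u \<in> U" "t \<in> {0..T0}" for k k' u t
  proof -
    have "\<bar>pos k - pos k'\<bar> = h * \<bar>k - k'\<bar>"
      unfolding left_diff_distrib[symmetric] abs_mult using h_pos by simp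
    then show ?thesis
      using lip[OF that(4) that(4) marg_prob[of t] marg_prob[of t] pos_range[OF that(1)] pos_range[OF that(2)] that(3) that(3)]
        W1_segment_self[OF marg_prob[of t]] by auto
  qed
  show "\<bar>fd n k u - fd n k' u\<bar> \<le> c * (h * \<bar>k - k'\<bar>)" "\<bar>bd n k u - bd n k' u\<bar> \<le> c * (h * \<bar>k - k'\<bar>)"
    if "k \<in> {0..m}" "k' \<in> {0..m}" "u \<in> U" for n k k' u
    using lp[OF that tm_range(2)] by (auto simp: fd_def bd_def)
  show "\<bar>gd k - gd k'\<bar> \<le> c * (h * \<bar>k - k'\<bar>)" if "k \<in> {0..m}" "k' \<in> {0..m}" for k k'
    using lp[OF that u, of T] T_pos T_le by (auto simp: gd_def)
  show "\<bar>bd n k u\<bar> \<le> c_B" if "k \<in> {0..m}" "u \<in> U" for n k u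
    unfolding bd_def by (rule b_bound[OF tm_range(2) marg_prob pos_range[OF that(1)] that(2)])
  show "\<bar>yd n\<bar> \<le> R" "\<bar>rd n\<bar> \<le> R" for n
    unfolding yd_def rd_def using yr_bound[OF tm_range(2) marg_prob] by blast+
  \<comment> \<open>From \<open>N\<close> on the truncated subtraction keeps \<open>tm\<close> at
    \<open>0\<close>, so the increments are \<open>Delta\<close> or \<open>0\<close> for every
    index.\<close>
  have "\<bar>tm (Suc n) - tm n\<bar> \<le> Delta" for n
    using tm_Suc[of n] Delta_pos by (cases "Suc n \<le> N") (auto simp: tm_def)
  then have *: "c * \<bar>tm (Suc n) - tm n\<bar> \<le> c * Delta" for n
    using c_nonneg by (intro mult_left_mono)
  show "\<bar>yd (Suc n) - yd n\<bar> \<le> c * Delta" "\<bar>rd (Suc n) - rd n\<bar> \<le> c * Delta" for n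
    unfolding yd_def rd_def
    using yr_lip[OF tm_range(2) tm_range(2), of "Suc n" n] * order_trans by blast+
  show "ad n k p \<in> U" if "k \<in> {0..m}" for n k p
    unfolding ad_def by (rule alpha_hat_minimizes(1)[OF tm_range(2) marg_prob pos_range[OF that]])
  show "fd n k (ad n k p) + bd n k (ad n k p) * p \<le> fd n k u + bd n k u * p" if "k \<in> {0..m}" "u \<in> U" for n k u p
    unfolding ad_def fd_def bd_def
    by (rule alpha_hat_minimizes(2)[OF tm_range(2) marg_prob pos_range[OF that(1)] that(2)])
qed

end

sublocale mfg_setup \<subseteq> G: grid_problem m h \<sigma> Delta U fd bd gd yd rd ad c R c_B
  by (rule grid)

context mfg_setup
begin

section \<open>Trajectories that follow the expansion of a walk\<close>

definition starts :: "(nat \<Rightarrow> real) \<Rightarrow> int list \<Rightarrow> bool" where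
  "starts \<xi> w \<longleftrightarrow> (\<forall>i<length w. \<xi> i = pos (w ! i))"

lemma starts_append: "starts \<xi> (w @ w') \<longleftrightarrow> starts \<xi> w \<and> (\<forall>i<length w'. \<xi> (length w + i) = pos (w' ! i))"
proof -
  have "starts \<xi> (w @ w') \<longleftrightarrow> (\<forall>i<length w. \<xi> i = pos (w ! i)) \<and> (\<forall>i<length w'. \<xi> (length w + i) = pos (w' ! i))"
  proof (intro iffI conjI allI impI)
    fix i assume a: "starts \<xi> (w @ w')"
    { assume "i < length w" then show "\<xi> i = pos (w ! i)"
        using a by (auto simp: starts_def nth_append dest: spec[of _ i]) }
    { assume "i < length w'" then show "\<xi> (length w + i) = pos (w' ! i)"
        using a by (auto simp: starts_def nth_append dest: spec[of _ "length w + i"]) }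
  next
    assume a: "(\<forall>i<length w. \<xi> i = pos (w ! i)) \<and> (\<forall>i<length w'. \<xi> (length w + i) = pos (w' ! i))"
    show "starts \<xi> (w @ w')"
      unfolding starts_def
    proof (intro allI impI)
      fix i assume i: "i < length (w @ w')"
      show "\<xi> i = pos ((w @ w') ! i)"
      proof (cases "i < length w")
        case False
        then show ?thesis using conjunct2[OF a, rule_format, of "i - length w"] i by (simp add: nth_append)
      qed (use a in \<open>simp add: nth_append\<close>)
    qed
  qed
  then show ?thesis by (simp add: starts_def)
qed

lemma starts_snoc: "starts \<xi> (w @ [k]) \<longleftrightarrow> starts \<xi> w \<and> \<xi> (length w) = pos k"
  by (simp add: starts_append)

lemma starts_last: "starts \<xi> w \<Longrightarrow> w \<noteq> [] \<Longrightarrow> \<xi> (length w - 1) = pos (last w)"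
  by (simp add: starts_def last_conv_nth)

lemma clock_Suc_interior: "\<xi> n = pos k \<Longrightarrow> k \<in> {0..m} \<Longrightarrow> clock t0 \<xi> (Suc n) = clock t0 \<xi> n + Delta"
  using pos_in_reflection[of k] by auto

lemma clock_Suc_reflection: "\<xi> n = pos k \<Longrightarrow> k = -1 \<or> k = m + 1 \<Longrightarrow> clock t0 \<xi> (Suc n) = clock t0 \<xi> n"
  using pos_in_reflection[of k] by auto

lemma walk_last_m: "walk m ks \<Longrightarrow> last ks \<in> {0..m}"
  using walk_last[of m ks] m_pos by simp

text \<open>Reflection states do not advance the clock, so at the last entry of an expansion it has
  counted the steps of the walk. In \<open>step\<close> the list \<open>w\<close> is what one step
  appends: a state of the segment, or a reflection state followed by the end next to it.\<close>

lemma clock_expand: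
  assumes "walk m ks" "starts \<xi> (expand m ks)"
  shows "clock t0 \<xi> (length (expand m ks) - 1) = t0 + real (length ks - 1) * Delta"
proof -
  have step: "clock t0 \<xi> (length (expand m ks @ w) - 1) = t0 + real (length ks) * Delta"
    if "walk m ks" "starts \<xi> (expand m ks @ w)"
      "clock t0 \<xi> (length (expand m ks) - 1) = t0 + real (length ks - 1) * Delta"
      "w = [k] \<or> (w = [k, k'] \<and> (k = -1 \<or> k = m + 1))" for ks w k k'
  proof -
    have ne: "expand m ks \<noteq> []" "ks \<noteq> []" using walk_nonempty[OF that(1)] by (auto simp: expand_nonempty)
    have st: "starts \<xi> (expand m ks)" using that(2) by (simp add: starts_append)
    have Suc: "Suc (length (expand m ks) - 1) = length (expand m ks)" using ne by (cases "expand m ks") auto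
    have "clock t0 \<xi> (length (expand m ks)) = t0 + real (length ks - 1) * Delta + Delta"
      using clock_Suc_interior[where \<xi> = \<xi> and n = "length (expand m ks) - 1" and ?t0.0 = t0,
          OF starts_last[OF st ne(1), unfolded last_expand] walk_last_m[OF that(1)]]
      unfolding Suc that(3) .
    also have "\<dots> = t0 + real (length ks) * Delta" using ne by (cases ks) (auto simp: algebra_simps)
    finally have 1: "clock t0 \<xi> (length (expand m ks)) = t0 + real (length ks) * Delta" .
    show ?thesis
      using that(4)
    proof
      assume "w = [k, k'] \<and> (k = -1 \<or> k = m + 1)"
      moreover from this have "\<xi> (length (expand m ks)) = pos k"
        using that(2) starts_append[of \<xi> "expand m ks" w] by auto
      ultimately show ?thesis using clock_Suc_reflection[of \<xi> "length (expand m ks)" k t0] 1 by simp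
    qed (use 1 in simp)
  qed
  show ?thesis
    using assms
  proof (induction rule: walk.induct)
    case (up ks)
    have ks: "ks \<noteq> []" "last ks \<in> {0..m}" using walk_nonempty[OF up.hyps] walk_last_m[OF up.hyps] by auto
    note e = expand_up[OF m_pos ks]
    have s: "starts \<xi> (expand m ks)" using up.prems by (simp add: e starts_append)
    show ?case unfolding e
      using step[OF up.hyps _ up.IH[OF s], of "[last ks + 1] @ (if last ks = m then [m] else [])" "last ks + 1" m]
        up.prems[unfolded e] by auto
  next
    case (down ks)
    have ks: "ks \<noteq> []" "last ks \<in> {0..m}" using walk_nonempty[OF down.hyps] walk_last_m[OF down.hyps] by auto
    note e = expand_down[OF m_pos ks]
    have s: "starts \<xi> (expand m ks)" using down.prems by (simp add: e starts_append)
    show ?case unfolding e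
      using step[OF down.hyps _ down.IH[OF s], of "[last ks - 1] @ (if last ks = 0 then [0] else [])" "last ks - 1" 0]
        down.prems[unfolded e] by auto
  qed simp
qed

end

subsection \<open>Histories\<close>

lemma space_history [simp]: "space (history M X \<alpha> n) = space M"
  by (simp add: history_def space_measure_of_conv)

lemma sets_history:
  "sets (history M X \<alpha> n) = sigma_sets (space M)
     ({X j -` B \<inter> space M | j B. j \<le> n \<and> B \<in> sets borel} \<union>
      {\<alpha> j -` B \<inter> space M | j B. j < n \<and> B \<in> sets borel})"
  unfolding history_def by (rule sets_measure_of) auto

lemma state_history_measurable:
  assumes "j \<le> n"
  shows "X j \<in> borel_measurable (history M X \<alpha> n)"
proof (rule measurableI)
  fix B :: "real set" assume "B \<in> sets borel"
  then show "X j -` B \<inter> space (history M X \<alpha> n) \<in> sets (history M X \<alpha> n)"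
    unfolding sets_history space_history using assms by (intro sigma_sets.Basic) blast
qed simp

text \<open>The history at \<open>n\<close> is generated by the states and by earlier controls, each
  measurable with respect to an earlier history; this is what makes the induction run.\<close>

lemma history_subalgebra:
  assumes X: "\<And>n. X n \<in> borel_measurable M"
    and \<alpha>: "\<And>n. \<alpha> n \<in> borel_measurable (history M X \<alpha> n)"
  shows "subalgebra M (history M X \<alpha> n)"
proof (induction n rule: less_induct)
  case (less n)
  have "\<alpha> j \<in> borel_measurable M" if "j < n" for j
    using measurable_from_subalg[OF less[OF that] \<alpha>] .
  then have "sigma_sets (space M)
     ({X j -` B \<inter> space M | j B. j \<le> n \<and> B \<in> sets borel} \<union>
      {\<alpha> j -` B \<inter> space M | j B. j < n \<and> B \<in> sets borel}) \<subseteq> sets M"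
    by (intro sets.sigma_sets_subset) (use X measurable_sets in blast)
  then show ?case
    by (simp add: subalgebra_def sets_history)
qed

lemma history_set_invariant:
  fixes X \<alpha> :: "nat \<Rightarrow> 'w \<Rightarrow> real"
  assumes "A \<in> sets (history M X \<alpha> n)" and \<omega>: "\<omega> \<in> space M" "\<omega>' \<in> space M"
    and X: "\<And>i. i \<le> n \<Longrightarrow> X i \<omega> = X i \<omega>'" and \<alpha>: "\<And>i. i < n \<Longrightarrow> \<alpha> i \<omega> = \<alpha> i \<omega>'"
  shows "\<omega> \<in> A \<longleftrightarrow> \<omega>' \<in> A"
  using assms(1) unfolding sets_history
proof (induction rule: sigma_sets.induct)
  case (Basic A)
  then consider j B where "A = X j -` B \<inter> space M" "j \<le> n" | j B where "A = \<alpha> j -` B \<inter> space M" "j < n"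
    by blast
  then show ?case
  proof cases
    case (1 j B)
    then show ?thesis using X[of j] \<omega> by simp
  next
    case (2 j B)
    then show ?thesis using \<alpha>[of j] \<omega> by simp
  qed
next
  case (Union A)
  then show ?case by blast
qed (use \<omega> in blast)+

text \<open>An admissible control is a function of the state trajectory. Sets of a generated
  sigma-algebra do not separate points at which all generators agree; inductively this holds for the
  earlier controls too, and the level set of \<open>\<alpha> n\<close> through
  \<open>\<omega>\<close> is a set of the history.\<close>

lemma history_measurable_const:
  fixes X \<alpha> :: "nat \<Rightarrow> 'w \<Rightarrow> real"
  assumes \<alpha>: "\<And>n. \<alpha> n \<in> borel_measurable (history M X \<alpha> n)"
    and \<omega>: "\<omega> \<in> space M" "\<omega>' \<in> space M" and "\<And>i. i \<le> n \<Longrightarrow> X i \<omega> = X i \<omega>'"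
  shows "\<alpha> n \<omega> = \<alpha> n \<omega>'"
  using assms(4)
proof (induction n rule: less_induct)
  case (less n)
  have "\<alpha> i \<omega> = \<alpha> i \<omega>'" if "i < n" for i
    by (rule less.IH[OF that]) (use that less.prems in auto)
  then have "\<omega> \<in> A \<longleftrightarrow> \<omega>' \<in> A" if "A \<in> sets (history M X \<alpha> n)" for A
    using history_set_invariant[OF that \<omega>] less.prems by blast
  moreover have "\<alpha> n -` {\<alpha> n \<omega>} \<inter> space M \<in> sets (history M X \<alpha> n)"
    by (rule measurable_sets[OF \<alpha>[of n], of "{\<alpha> n \<omega>}", unfolded space_history]) simp
  ultimately have "\<omega> \<in> \<alpha> n -` {\<alpha> n \<omega>} \<inter> space M \<longleftrightarrow> \<omega>' \<in> \<alpha> n -` {\<alpha> n \<omega>} \<inter> space M"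
    by blast
  then show ?case using \<omega> by simp
qed

subsection \<open>Probabilities of cylinders\<close>

context mfg_setup
begin

definition cyl :: "'w measure \<Rightarrow> (nat \<Rightarrow> 'w \<Rightarrow> real) \<Rightarrow> int list \<Rightarrow> 'w set" where
  "cyl M X w = {\<omega> \<in> space M. starts (\<lambda>n. X n \<omega>) w}"

lemma cyl_snoc: "cyl M X (w @ [k]) = cyl M X w \<inter> (X (length w) -` {pos k} \<inter> space M)"
  by (auto simp: cyl_def starts_snoc)

lemma cyl_append_subset: "cyl M X (w @ w') \<subseteq> cyl M X w"
  by (auto simp: cyl_def starts_append)

lemma cyl_history: "length w \<le> Suc n \<Longrightarrow> cyl M X w \<in> sets (history M X \<alpha> n)"
proof (induction w rule: rev_induct)
  case Nil
  have "cyl M X [] = space (history M X \<alpha> n)" by (auto simp: cyl_def starts_def)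
  then show ?case by (metis sets.top)
next
  case (snoc k w)
  then have "X (length w) \<in> borel_measurable (history M X \<alpha> n)"
    by (intro state_history_measurable) auto
  from measurable_sets[OF this, of "{pos k}"] snoc show ?case by (auto simp: cyl_snoc)
qed

context
  fixes M :: "'w measure" and X \<alpha> :: "nat \<Rightarrow> 'w \<Rightarrow> real" and t0 x :: real
  assumes chain: "controlled_chain t0 x M X \<alpha>"
begin

lemma chain_prob_space: "prob_space M"
  and chain_states_measurable: "X n \<in> borel_measurable M"
  and chain_states: "\<omega> \<in> space M \<Longrightarrow> X n \<omega> \<in> S"
  and chain_start: "\<omega> \<in> space M \<Longrightarrow> X 0 \<omega> = x"
  and chain_control_measurable: "\<alpha> n \<in> borel_measurable (history M X \<alpha> n)"
  and chain_control: "\<omega> \<in> space M \<Longrightarrow> \<alpha> n \<omega> \<in> U"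
  using chain unfolding controlled_chain_def by blast+

lemma chain_subalgebra: "subalgebra M (history M X \<alpha> n)"
  by (rule history_subalgebra[OF chain_states_measurable chain_control_measurable])

lemma cyl_measurable [measurable]: "cyl M X w \<in> sets M"
  using chain_subalgebra[of "length w"] cyl_history[of w "length w" M X \<alpha>]
  unfolding subalgebra_def by auto

lemma control_const_on_cyl:
  assumes "\<omega> \<in> cyl M X w" "\<omega>' \<in> cyl M X w" "w \<noteq> []"
  shows "\<alpha> (length w - 1) \<omega> = \<alpha> (length w - 1) \<omega>'"
proof (rule history_measurable_const[OF chain_control_measurable])
  show "\<omega> \<in> space M" "\<omega>' \<in> space M" using assms by (auto simp: cyl_def)
  fix i assume "i \<le> length w - 1"
  moreover have "0 < length w" using assms(3) by simp
  ultimately have "i < length w" by linarith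
  then show "X i \<omega> = X i \<omega>'" using assms by (auto simp: cyl_def starts_def)
qed

text \<open>The cylinder belongs to the history, so the conditional law may be integrated over it;
  clock, state and kernel are constant there.\<close>

lemma step_prob:
  assumes w: "w \<noteq> []" and k: "k \<in> {-1..m + 1}"
    and clock: "\<And>\<omega>. \<omega> \<in> cyl M X w \<Longrightarrow> clock t0 (\<lambda>j. X j \<omega>) (length w - 1) = \<tau>"
    and running: "\<tau> < T \<or> (\<tau> = T \<and> (last w = -1 \<or> last w = m + 1))"
    and kernel: "\<And>\<omega>. \<omega> \<in> cyl M X w \<Longrightarrow>
       kernel \<tau> (marg \<tau>) (\<alpha> (length w - 1) \<omega>) (pos (last w)) (pos k) = K"
  shows "measure M (cyl M X (w @ [k])) = measure M (cyl M X w) * K"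
proof -
  let ?n = "length w - 1" and ?A = "cyl M X w"
  let ?F = "history M X \<alpha> ?n"
  have len: "Suc ?n = length w" using w by (cases w) auto
  interpret prob_space M by (rule chain_prob_space)
  interpret F: finite_measure_subalgebra M ?F
    by unfold_locales (rule chain_subalgebra)
  define E where "E = {\<omega>' \<in> space M. X (Suc ?n) \<omega>' = pos k}"
  have E_eq: "E = X (Suc ?n) -` {pos k} \<inter> space M" by (auto simp: E_def)
  have E[measurable]: "E \<in> sets M"
    unfolding E_eq by (intro measurable_sets[OF chain_states_measurable]) auto
  have A_F: "?A \<in> sets ?F" using cyl_history[of w ?n] len by simp
  have int: "integrable M (indicator E :: 'w \<Rightarrow> real)" by (simp add: emeasure_eq_measure)
  have "pos k \<in> S" unfolding S_eq using k by (rule imageI)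
  then have ae: "AE \<omega> in M. (let \<tau> = clock t0 (\<lambda>j. X j \<omega>) ?n in
           \<tau> < T \<or> (\<tau> = T \<and> X ?n \<omega> \<in> {-h, L + h}) \<longrightarrow>
           real_cond_exp M ?F (indicator E) \<omega> = kernel \<tau> (marg \<tau>) (\<alpha> ?n \<omega>) (X ?n \<omega>) (pos k))"
    using chain unfolding controlled_chain_def E_def by blast
  have ae': "AE \<omega> in M. indicator ?A \<omega> *\<^sub>R real_cond_exp M ?F (indicator E) \<omega> = indicator ?A \<omega> *\<^sub>R K"
    using ae
  proof eventually_elim
    case (elim \<omega>)
    show ?case
    proof (cases "\<omega> \<in> ?A")
      case True
      then have last: "X ?n \<omega> = pos (last w)" using starts_last[of "\<lambda>n. X n \<omega>" w] w by (simp add: cyl_def)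
      show ?thesis
        using elim True running kernel[OF True] pos_in_reflection[of "last w"]
        unfolding Let_def clock[OF True] last by auto
    qed simp
  qed
  have "measure M (cyl M X (w @ [k])) = measure M (?A \<inter> E)"
    unfolding cyl_snoc E_eq len ..
  also have "\<dots> = (\<integral>\<omega>\<in>?A. indicator E \<omega> \<partial>M)"
    by (simp add: set_lebesgue_integral_def indicator_inter_arith[symmetric])
  also have "\<dots> = (\<integral>\<omega>\<in>?A. real_cond_exp M ?F (indicator E) \<omega> \<partial>M)"
    by (rule F.real_cond_exp_intA[OF int A_F])
  also have "\<dots> = (\<integral>\<omega>. indicator ?A \<omega> *\<^sub>R K \<partial>M)"
    unfolding set_lebesgue_integral_def by (rule integral_cong_AE) (use ae' in \<open>auto intro: measurable_from_subalg[OF chain_subalgebra]\<close>)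
  also have "\<dots> = measure M ?A * K" by simp
  finally show ?thesis .
qed

text \<open>A time step of the walk is one step of the chain, or two when the chain leaves the
  segment; the second of these is a reflection and has probability one.\<close>

lemma node_step:
  assumes ks: "walk m ks" and before: "t0 + real (length ks) * Delta \<le> T"
    and \<tau>: "\<tau> = t0 + real (length ks - 1) * Delta" and u: "u \<in> U"
    and const: "\<And>\<omega>. \<omega> \<in> cyl M X (expand m ks) \<Longrightarrow> \<alpha> (length (expand m ks) - 1) \<omega> = u"
    and p: "p = (h * b \<tau> (marg \<tau>) (pos (last ks)) u + \<sigma>\<^sup>2) / (2 * \<sigma>\<^sup>2)"
  shows "measure M (cyl M X (expand m (ks @ [clamp m (last ks + 1)]))) = measure M (cyl M X (expand m ks)) * p"
    and "measure M (cyl M X (expand m (ks @ [clamp m (last ks - 1)]))) = measure M (cyl M X (expand m ks)) * (1 - p)"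
proof -
  let ?w = "expand m ks" and ?k = "last ks"
  have k: "?k \<in> {0..m}" and ne: "ks \<noteq> []" and wne: "?w \<noteq> []"
    using walk_last_m[OF ks] walk_nonempty[OF ks] by (auto simp: expand_nonempty)
  have \<tau>': "\<tau> + Delta = t0 + real (length ks) * Delta"
    using ne unfolding \<tau> by (cases ks) (auto simp: algebra_simps)
  have clock: "clock t0 (\<lambda>j. X j \<omega>) (length ?w - 1) = \<tau>" if "\<omega> \<in> cyl M X ?w" for \<omega>
    unfolding \<tau> using that by (intro clock_expand[OF ks]) (simp add: cyl_def)
  have \<tau>T: "\<tau> < T" using before Delta_pos \<tau>' by linarith
  have first: "measure M (cyl M X (?w @ [?k + 1])) = measure M (cyl M X ?w) * p"
    "measure M (cyl M X (?w @ [?k - 1])) = measure M (cyl M X ?w) * (1 - p)"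
  proof -
    show "measure M (cyl M X (?w @ [?k + 1])) = measure M (cyl M X ?w) * p"
    proof (rule step_prob[OF wne _ clock])
      show "?k + 1 \<in> {-1..m + 1}" using k by simp
      show "kernel \<tau> (marg \<tau>) (\<alpha> (length ?w - 1) \<omega>) (pos (last ?w)) (pos (?k + 1)) = p" if "\<omega> \<in> cyl M X ?w" for \<omega>
        unfolding last_expand const[OF that] p by (rule kernel_interior[OF k])
    qed (use \<tau>T in auto)
    show "measure M (cyl M X (?w @ [?k - 1])) = measure M (cyl M X ?w) * (1 - p)"
    proof (rule step_prob[OF wne _ clock])
      show "?k - 1 \<in> {-1..m + 1}" using k by simp
      show "kernel \<tau> (marg \<tau>) (\<alpha> (length ?w - 1) \<omega>) (pos (last ?w)) (pos (?k - 1)) = 1 - p" if "\<omega> \<in> cyl M X ?w" for \<omega>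
        unfolding last_expand const[OF that] p by (rule kernel_interior[OF k])
    qed (use \<tau>T in auto)
  qed
  \<comment> \<open>The reflection may fall on time \<open>T\<close>, where the transition law is
    imposed at the two reflection states only.\<close>
  have second: "measure M (cyl M X (?w @ [j] @ [j'])) = measure M (cyl M X (?w @ [j]))"
    if "j = -1 \<and> j' = 0 \<or> j = m + 1 \<and> j' = m" for j j'
  proof -
    have "measure M (cyl M X ((?w @ [j]) @ [j'])) = measure M (cyl M X (?w @ [j])) * 1"
    proof (rule step_prob)
      show "clock t0 (\<lambda>j. X j \<omega>) (length (?w @ [j]) - 1) = \<tau> + Delta" if "\<omega> \<in> cyl M X (?w @ [j])" for \<omega>
      proof -
        have \<omega>: "\<omega> \<in> cyl M X ?w" using that cyl_append_subset[of M X ?w "[j]"] by blast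
        then have "X (length ?w - 1) \<omega> = pos ?k"
          using starts_last[of "\<lambda>n. X n \<omega>" ?w] wne by (simp add: cyl_def last_expand)
        from clock_Suc_interior[where \<xi> = "\<lambda>j. X j \<omega>" and n = "length ?w - 1" and ?t0.0 = t0, OF this k]
        show ?thesis using clock[OF \<omega>] wne by simp
      qed
      show "\<tau> + Delta < T \<or> \<tau> + Delta = T \<and> (last (?w @ [j]) = - 1 \<or> last (?w @ [j]) = m + 1)"
        using that before \<tau>' by auto
      show "j' \<in> {-1..m + 1}" using that m_pos by auto
      show "kernel (\<tau> + Delta) (marg (\<tau> + Delta)) (\<alpha> (length (?w @ [j]) - 1) \<omega>) (pos (last (?w @ [j]))) (pos j') = 1" for \<omega>
        using that kernel_reflection by auto
    qed simp
    then show ?thesis by simp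
  qed
  show "measure M (cyl M X (expand m (ks @ [clamp m (?k + 1)]))) = measure M (cyl M X ?w) * p"
    unfolding expand_up[OF m_pos ne k] using first second[of "m + 1" m] by auto
  show "measure M (cyl M X (expand m (ks @ [clamp m (?k - 1)]))) = measure M (cyl M X ?w) * (1 - p)"
    unfolding expand_down[OF m_pos ne k] using first second[of "-1" 0] by auto
qed

end

text \<open>The expectation of \<open>F\<close> over the continuations of \<open>ks\<close> by
  \<open>n\<close> steps. The control \<open>u\<close> takes the whole walk as its argument because
  an admissible control may depend on the history.\<close>

primrec tree :: "(int list \<Rightarrow> real) \<Rightarrow> nat \<Rightarrow> (int list \<Rightarrow> real) \<Rightarrow> int list \<Rightarrow> real" where
  "tree u 0 F ks = F ks"
| "tree u (Suc n) F ks =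
     G.prob_up n (last ks) (u ks) * tree u n F (ks @ [clamp m (last ks + 1)])
     + (1 - G.prob_up n (last ks) (u ks)) * tree u n F (ks @ [clamp m (last ks - 1)])"

text \<open>Up to a null set a cylinder is the disjoint union of the cylinders of its two
  extensions, since their probabilities add up to its own. On the remainder nothing is known about
  \<open>F'\<close>, so the decomposition is an almost sure one.\<close>

lemma tree_integral:
  fixes M :: "'w measure"
  assumes chain: "controlled_chain (tm n0) x M X \<alpha>" and n0: "n0 \<le> N"
    and u: "\<And>ks. u ks \<in> U"
    and \<alpha>: "\<And>ks \<omega>. walk m ks \<Longrightarrow> \<omega> \<in> cyl M X (expand m ks) \<Longrightarrow> \<alpha> (length (expand m ks) - 1) \<omega> = u ks"
    and meas: "F' \<in> borel_measurable M"
    and F: "\<And>ks \<omega>. walk m ks \<Longrightarrow> length ks = Suc n0 \<Longrightarrow> \<omega> \<in> cyl M X (expand m ks) \<Longrightarrow> F' \<omega> = F ks"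
    and "walk m ks" "length ks + n = Suc n0"
  shows "has_bochner_integral M (\<lambda>\<omega>. indicator (cyl M X (expand m ks)) \<omega> * F' \<omega>)
     (measure M (cyl M X (expand m ks)) * tree u n F ks)"
  using assms(7,8)
proof (induction n arbitrary: ks)
  case 0
  interpret prob_space M by (rule chain_prob_space[OF chain])
  have "(\<lambda>\<omega>. indicator (cyl M X (expand m ks)) \<omega> * F' \<omega>) = (\<lambda>\<omega>. indicator (cyl M X (expand m ks)) \<omega> * F ks)"
    using F[OF 0(1)] 0(2) by (auto simp: indicator_def)
  moreover have "has_bochner_integral M (\<lambda>\<omega>. indicator (cyl M X (expand m ks)) \<omega> * F ks)
      (measure M (cyl M X (expand m ks)) * F ks)"
    using cyl_measurable[OF chain]
    by (intro has_bochner_integral_mult_left has_bochner_integral_real_indicator) (auto simp: emeasure_eq_measure)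
  ultimately show ?case by simp
next
  case (Suc n)
  interpret prob_space M by (rule chain_prob_space[OF chain])
  let ?ks1 = "ks @ [clamp m (last ks + 1)]" and ?ks2 = "ks @ [clamp m (last ks - 1)]"
  let ?A = "cyl M X (expand m ks)" and ?A1 = "cyl M X (expand m ?ks1)" and ?A2 = "cyl M X (expand m ?ks2)"
  let ?p = "G.prob_up n (last ks) (u ks)"
  note [measurable] = cyl_measurable[OF chain] meas
  have k: "last ks \<in> {0..m}" and ne: "ks \<noteq> []"
    using walk_last_m[OF Suc.prems(1)] walk_nonempty[OF Suc.prems(1)] by auto
  have sub: "?A1 \<subseteq> ?A" "?A2 \<subseteq> ?A"
    unfolding expand_up[OF m_pos ne k] expand_down[OF m_pos ne k] by (rule cyl_append_subset)+
  have disj: "?A1 \<inter> ?A2 = {}"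
  proof -
    have "X (length (expand m ks)) \<omega> = pos (last ks + 1)" if "\<omega> \<in> ?A1" for \<omega>
      using that unfolding expand_up[OF m_pos ne k] cyl_def starts_append by auto
    moreover have "X (length (expand m ks)) \<omega> = pos (last ks - 1)" if "\<omega> \<in> ?A2" for \<omega>
      using that unfolding expand_down[OF m_pos ne k] cyl_def starts_append by auto
    moreover have "pos (last ks + 1) \<noteq> pos (last ks - 1)" unfolding pos_eq_iff by simp
    ultimately show ?thesis by fastforce
  qed
  have len: "length ks - 1 = n0 - Suc n" "Suc n \<le> n0" "length ks = n0 - n" using Suc.prems(2) ne by (cases ks; simp)+
  have time: "tm (Suc n) = tm n0 + real (length ks - 1) * Delta" "tm n = tm n0 + real (length ks) * Delta"
    unfolding len using n0 len(2) by (auto simp: tm_def of_nat_diff algebra_simps)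
  have p: "?p = (h * b (tm (Suc n)) (marg (tm (Suc n))) (pos (last ks)) (u ks) + \<sigma>\<^sup>2) / (2 * \<sigma>\<^sup>2)"
    by (simp add: G.prob_up_def bd_def)
  have meas1: "measure M ?A1 = measure M ?A * ?p" and meas2: "measure M ?A2 = measure M ?A * (1 - ?p)"
    using tm_range(1)[of n] time
    by (intro node_step[OF chain Suc.prems(1) _ time(1) u _ p] \<alpha>[OF Suc.prems(1)]; simp)+
  have "measure M (?A - (?A1 \<union> ?A2)) = 0"
    using sub disj meas1 meas2
    by (simp add: finite_measure_Diff finite_measure_Union algebra_simps)
  then have "?A - (?A1 \<union> ?A2) \<in> null_sets M"
    by (simp add: null_sets_def emeasure_eq_measure)
  then have ae: "AE \<omega> in M. indicator ?A1 \<omega> * F' \<omega> + indicator ?A2 \<omega> * F' \<omega> = indicator ?A \<omega> * F' \<omega>"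
    by (rule AE_mp[OF AE_not_in]) (use sub disj in \<open>auto simp: indicator_def\<close>)
  have "walk m ?ks1" "walk m ?ks2" using Suc.prems(1) by (auto intro: walk.intros)
  then have "has_bochner_integral M (\<lambda>\<omega>. indicator ?A1 \<omega> * F' \<omega> + indicator ?A2 \<omega> * F' \<omega>)
     (measure M ?A1 * tree u n F ?ks1 + measure M ?A2 * tree u n F ?ks2)"
    using Suc.prems(2) by (intro has_bochner_integral_add Suc.IH) auto
  then have "has_bochner_integral M (\<lambda>\<omega>. indicator ?A \<omega> * F' \<omega>)
     (measure M ?A1 * tree u n F ?ks1 + measure M ?A2 * tree u n F ?ks2)"
    using ae by (subst has_bochner_integral_cong_AE[symmetric]) (auto simp: meas)
  then show ?case
    unfolding meas1 meas2 tree.simps by (simp add: algebra_simps)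
qed

lemma chain_integral:
  fixes M :: "'w measure"
  assumes chain: "controlled_chain (tm n0) (pos k0) M X \<alpha>" and n0: "n0 \<le> N" and k0: "k0 \<in> {0..m}"
    and u: "\<And>ks. u ks \<in> U"
    and \<alpha>: "\<And>ks \<omega>. walk m ks \<Longrightarrow> \<omega> \<in> cyl M X (expand m ks) \<Longrightarrow> \<alpha> (length (expand m ks) - 1) \<omega> = u ks"
    and meas: "F' \<in> borel_measurable M"
    and F: "\<And>ks \<omega>. walk m ks \<Longrightarrow> length ks = Suc n0 \<Longrightarrow> \<omega> \<in> cyl M X (expand m ks) \<Longrightarrow> F' \<omega> = F ks"
  shows "has_bochner_integral M F' (tree u n0 F [k0])"
proof -
  interpret prob_space M by (rule chain_prob_space[OF chain])
  have A: "cyl M X (expand m [k0]) = space M"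
    using chain_start[OF chain] by (auto simp: cyl_def starts_def)
  have "has_bochner_integral M (\<lambda>\<omega>. indicator (cyl M X (expand m [k0])) \<omega> * F' \<omega>)
     (measure M (cyl M X (expand m [k0])) * tree u n0 F [k0])"
    by (rule tree_integral[where u = u and F = F, OF chain n0 u]) (use \<alpha> meas F walk.start[OF k0] in auto)
  then have "has_bochner_integral M (\<lambda>\<omega>. indicator (space M) \<omega> * F' \<omega>) (1 * tree u n0 F [k0])"
    unfolding A prob_space .
  then show ?thesis
    by (subst (asm) has_bochner_integral_cong[where g = F']) auto
qed

text \<open>An empty cylinder yields no value of the control. The default \<open>d\<close> lets the
  caller prescribe one, so that \<open>u\<close> can be made to agree with an optimal feedback at
  every walk that matters and not only at those that occur.\<close>

lemma chain_control_on_walks: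
  fixes M :: "'w measure"
  assumes chain: "controlled_chain t0 x M X \<alpha>" and default: "\<And>ks. d ks \<in> U"
  obtains u where "\<And>ks. u ks \<in> U"
    and "\<And>ks \<omega>. walk m ks \<Longrightarrow> \<omega> \<in> cyl M X (expand m ks) \<Longrightarrow> \<alpha> (length (expand m ks) - 1) \<omega> = u ks"
    and "\<And>ks. walk m ks \<Longrightarrow> cyl M X (expand m ks) = {} \<Longrightarrow> u ks = d ks"
proof -
  define u where "u ks = (if cyl M X (expand m ks) = {} then d ks
     else \<alpha> (length (expand m ks) - 1) (SOME \<omega>. \<omega> \<in> cyl M X (expand m ks)))" for ks
  have some: "(SOME \<omega>. \<omega> \<in> cyl M X w) \<in> cyl M X w" if "cyl M X w \<noteq> {}" for w
    using that by (meson ex_in_conv someI_ex)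
  show ?thesis
  proof
    fix ks
    show "u ks \<in> U"
      using default chain_control[OF chain] some[of "expand m ks"] by (auto simp: u_def cyl_def)
    show "u ks = d ks" if "cyl M X (expand m ks) = {}"
      using that by (simp add: u_def)
    show "\<alpha> (length (expand m ks) - 1) \<omega> = u ks" if "walk m ks" "\<omega> \<in> cyl M X (expand m ks)" for \<omega>
    proof -
      have "cyl M X (expand m ks) \<noteq> {}" "expand m ks \<noteq> []"
        using that walk_nonempty[OF that(1)] by (auto simp: expand_nonempty)
      then show ?thesis
        using control_const_on_cyl[OF chain that(2) some] by (simp add: u_def)
    qed
  qed
qed

end

subsection \<open>Integrals of step functions\<close>

lemma Ico_split: "a \<le> b \<Longrightarrow> b \<le> c \<Longrightarrow> indicator {a..<c} s = (indicator {a..<b} s + indicator {b..<c} s :: real)" for s :: real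
  by (auto simp: indicator_def)

lemma Ioc_split: "a \<le> b \<Longrightarrow> b \<le> c \<Longrightarrow> indicator {a<..c} s = (indicator {a<..b} s + indicator {b<..c} s :: real)" for s :: real
  by (auto simp: indicator_def)

lemma integral_step_function:
  fixes \<phi> :: "real \<Rightarrow> real"
  assumes \<Delta>: "0 < \<Delta>"
    and \<phi>: "\<And>i s. i < n \<Longrightarrow> t + real i * \<Delta> \<le> s \<Longrightarrow> s < t + real (Suc i) * \<Delta> \<Longrightarrow> \<phi> s = c i"
  shows "(LINT s:{t..t + real n * \<Delta>}|lborel. \<phi> s) = (\<Sum>i<n. \<Delta> * c i)"
proof -
  have "has_bochner_integral lborel (\<lambda>s. indicator {t..<t + real k * \<Delta>} s * \<phi> s) (\<Sum>i<k. \<Delta> * c i)" if "k \<le> n" for k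
    using that
  proof (induction k)
    case (Suc k)
    let ?b = "t + real k * \<Delta>" and ?c = "t + real (Suc k) * \<Delta>"
    have bc: "?c = ?b + \<Delta>" by (simp add: algebra_simps)
    have "emeasure lborel {?b..<?c} = ennreal (?c - ?b)"
      by (rule emeasure_lborel_Ico) (use bc \<Delta> in linarith)
    then have "has_bochner_integral lborel (\<lambda>s. indicator {?b..<?c} s * c k) (measure lborel {?b..<?c} * c k)"
      by (intro has_bochner_integral_mult_left has_bochner_integral_real_indicator) (simp_all only: ennreal_less_top infinity_ennreal_def sets_lborel atLeastLessThan_borel)
    then have "has_bochner_integral lborel (\<lambda>s. indicator {?b..<?c} s * \<phi> s) (\<Delta> * c k)"
    proof (subst has_bochner_integral_cong)
      show "indicator {?b..<?c} s * \<phi> s = indicator {?b..<?c} s * c k" for s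
        using \<phi>[of k s] Suc.prems by (auto simp: indicator_def)
      have "measure lborel {?b..<?c} = ?c - ?b"
        by (rule measure_lborel_Ico) (use bc \<Delta> in linarith)
      then show "\<Delta> * c k = measure lborel {?b..<?c} * c k" using bc by simp
    qed auto
    from has_bochner_integral_add[OF Suc.IH this] Suc.prems
    have "has_bochner_integral lborel (\<lambda>s. indicator {t..<?b} s * \<phi> s + indicator {?b..<?c} s * \<phi> s) (\<Sum>i<Suc k. \<Delta> * c i)"
      by simp
    moreover have "indicator {t..<?c} s = (indicator {t..<?b} s + indicator {?b..<?c} s :: real)" for s
      using \<Delta> bc by (intro Ico_split) auto
    ultimately show ?case by (simp only: distrib_right)
  qed (simp add: has_bochner_integral_zero)
  from this[of n]
  have 1: "has_bochner_integral lborel (\<lambda>s. indicator {t..<t + real n * \<Delta>} s * \<phi> s) (\<Sum>i<n. \<Delta> * c i)" by simp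
  have "has_bochner_integral lborel (\<lambda>s. indicator {t + real n * \<Delta>} s * \<phi> (t + real n * \<Delta>))
      (measure lborel {t + real n * \<Delta>} * \<phi> (t + real n * \<Delta>))"
    by (intro has_bochner_integral_mult_left has_bochner_integral_real_indicator) auto
  from has_bochner_integral_add[OF 1 this]
  have "has_bochner_integral lborel (\<lambda>s. indicator {t..<t + real n * \<Delta>} s * \<phi> s
       + indicator {t + real n * \<Delta>} s * \<phi> (t + real n * \<Delta>)) (\<Sum>i<n. \<Delta> * c i)"
    by simp
  moreover have "indicator {t..<t + real n * \<Delta>} s * \<phi> s + indicator {t + real n * \<Delta>} s * \<phi> (t + real n * \<Delta>)
      = indicator {t..t + real n * \<Delta>} s *\<^sub>R \<phi> s" for s
    using \<Delta> by (auto simp: indicator_def)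
  ultimately show ?thesis
    unfolding set_lebesgue_integral_def by (simp only: has_bochner_integral_integral_eq)
qed

text \<open>Constant before \<open>t\<close>, where \<open>nat\<close> of a negative integer is
  \<open>0\<close>, and constant after step \<open>n\<close> by the cap. For monotone
  \<open>A\<close> this is a right-continuous integrator on the whole line, as
  \<open>interval_measure\<close> expects.\<close>

definition stepfun :: "real \<Rightarrow> real \<Rightarrow> nat \<Rightarrow> (nat \<Rightarrow> real) \<Rightarrow> real \<Rightarrow> real" where
  "stepfun t \<Delta> n A s = A (min n (nat \<lfloor>(s - t) / \<Delta>\<rfloor>))"

lemma stepfun_mono:
  assumes "0 < \<Delta>" "\<And>i j. i \<le> j \<Longrightarrow> A i \<le> A j" "s \<le> s'"
  shows "stepfun t \<Delta> n A s \<le> stepfun t \<Delta> n A s'"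
  unfolding stepfun_def using assms(1,3)
  by (intro assms(2) min.mono nat_mono floor_mono divide_right_mono) auto

lemma floor_eq_right:
  assumes "0 < \<Delta>"
  shows "\<exists>b>s. \<forall>s'. s \<le> s' \<and> s' < b \<longrightarrow> \<lfloor>(s' - t) / \<Delta>\<rfloor> = \<lfloor>(s - t) / \<Delta>\<rfloor>"
proof (intro exI conjI allI impI)
  let ?z = "\<lfloor>(s - t) / \<Delta>\<rfloor>"
  have "(s - t) / \<Delta> < of_int ?z + 1" by linarith
  then show "s < t + (of_int ?z + 1) * \<Delta>" using assms by (simp add: field_simps)
  fix s' assume s': "s \<le> s' \<and> s' < t + (of_int ?z + 1) * \<Delta>"
  have "of_int ?z \<le> (s - t) / \<Delta>" by linarith
  also have "\<dots> \<le> (s' - t) / \<Delta>" using s' assms by (simp add: divide_right_mono)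
  finally have "of_int ?z \<le> (s' - t) / \<Delta>" .
  moreover have "(s' - t) / \<Delta> < of_int ?z + 1" using s' assms by (simp add: field_simps)
  ultimately show "\<lfloor>(s' - t) / \<Delta>\<rfloor> = ?z" by (rule floor_unique)
qed

lemma stepfun_right_continuous:
  assumes "0 < \<Delta>"
  shows "continuous (at_right s) (stepfun t \<Delta> n A)"
proof -
  obtain b where b: "s < b" "\<And>s'. s \<le> s' \<Longrightarrow> s' < b \<Longrightarrow> \<lfloor>(s' - t) / \<Delta>\<rfloor> = \<lfloor>(s - t) / \<Delta>\<rfloor>"
    using floor_eq_right[OF assms, of s t] by blast
  have "eventually (\<lambda>s'. stepfun t \<Delta> n A s' = stepfun t \<Delta> n A s) (at_right s)"
    unfolding eventually_at_right[OF b(1)]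
  proof (intro exI[of _ b] conjI allI impI b(1))
    fix s' assume "s < s'" "s' < b"
    then show "stepfun t \<Delta> n A s' = stepfun t \<Delta> n A s"
      unfolding stepfun_def using b(2)[of s'] by (simp only: less_imp_le)
  qed
  then show ?thesis
    unfolding continuous_within by (rule tendsto_eventually)
qed

lemma stepfun_eq:
  assumes "0 < \<Delta>" "i \<le> n" "t + real i * \<Delta> \<le> s" "s < t + real (Suc i) * \<Delta>"
  shows "stepfun t \<Delta> n A s = A i"
proof -
  have "\<lfloor>(s - t) / \<Delta>\<rfloor> = int i"
    using assms by (intro floor_unique) (auto simp: field_simps)
  then show ?thesis using assms by (simp add: stepfun_def)
qed

text \<open>On the interval the measure is a sum of point masses at grid times: the integrator is
  constant between them, so the open gaps are null, being exhausted by the half-open intervals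
  \<open>{?a<..e i}\<close>. Measurability is assumed for the restriction of \<open>\<phi>\<close>
  only, as the flux costs are regular on the horizon only.\<close>

lemma interval_measure_step:
  fixes \<phi> :: "real \<Rightarrow> real"
  assumes \<Delta>: "0 < \<Delta>" and A: "\<And>i j. i \<le> j \<Longrightarrow> A i \<le> A j"
    and \<phi>: "(\<lambda>s. indicator {t<..t + real n * \<Delta>} s * \<phi> s) \<in> borel_measurable borel"
  shows "(LINT s:{t<..t + real n * \<Delta>}|interval_measure (stepfun t \<Delta> n A). \<phi> s)
     = (\<Sum>i<n. \<phi> (t + real (Suc i) * \<Delta>) * (A (Suc i) - A i))"
proof -
  let ?F = "stepfun t \<Delta> n A"
  let ?M = "interval_measure ?F"
  note Ioc = emeasure_interval_measure_Ioc[OF _ stepfun_mono[OF \<Delta> A] stepfun_right_continuous[OF \<Delta>]]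
    measure_interval_measure_Ioc[OF _ stepfun_mono[OF \<Delta> A] stepfun_right_continuous[OF \<Delta>]]
  have piece: "has_bochner_integral ?M (\<lambda>s. indicator {t + real k * \<Delta><..t + real (Suc k) * \<Delta>} s * \<phi> s)
      (\<phi> (t + real (Suc k) * \<Delta>) * (A (Suc k) - A k))" if "k < n" for k
  proof -
    let ?a = "t + real k * \<Delta>" and ?b = "t + real (Suc k) * \<Delta>"
    have ab: "?b = ?a + \<Delta>" by (simp add: algebra_simps)
    have Fa: "?F s = A k" if "?a \<le> s" "s < ?b" for s
      using that \<open>k < n\<close> \<Delta> by (intro stepfun_eq) auto
    have Fb: "?F ?b = A (Suc k)" using \<open>k < n\<close> \<Delta> by (intro stepfun_eq) (auto simp: algebra_simps)
    have null: "{?a<..<?b} \<in> null_sets ?M"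
    proof -
      define e where "e i = ?b - \<Delta> / (real i + 2)" for i :: nat
      have e: "?a \<le> e i" "e i < ?b" for i
        using \<Delta> ab by (auto simp: e_def divide_le_eq)
      have "{?a<..<?b} = (\<Union>i. {?a<..e i})"
      proof (intro equalityI subsetI)
        fix s assume s: "s \<in> {?a<..<?b}"
        obtain i :: nat where i: "\<Delta> / (?b - s) < real i" using reals_Archimedean2 by blast
        then have "\<Delta> \<le> (?b - s) * (real i + 2)" using s by (simp add: divide_less_eq algebra_simps)
        then have "\<Delta> / (real i + 2) \<le> ?b - s" by (simp add: divide_le_eq)
        then have "s \<le> e i" by (simp add: e_def)
        then show "s \<in> (\<Union>i. {?a<..e i})" using s by auto
      next
        fix s assume "s \<in> (\<Union>i. {?a<..e i})"
        then obtain i where "?a < s" "s \<le> e i" by auto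
        then show "s \<in> {?a<..<?b}" using e(2)[of i] by simp
      qed
      moreover have "{?a<..e i} \<in> null_sets ?M" for i
        using e[of i] Fa[of "e i"] Fa[of ?a] \<Delta> ab by (simp add: null_sets_def Ioc)
      ultimately show ?thesis by (simp add: null_sets_UN)
    qed
    have "has_bochner_integral ?M (\<lambda>s. indicator {?a<..?b} s * \<phi> ?b) (measure ?M {?a<..?b} * \<phi> ?b)"
      using \<Delta> ab by (intro has_bochner_integral_mult_left has_bochner_integral_real_indicator) (auto simp: Ioc)
    moreover have "measure ?M {?a<..?b} = A (Suc k) - A k"
      using \<Delta> ab Fa[of ?a] Fb by (simp add: Ioc)
    moreover have "has_bochner_integral ?M (\<lambda>s. indicator {?a<..?b} s * \<phi> ?b) x \<longleftrightarrow>
        has_bochner_integral ?M (\<lambda>s. indicator {?a<..?b} s * \<phi> s) x" for x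
    proof (rule has_bochner_integral_cong_AE)
      have "AE s in ?M. s \<notin> {?a<..<?b}" by (rule AE_not_in[OF null])
      then show "AE s in ?M. indicator {?a<..?b} s * \<phi> ?b = indicator {?a<..?b} s * \<phi> s"
      proof eventually_elim
        case (elim s)
        then have "s \<in> {?a<..?b} \<Longrightarrow> s = ?b" by auto
        then show ?case by (cases "s \<in> {?a<..?b}") auto
      qed
      have "{?a<..?b} \<subseteq> {t<..t + real n * \<Delta>}"
      proof -
        have "real (Suc k) * \<Delta> \<le> real n * \<Delta>" using \<open>k < n\<close> \<Delta> by (intro mult_right_mono) auto
        moreover have "0 \<le> real k * \<Delta>" using \<Delta> by simp
        ultimately show ?thesis by auto
      qed
      then have "indicator {?a<..?b} s * \<phi> s = indicator {?a<..?b} s * (indicator {t<..t + real n * \<Delta>} s * \<phi> s)" for s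
        by (auto simp: indicator_def)
      moreover have "(\<lambda>s. indicator {?a<..?b} s * (indicator {t<..t + real n * \<Delta>} s * \<phi> s)) \<in> borel_measurable borel"
        using \<phi> by measurable
      ultimately show "(\<lambda>s. indicator {?a<..?b} s * \<phi> s) \<in> borel_measurable ?M"
        by (simp only: measurable_cong_sets[OF sets_interval_measure refl])
    qed auto
    ultimately show ?thesis by (simp add: mult.commute)
  qed
  have "has_bochner_integral ?M (\<lambda>s. indicator {t<..t + real k * \<Delta>} s * \<phi> s)
      (\<Sum>i<k. \<phi> (t + real (Suc i) * \<Delta>) * (A (Suc i) - A i))" if "k \<le> n" for k
    using that
  proof (induction k)
    case (Suc k)
    let ?b = "t + real k * \<Delta>" and ?c = "t + real (Suc k) * \<Delta>"
    have "has_bochner_integral ?M (\<lambda>s. indicator {t<..?b} s * \<phi> s + indicator {?b<..?c} s * \<phi> s)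
       (\<Sum>i<Suc k. \<phi> (t + real (Suc i) * \<Delta>) * (A (Suc i) - A i))"
      using has_bochner_integral_add[OF Suc.IH piece[of k]] Suc.prems by simp
    moreover have "indicator {t<..?c} s = (indicator {t<..?b} s + indicator {?b<..?c} s :: real)" for s
      using \<Delta> by (intro Ioc_split) auto
    ultimately show ?case by (simp only: distrib_right)
  qed (simp add: has_bochner_integral_zero)
  from this[of n] show ?thesis
    unfolding set_lebesgue_integral_def by (simp add: has_bochner_integral_integral_eq)
qed

subsection \<open>The cost of a trajectory\<close>

lemma walk_take: "walk m ks \<Longrightarrow> i < length ks \<Longrightarrow> walk m (take (Suc i) ks)"
proof (induction rule: walk.induct)
  case (up ks)
  then show ?case by (cases "i < length ks") (auto intro: walk.up)
next
  case (down ks)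
  then show ?case by (cases "i < length ks") (auto intro: walk.down)
qed (auto intro: walk.start)

lemma expand_append: "ks \<noteq> [] \<Longrightarrow> \<exists>w. expand m (ks @ zs) = expand m ks @ w"
proof (induction zs rule: rev_induct)
  case (snoc z zs)
  then obtain w where "expand m (ks @ zs) = expand m ks @ w" by blast
  then show ?case using snoc.prems expand_snoc[of "ks @ zs" m z] by auto
qed simp

definition visits :: "int \<Rightarrow> int list \<Rightarrow> nat" where
  "visits j w = length (filter ((=) j) w)"

lemma visits_append [simp]: "visits j (w @ w') = visits j w + visits j w'"
  by (simp add: visits_def)

context mfg_setup
begin

lemma starts_take: "walk m ks \<Longrightarrow> starts \<xi> (expand m ks) \<Longrightarrow> i < length ks \<Longrightarrow> starts \<xi> (expand m (take (Suc i) ks))"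
proof -
  assume "walk m ks" "starts \<xi> (expand m ks)" "i < length ks"
  moreover from this have "take (Suc i) ks \<noteq> []" by auto
  from expand_append[OF this, of m "drop (Suc i) ks"] obtain w where
    "expand m ks = expand m (take (Suc i) ks) @ w" by auto
  ultimately show ?thesis by (simp add: starts_append)
qed

lemma grid_floor_shift:
  assumes "t = real j * Delta"
  shows "grid_floor s = t + of_int \<lfloor>(s - t) / Delta\<rfloor> * Delta"
proof -
  have "s / Delta = (s - t) / Delta + of_int (int j)" using Delta_pos assms by (simp add: field_simps)
  then have "\<lfloor>s / Delta\<rfloor> = \<lfloor>(s - t) / Delta\<rfloor> + int j" by simp
  then show ?thesis by (simp add: grid_floor_def assms algebra_simps)
qed

lemma grid_floor_eq:
  assumes "t = real j * Delta" "t + real i * Delta \<le> s" "s < t + real (Suc i) * Delta"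
  shows "grid_floor s = t + real i * Delta"
proof -
  have "\<lfloor>(s - t) / Delta\<rfloor> = int i"
    using assms(2,3) Delta_pos by (intro floor_unique) (auto simp: field_simps)
  then show ?thesis using grid_floor_shift[OF assms(1), of s] by simp
qed

lemma clock_mono: "n \<le> n' \<Longrightarrow> clock t0 \<xi> n \<le> clock t0 \<xi> n'"
  by (rule lift_Suc_mono_le[of "clock t0 \<xi>"]) (use Delta_pos in auto)

text \<open>The last entry of an expansion lies in the segment, so the clock moves on immediately
  after it. By monotonicity the set in \<open>step_at\<close> is then finite, with this index as its
  maximum.\<close>

lemma step_at_expand:
  assumes ks: "walk m ks" "starts \<xi> (expand m ks)"
    and s: "grid_floor s = t0 + real (length ks - 1) * Delta"
  shows "step_at t0 \<xi> s = length (expand m ks) - 1"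
proof -
  let ?n = "length (expand m ks) - 1"
  have ne: "expand m ks \<noteq> []" using walk_nonempty[OF ks(1)] by (simp add: expand_nonempty)
  have c: "clock t0 \<xi> ?n = grid_floor s" unfolding s by (rule clock_expand[OF ks])
  have "\<xi> ?n = pos (last ks)" using starts_last[OF ks(2) ne] by (simp add: last_expand)
  from clock_Suc_interior[where ?t0.0 = t0 and \<xi> = \<xi> and n = ?n, OF this walk_last_m[OF ks(1)]]
  have "clock t0 \<xi> (Suc ?n) > grid_floor s" using c Delta_pos by linarith
  then have le: "n \<le> ?n" if "clock t0 \<xi> n = grid_floor s" for n
    using clock_mono[of "Suc ?n" n t0 \<xi>] that by (force simp: not_le[symmetric] Suc_le_eq)
  show ?thesis
    unfolding step_at_def
  proof (rule Max_eqI)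
    show "finite {n. clock t0 \<xi> n = grid_floor s}"
      by (rule finite_subset[of _ "{..?n}"]) (use le in auto)
  qed (use c le in auto)
qed

lemma sum_visits:
  "starts \<xi> w \<Longrightarrow> (\<Sum>j<length w. if \<xi> j = pos k then 1 else 0 :: real) = real (visits k w)"
proof (induction w rule: rev_induct)
  case (snoc x w)
  then show ?case using h_pos by (simp add: starts_snoc visits_def)
qed (simp add: visits_def)

lemma sum_visits_walk:
  assumes ks: "walk m ks" "starts \<xi> (expand m ks)" and k: "k \<notin> {0..m}"
  shows "(\<Sum>j<length (expand m ks) - 1. if \<xi> j = pos k then 1 else 0 :: real) = real (visits k (expand m ks))"
proof -
  have ne: "expand m ks \<noteq> []" using walk_nonempty[OF ks(1)] by (simp add: expand_nonempty)
  obtain w where w: "expand m ks = w @ [last ks]"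
    using append_butlast_last_id[OF ne] by (metis last_expand)
  \<comment> \<open>The reflection terms count the indices strictly before the last one; the last
    entry is no reflection state, so the whole expansion may be counted instead.\<close>
  have "last ks \<noteq> k" using walk_last_m[OF ks(1)] k by auto
  then show ?thesis
    using sum_visits[of \<xi> w k] ks(2) unfolding w starts_snoc by (auto simp: visits_def)
qed

definition flux_cost :: "nat \<Rightarrow> int \<Rightarrow> int \<Rightarrow> real" where
  "flux_cost n k k' = (if k = k' then (if k = 0 then yd n else rd n) * h else 0)"

text \<open>\<open>n0\<close> is the number of steps that remain at the start of the walk.\<close>

definition running_cost :: "nat \<Rightarrow> (int list \<Rightarrow> real) \<Rightarrow> int list \<Rightarrow> real" where
  "running_cost n0 u ks = (\<Sum>i<length ks - 1. Delta * fd (n0 - Suc i) (ks ! i) (u (take (Suc i) ks))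
      + flux_cost (n0 - Suc i) (ks ! i) (ks ! Suc i))"

definition walk_cost :: "nat \<Rightarrow> (int list \<Rightarrow> real) \<Rightarrow> int list \<Rightarrow> real" where
  "walk_cost n0 u ks = running_cost n0 u ks + gd (last ks)"

lemma flux_measurable:
  assumes "{t<..t'} \<subseteq> {0..T0}"
  shows "(\<lambda>s. indicator {t<..t'} s * y s (marg s)) \<in> borel_measurable borel"
    and "(\<lambda>s. indicator {t<..t'} s * r s (marg s)) \<in> borel_measurable borel"
proof -
  have lipschitz: "continuous_on {t<..t'} \<phi>"
    if "\<And>s s'. s \<in> {0..T0} \<Longrightarrow> s' \<in> {0..T0} \<Longrightarrow> \<bar>\<phi> s - \<phi> s'\<bar> \<le> c * \<bar>s - s'\<bar>" for \<phi> :: "real \<Rightarrow> real"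
  proof (rule continuous_on_subset[OF _ assms])
    have "c-lipschitz_on {0..T0} \<phi>"
      using that c_nonneg by (intro lipschitz_onI) (auto simp: dist_real_def)
    then show "continuous_on {0..T0} \<phi>" by (rule lipschitz_on_continuous_on)
  qed
  show "(\<lambda>s. indicator {t<..t'} s * y s (marg s)) \<in> borel_measurable borel"
    "(\<lambda>s. indicator {t<..t'} s * r s (marg s)) \<in> borel_measurable borel"
    using borel_measurable_continuous_on_indicator[OF _ lipschitz[OF yr_lip(1)]]
      borel_measurable_continuous_on_indicator[OF _ lipschitz[OF yr_lip(2)]] by simp_all
qed

lemma tm_shift: "i \<le> n0 \<Longrightarrow> n0 \<le> N \<Longrightarrow> tm (n0 - i) = tm n0 + real i * Delta"
  by (simp add: tm_def of_nat_diff algebra_simps)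

context
  fixes ks :: "int list" and \<xi> :: "nat \<Rightarrow> real" and n0 :: nat
  assumes ks: "walk m ks" "starts \<xi> (expand m ks)" and len: "length ks = Suc n0" and n0: "n0 \<le> N"
begin

definition index :: "nat \<Rightarrow> nat" where
  "index i = length (expand m (take (Suc i) ks)) - 1"

lemma step_at_index:
  assumes "i \<le> n0" "grid_floor s = tm n0 + real i * Delta"
  shows "step_at (tm n0) \<xi> s = index i"
  unfolding index_def
  using assms len by (intro step_at_expand walk_take starts_take ks) auto

lemma state_index:
  assumes "i \<le> n0"
  shows "\<xi> (index i) = pos (ks ! i)"
proof -
  have i: "i < length ks" using assms len by simp
  have "take (Suc i) ks \<noteq> []" using i by auto
  then show ?thesis
    unfolding index_def using starts_last[OF starts_take[OF ks i]] i
    by (simp add: expand_nonempty last_expand take_Suc_conv_app_nth)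
qed

lemma grid_floor_remaining:
  assumes "i \<le> n0" "tm n0 + real i * Delta \<le> s" "s < tm n0 + real (Suc i) * Delta"
  shows "grid_floor s = tm n0 + real i * Delta"
  using grid_floor_eq[OF _ assms(2,3), of "N - n0"] by (simp add: tm_def)

lemma horizon: "tm n0 + real n0 * Delta = T"
  using tm_shift[of n0 n0] n0 tm_0 by simp

text \<open>Freezing the integrator outside the horizon corresponds to clipping the index in
  \<open>stepfun\<close>: it is \<open>0\<close> before the start and \<open>n0\<close> from
  \<open>T\<close> on.\<close>

lemma flux_stepfun:
  assumes k: "k \<notin> {0..m}"
  shows "h * (\<Sum>j<step_at (tm n0) \<xi> (max (tm n0) (min T s)). if \<xi> j = pos k then 1 else 0)
    = stepfun (tm n0) Delta n0 (\<lambda>i. h * real (visits k (expand m (take (Suc i) ks)))) s"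
proof -
  let ?s = "max (tm n0) (min T s)" and ?i = "min n0 (nat \<lfloor>(s - tm n0) / Delta\<rfloor>)"
  have s: "grid_floor ?s = tm n0 + real ?i * Delta"
  proof -
    have T: "(T - tm n0) / Delta = real n0" using horizon Delta_pos by (simp add: field_simps)
    consider "s < tm n0" | "tm n0 \<le> s" "s < T" | "T \<le> s" by linarith
    then have "\<lfloor>(?s - tm n0) / Delta\<rfloor> = int ?i"
    proof cases
      case 1
      then have "(s - tm n0) / Delta < 0" using Delta_pos by (simp add: divide_less_0_iff)
      then have "nat \<lfloor>(s - tm n0) / Delta\<rfloor> = 0" by simp
      moreover have "?s = tm n0" using 1 tm_range(1)[of n0] by auto
      ultimately show ?thesis by simp
    next
      case 2
      then have "0 \<le> (s - tm n0) / Delta" using Delta_pos by simp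
      moreover have "(s - tm n0) / Delta < real n0" unfolding T[symmetric] using 2 Delta_pos by (simp add: divide_strict_right_mono)
      ultimately have "nat \<lfloor>(s - tm n0) / Delta\<rfloor> \<le> n0" "0 \<le> \<lfloor>(s - tm n0) / Delta\<rfloor>" by linarith+
      moreover have "?s = s" using 2 by auto
      ultimately show ?thesis by simp
    next
      case 3
      then have "real n0 \<le> (s - tm n0) / Delta" unfolding T[symmetric] using Delta_pos by (simp add: divide_right_mono)
      then have "n0 \<le> nat \<lfloor>(s - tm n0) / Delta\<rfloor>" by linarith
      moreover have "?s = T" using 3 tm_range(1)[of n0] by auto
      ultimately show ?thesis using T by simp
    qed
    then show ?thesis using grid_floor_shift[of "tm n0" "N - n0" ?s] by (simp add: tm_def)
  qed
  have i: "?i < length ks" using len by simp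
  show ?thesis
    unfolding stepfun_def step_at_index[OF min.cobounded1 s] index_def
    using sum_visits_walk[OF walk_take[OF ks(1) i] starts_take[OF ks i] k] by simp
qed

lemma visits_mono: "i \<le> j \<Longrightarrow> visits k (expand m (take (Suc i) ks)) \<le> visits k (expand m (take (Suc j) ks))"
proof -
  assume "i \<le> j"
  then have "take (Suc j) ks = take (Suc i) ks @ drop (Suc i) (take (Suc j) ks)"
    by (metis append_take_drop_id min.absorb2 Suc_le_mono take_take min.commute)
  moreover have "take (Suc i) ks \<noteq> []" using len by auto
  ultimately show ?thesis using expand_append by (metis visits_append le_add1)
qed

lemma visits_Suc:
  assumes "i < n0" "k = -1 \<or> k = m + 1"
  shows "real (visits k (expand m (take (Suc (Suc i)) ks))) - real (visits k (expand m (take (Suc i) ks)))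
    = (if ks ! i = ks ! Suc i \<and> (k = -1 \<longleftrightarrow> ks ! i = 0) then 1 else 0)"
proof -
  have i: "Suc i < length ks" using assms len by simp
  then have take: "take (Suc (Suc i)) ks = take (Suc i) ks @ [ks ! Suc i]" "last (take (Suc i) ks) = ks ! i"
    "take (Suc i) ks \<noteq> []"
    by (auto simp: take_Suc_conv_app_nth)
  have "set ks \<subseteq> {0..m}" using walk_range[of m ks] ks(1) m_pos by simp
  then have "ks ! Suc i \<in> {0..m}" using nth_mem[OF i] by blast
  then have "k \<noteq> ks ! Suc i" using assms(2) by auto
  then show ?thesis
    using assms(2) m_pos unfolding take(1) expand_snoc[OF take(3)] take(2)
    by (auto simp: reflection_def visits_def)
qed

text \<open>The control at the horizon enters only through the running cost at the single time
  \<open>T\<close>, which is a null set; hence \<open>a\<close> is prescribed for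
  \<open>i < n0\<close>.\<close>

lemma path_cost_walk:
  assumes a: "\<And>i. i < n0 \<Longrightarrow> a (index i) = u (take (Suc i) ks)"
  shows "path_cost (tm n0) \<xi> a = walk_cost n0 u ks"
proof -
  let ?t = "tm n0"
  have sub: "{?t<..?t + real n0 * Delta} \<subseteq> {0..T0}" unfolding horizon using tm_range[of n0] T_le by auto
  have 1: "(LINT s:{?t..?t + real n0 * Delta}|lborel. f (grid_floor s) (marg (grid_floor s)) (\<xi> (step_at ?t \<xi> s)) (a (step_at ?t \<xi> s)))
    = (\<Sum>i<n0. Delta * fd (n0 - Suc i) (ks ! i) (u (take (Suc i) ks)))"
  proof (rule integral_step_function[OF Delta_pos])
    fix i s assume i: "i < n0" "?t + real i * Delta \<le> s" "s < ?t + real (Suc i) * Delta"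
    have gf: "grid_floor s = ?t + real i * Delta" using i by (intro grid_floor_remaining) auto
    have "n0 - i = Suc (n0 - Suc i)" using i by simp
    then have t: "?t + real i * Delta = tm (Suc (n0 - Suc i))" using tm_shift[of i n0] n0 i by simp
    show "f (grid_floor s) (marg (grid_floor s)) (\<xi> (step_at ?t \<xi> s)) (a (step_at ?t \<xi> s))
       = fd (n0 - Suc i) (ks ! i) (u (take (Suc i) ks))"
      using step_at_index[OF _ gf] i a[of i] state_index[of i] unfolding gf t fd_def by simp
  qed
  have gfT: "grid_floor T = ?t + real n0 * Delta"
    using horizon Delta_pos by (intro grid_floor_remaining) (auto simp: algebra_simps)
  have "ks ! n0 = last ks" using len walk_nonempty[OF ks(1)] by (simp add: last_conv_nth)
  then have 2: "g (marg T) (\<xi> (step_at ?t \<xi> T)) = gd (last ks)"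
    using step_at_index[OF order_refl gfT] state_index[OF order_refl] by (simp add: gd_def)
  have flux: "(LINT s:{?t<..?t + real n0 * Delta}|interval_measure
        (stepfun ?t Delta n0 (\<lambda>i. h * real (visits k (expand m (take (Suc i) ks))))). \<phi> s)
     = (\<Sum>i<n0. \<phi> (tm (n0 - Suc i)) * (if ks ! i = ks ! Suc i \<and> (k = -1 \<longleftrightarrow> ks ! i = 0) then h else 0))"
    if "k = -1 \<or> k = m + 1" "(\<lambda>s. indicator {?t<..?t + real n0 * Delta} s * \<phi> s) \<in> borel_measurable borel"
    for k and \<phi> :: "real \<Rightarrow> real"
  proof -
    let ?A = "\<lambda>i. h * real (visits k (expand m (take (Suc i) ks)))"
    have "(LINT s:{?t<..?t + real n0 * Delta}|interval_measure (stepfun ?t Delta n0 ?A). \<phi> s)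
      = (\<Sum>i<n0. \<phi> (?t + real (Suc i) * Delta) * (?A (Suc i) - ?A i))"
      using that(2) h_pos visits_mono
      by (intro interval_measure_step Delta_pos mult_left_mono) auto
    also have "\<dots> = (\<Sum>i<n0. \<phi> (tm (n0 - Suc i)) * (if ks ! i = ks ! Suc i \<and> (k = -1 \<longleftrightarrow> ks ! i = 0) then h else 0))"
    proof (rule sum.cong)
      fix i assume "i \<in> {..<n0}"
      then have i: "i < n0" by simp
      have "?A (Suc i) - ?A i = h * (if ks ! i = ks ! Suc i \<and> (k = -1 \<longleftrightarrow> ks ! i = 0) then 1 else 0)"
        unfolding visits_Suc[OF i that(1), symmetric] by (simp add: right_diff_distrib)
      then show "\<phi> (?t + real (Suc i) * Delta) * (?A (Suc i) - ?A i)
         = \<phi> (tm (n0 - Suc i)) * (if ks ! i = ks ! Suc i \<and> (k = -1 \<longleftrightarrow> ks ! i = 0) then h else 0)"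
        using tm_shift[of "Suc i" n0] i n0 by (simp del: of_nat_Suc)
    qed simp
    finally show ?thesis .
  qed
  have "(\<lambda>s. refl_Y ?t \<xi> (max ?t (min T s)))
      = stepfun ?t Delta n0 (\<lambda>i. h * real (visits (-1) (expand m (take (Suc i) ks))))"
    unfolding refl_Y_def reflection_states by (rule ext) (rule flux_stepfun, simp)
  then have 3: "(LINT s:{?t<..?t + real n0 * Delta}|interval_measure (\<lambda>s. refl_Y ?t \<xi> (max ?t (min T s))). y s (marg s))
    = (\<Sum>i<n0. yd (n0 - Suc i) * (if ks ! i = ks ! Suc i \<and> ks ! i = 0 then h else 0))"
    using flux[OF _ flux_measurable(1)[OF sub], of "-1"] by (simp add: yd_def)
  have "(\<lambda>s. refl_R ?t \<xi> (max ?t (min T s)))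
      = stepfun ?t Delta n0 (\<lambda>i. h * real (visits (m + 1) (expand m (take (Suc i) ks))))"
    unfolding refl_R_def reflection_states by (rule ext) (rule flux_stepfun, simp)
  then have 4: "(LINT s:{?t<..?t + real n0 * Delta}|interval_measure (\<lambda>s. refl_R ?t \<xi> (max ?t (min T s))). r s (marg s))
    = (\<Sum>i<n0. rd (n0 - Suc i) * (if ks ! i = ks ! Suc i \<and> ks ! i \<noteq> 0 then h else 0))"
    using flux[OF _ flux_measurable(2)[OF sub], of "m + 1"] m_pos by (simp add: rd_def)
  have "flux_cost n k k' = yd n * (if k = k' \<and> k = 0 then h else 0) + rd n * (if k = k' \<and> k \<noteq> 0 then h else 0)" for n k k'
    by (simp add: flux_cost_def)
  then show ?thesis
    unfolding path_cost_def walk_cost_def running_cost_def 1[unfolded horizon] 2 3[unfolded horizon] 4[unfolded horizon]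
    by (simp add: len sum.distrib)
qed

end

subsection \<open>Verification\<close>

lemma running_cost_snoc:
  assumes "ks \<noteq> []" "length ks + n = n0"
  shows "running_cost n0 u (ks @ [k]) = running_cost n0 u ks + Delta * fd n (last ks) (u ks) + flux_cost n (last ks) k"
proof -
  obtain l where l: "length ks = Suc l" using assms(1) by (cases ks) auto
  then have n: "n0 - Suc l = n" using assms(2) by simp
  have "running_cost n0 u (ks @ [k]) = (\<Sum>i<Suc l. Delta * fd (n0 - Suc i) ((ks @ [k]) ! i) (u (take (Suc i) (ks @ [k])))
      + flux_cost (n0 - Suc i) ((ks @ [k]) ! i) ((ks @ [k]) ! Suc i))"
    by (simp add: running_cost_def l)
  also have "\<dots> = (\<Sum>i<l. Delta * fd (n0 - Suc i) (ks ! i) (u (take (Suc i) ks))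
      + flux_cost (n0 - Suc i) (ks ! i) (ks ! Suc i)) + (Delta * fd n (last ks) (u ks) + flux_cost n (last ks) k)"
    using l n assms(1) by (simp add: nth_append last_conv_nth)
  finally show ?thesis by (simp add: running_cost_def l)
qed

lemma ext_flux:
  assumes "k \<in> {0..m}"
  shows "G.ext n \<phi> (k + 1) = flux_cost n k (clamp m (k + 1)) + \<phi> (clamp m (k + 1))"
    and "G.ext n \<phi> (k - 1) = flux_cost n k (clamp m (k - 1)) + \<phi> (clamp m (k - 1))"
  using assms m_pos by (auto simp: G.ext_def flux_cost_def clamp_def)

text \<open>Under any control the accumulated cost plus \<open>val\<close> is a submartingale along
  the walk, by the one-step Bellman inequality; the induction runs backwards from the
  leaves.\<close>

lemma tree_cost_ge:
  assumes "\<And>ks. u ks \<in> U" "walk m ks" "length ks + n = Suc n0"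
  shows "running_cost n0 u ks + G.val n (last ks) \<le> tree u n (walk_cost n0 u) ks"
  using assms(2,3)
proof (induction n arbitrary: ks)
  case 0
  then show ?case by (simp add: walk_cost_def)
next
  case (Suc n)
  let ?k = "last ks" and ?u = "u ks"
  let ?ks1 = "ks @ [clamp m (?k + 1)]" and ?ks2 = "ks @ [clamp m (?k - 1)]"
  let ?p = "G.prob_up n ?k ?u"
  have k: "?k \<in> {0..m}" and ne: "ks \<noteq> []" using walk_last_m Suc.prems walk_nonempty by auto
  have p: "0 \<le> ?p" "?p \<le> 1" using G.prob_up_range[OF k assms(1)[of ks], of n] by auto
  have IH1: "running_cost n0 u ?ks1 + G.val n (last ?ks1) \<le> tree u n (walk_cost n0 u) ?ks1"
    and IH2: "running_cost n0 u ?ks2 + G.val n (last ?ks2) \<le> tree u n (walk_cost n0 u) ?ks2"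
    using Suc.prems by (intro Suc.IH; auto intro: walk.intros)+
  have rc: "running_cost n0 u (ks @ [j]) = running_cost n0 u ks + Delta * fd n ?k ?u + flux_cost n ?k j" for j
    using Suc.prems by (intro running_cost_snoc ne) auto
  have "running_cost n0 u ks + G.val (Suc n) ?k
     \<le> running_cost n0 u ks + (Delta * fd n ?k ?u + ?p * G.ext n (G.val n) (?k + 1) + (1 - ?p) * G.ext n (G.val n) (?k - 1))"
    by (intro add_left_mono G.val_Suc_le k assms(1))
  also have "\<dots> = ?p * (running_cost n0 u ?ks1 + G.val n (last ?ks1)) + (1 - ?p) * (running_cost n0 u ?ks2 + G.val n (last ?ks2))"
    unfolding ext_flux[OF k] rc by (simp add: algebra_simps)
  also have "\<dots> \<le> tree u (Suc n) (walk_cost n0 u) ks"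
    unfolding tree.simps using p by (intro add_mono mult_left_mono IH1 IH2) auto
  finally show ?case .
qed

text \<open>Under the minimizing feedback the submartingale of \<open>tree_cost_ge\<close> is a
  martingale.\<close>

lemma tree_cost_eq:
  assumes u: "\<And>ks n. walk m ks \<Longrightarrow> length ks + n = n0 \<Longrightarrow> u ks = ad n (last ks) (G.val_slope n (last ks))"
    and "walk m ks" "length ks + n = Suc n0"
  shows "tree u n (walk_cost n0 u) ks = running_cost n0 u ks + G.val n (last ks)"
  using assms(2,3)
proof (induction n arbitrary: ks)
  case 0
  then show ?case by (simp add: walk_cost_def)
next
  case (Suc n)
  let ?k = "last ks" and ?u = "u ks"
  let ?ks1 = "ks @ [clamp m (?k + 1)]" and ?ks2 = "ks @ [clamp m (?k - 1)]"
  let ?p = "G.prob_up n ?k ?u"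
  have k: "?k \<in> {0..m}" and ne: "ks \<noteq> []" using walk_last_m Suc.prems walk_nonempty by auto
  have IH1: "tree u n (walk_cost n0 u) ?ks1 = running_cost n0 u ?ks1 + G.val n (last ?ks1)"
    and IH2: "tree u n (walk_cost n0 u) ?ks2 = running_cost n0 u ?ks2 + G.val n (last ?ks2)"
    using Suc.prems by (intro Suc.IH; auto intro: walk.intros)+
  have rc: "running_cost n0 u (ks @ [j]) = running_cost n0 u ks + Delta * fd n ?k ?u + flux_cost n ?k j" for j
    using Suc.prems by (intro running_cost_snoc ne) auto
  have v: "G.val (Suc n) ?k = Delta * fd n ?k ?u + ?p * G.ext n (G.val n) (?k + 1) + (1 - ?p) * G.ext n (G.val n) (?k - 1)"
    using Suc.prems by (intro G.val_Suc_eq u) auto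
  show ?case
    unfolding tree.simps IH1 IH2 v ext_flux[OF k] rc by (simp add: algebra_simps)
qed

end

subsection \<open>Countably valued measurable functions\<close>

text \<open>This form of measurability passes to every function that factors through it, whatever
  the target space. It gives the measurability of \<open>path_cost\<close> and \<open>X_hat\<close>
  without any analysis of their dependence on the trajectory.\<close>

definition countably_valued :: "'w measure \<Rightarrow> ('w \<Rightarrow> 'a) \<Rightarrow> bool" where
  "countably_valued M f \<longleftrightarrow> countable (f ` space M) \<and> (\<forall>v. {\<omega> \<in> space M. f \<omega> = v} \<in> sets M)"

lemma countably_valued_factor:
  assumes G: "countably_valued M G"
    and F: "\<And>\<omega> \<omega>'. \<omega> \<in> space M \<Longrightarrow> \<omega>' \<in> space M \<Longrightarrow> G \<omega> = G \<omega>' \<Longrightarrow> F \<omega> = F \<omega>'"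
  shows "countably_valued M F"
proof -
  define \<phi> where "\<phi> v = F (SOME \<omega>. \<omega> \<in> space M \<and> G \<omega> = v)" for v
  have \<phi>: "F \<omega> = \<phi> (G \<omega>)" if "\<omega> \<in> space M" for \<omega>
  proof -
    have "(SOME \<omega>'. \<omega>' \<in> space M \<and> G \<omega>' = G \<omega>) \<in> space M \<and> G (SOME \<omega>'. \<omega>' \<in> space M \<and> G \<omega>' = G \<omega>) = G \<omega>"
      by (rule someI[of "\<lambda>\<omega>'. \<omega>' \<in> space M \<and> G \<omega>' = G \<omega>" \<omega>]) (use that in auto)
    then show ?thesis unfolding \<phi>_def using F[OF that] by metis
  qed
  have "F ` space M = \<phi> ` G ` space M" using \<phi> by (auto simp: image_image)
  moreover have "{\<omega> \<in> space M. F \<omega> = v} \<in> sets M" for v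
  proof -
    have "{\<omega> \<in> space M. F \<omega> = v} = (\<Union>w\<in>{w \<in> G ` space M. \<phi> w = v}. {\<omega> \<in> space M. G \<omega> = w})"
      using \<phi> by auto
    also have "\<dots> \<in> sets M"
      using G unfolding countably_valued_def by (intro sets.countable_UN'') (auto intro: countable_subset)
    finally show ?thesis .
  qed
  ultimately show ?thesis using G unfolding countably_valued_def by simp
qed

lemma countably_valued_measurable:
  assumes "countably_valued M f" "\<And>\<omega>. \<omega> \<in> space M \<Longrightarrow> f \<omega> \<in> space N"
  shows "f \<in> M \<rightarrow>\<^sub>M N"
proof (rule measurableI)
  fix A
  have "f -` A \<inter> space M = (\<Union>v\<in>f ` space M \<inter> A. {\<omega> \<in> space M. f \<omega> = v})" by auto
  also have "\<dots> \<in> sets M"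
    using assms(1) unfolding countably_valued_def by (intro sets.countable_UN'') (auto intro: countable_subset)
  finally show "f -` A \<inter> space M \<in> sets M" .
qed (use assms in auto)

lemma countably_valued_Pair:
  assumes "countably_valued M f" "countably_valued M g"
  shows "countably_valued M (\<lambda>\<omega>. (f \<omega>, g \<omega>))"
  unfolding countably_valued_def
proof (intro conjI allI)
  show "countable ((\<lambda>\<omega>. (f \<omega>, g \<omega>)) ` space M)"
    by (rule countable_subset[of _ "f ` space M \<times> g ` space M"])
      (use assms in \<open>auto simp: countably_valued_def\<close>)
  fix v
  have "{\<omega> \<in> space M. (f \<omega>, g \<omega>) = v} = {\<omega> \<in> space M. f \<omega> = fst v} \<inter> {\<omega> \<in> space M. g \<omega> = snd v}" by auto
  then show "{\<omega> \<in> space M. (f \<omega>, g \<omega>) = v} \<in> sets M"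
    using assms by (auto simp: countably_valued_def)
qed

lemma countably_valued_map:
  assumes "\<And>i. i < n \<Longrightarrow> countably_valued M (f i)"
  shows "countably_valued M (\<lambda>\<omega>. map (\<lambda>i. f i \<omega>) [0..<n])"
  using assms
proof (induction n)
  case 0
  have "{\<omega> \<in> space M. [] = v} = (if v = [] then space M else {})" for v :: "'a list" by auto
  then show ?case by (auto simp: countably_valued_def image_constant_conv)
next
  case (Suc n)
  have "countably_valued M (\<lambda>\<omega>. (map (\<lambda>i. f i \<omega>) [0..<n], f n \<omega>))"
    using Suc by (intro countably_valued_Pair) auto
  then show ?case by (rule countably_valued_factor) simp
qed

lemma countably_valued_nat:
  fixes n :: "'w \<Rightarrow> nat"
  assumes "n \<in> M \<rightarrow>\<^sub>M count_space UNIV"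
  shows "countably_valued M n"
  unfolding countably_valued_def using measurable_sets[OF assms, of "{v}" for v]
  by (auto simp: vimage_def Int_def conj_commute)

lemma countably_valued_compose:
  fixes n :: "'w \<Rightarrow> nat"
  assumes n: "countably_valued M n" and f: "\<And>i. countably_valued M (f i)"
  shows "countably_valued M (\<lambda>\<omega>. f (n \<omega>) \<omega>)"
  unfolding countably_valued_def
proof (intro conjI allI)
  show "countable ((\<lambda>\<omega>. f (n \<omega>) \<omega>) ` space M)"
    by (rule countable_subset[of _ "\<Union>i. f i ` space M"]) (use f in \<open>auto simp: countably_valued_def\<close>)
  fix v
  have "{\<omega> \<in> space M. f (n \<omega>) \<omega> = v} = (\<Union>i. {\<omega> \<in> space M. n \<omega> = i} \<inter> {\<omega> \<in> space M. f i \<omega> = v})" by auto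
  also have "\<dots> \<in> sets M" using n f unfolding countably_valued_def by (intro sets.countable_UN) auto
  finally show "{\<omega> \<in> space M. f (n \<omega>) \<omega> = v} \<in> sets M" .
qed

lemma countably_valued_borel:
  fixes X :: "'w \<Rightarrow> real"
  assumes "X \<in> borel_measurable M" "countable A" "\<And>\<omega>. \<omega> \<in> space M \<Longrightarrow> X \<omega> \<in> A"
  shows "countably_valued M X"
  unfolding countably_valued_def
proof (intro conjI allI)
  show "countable (X ` space M)" using assms(2,3) by (auto intro: countable_subset)
  fix v
  have "X -` {v} \<inter> space M \<in> sets M" using assms(1) by (rule measurable_sets) auto
  then show "{\<omega> \<in> space M. X \<omega> = v} \<in> sets M" by (simp add: vimage_def Int_def conj_commute)
qed

subsection \<open>Polygons\<close>

text \<open>A sum of clipped ramps, so that continuity in \<open>s\<close> can be read off; the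
  usual interpolation formula is \<open>polygon_fun_eq\<close>.\<close>

definition polygon_fun :: "nat \<Rightarrow> (nat \<Rightarrow> real) \<Rightarrow> real \<Rightarrow> real" where
  "polygon_fun n z s = z 0 + (\<Sum>i<n. (z (Suc i) - z i) * max 0 (min 1 (s - real i)))"

lemma polygon_fun_eq:
  assumes "real i \<le> s" "s \<le> real i + 1" "i < n"
  shows "polygon_fun n z s = (1 - (s - real i)) * z i + (s - real i) * z (Suc i)"
proof -
  have "polygon_fun n z s = z (min n i) + (if i < n then (s - real i) * (z (Suc i) - z i) else 0)" for n
  proof (induction n)
    case (Suc n)
    have step: "polygon_fun (Suc n) z s = polygon_fun n z s + (z (Suc n) - z n) * max 0 (min 1 (s - real n))"
      by (simp add: polygon_fun_def)
    consider "n < i" | "n = i" | "i < n" by linarith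
    then show ?case
    proof cases
      case 1
      then have "real n + 1 \<le> real i" by simp
      then have "min 1 (s - real n) = 1" using assms by simp
      then show ?thesis using 1 Suc unfolding step by simp
    next
      case 2
      then show ?thesis using assms Suc unfolding step by (simp add: mult.commute)
    next
      case 3
      then have "real i + 1 \<le> real n" by simp
      then have "max 0 (min 1 (s - real n)) = 0" using assms by simp
      then show ?thesis using 3 Suc unfolding step by simp
    qed
  qed (simp add: polygon_fun_def)
  then show ?thesis using assms by (simp add: algebra_simps)
qed

lemma polygon_fun_end: "polygon_fun n z (real n) = z n"
proof (cases n)
  case (Suc k)
  then show ?thesis using polygon_fun_eq[of k "real n" n z] by simp
qed (simp add: polygon_fun_def)

text \<open>The order of quantifiers is the point: nodes and weight depend on \<open>s\<close> but
  not on \<open>z\<close>, so two polygons can be compared at \<open>s\<close> with the same convex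
  combination.\<close>

lemma polygon_fun_convex:
  assumes "0 \<le> s" "s \<le> real n"
  shows "\<exists>i j \<theta>. i \<le> n \<and> j \<le> n \<and> 0 \<le> \<theta> \<and> \<theta> \<le> 1 \<and> (\<forall>z. polygon_fun n z s = (1 - \<theta>) * z i + \<theta> * z j)"
proof (cases "s = real n")
  case True
  then show ?thesis by (intro exI[of _ n] exI[of _ 0]) (auto simp: polygon_fun_end)
next
  case False
  define i where "i = nat \<lfloor>s\<rfloor>"
  have i: "real i \<le> s" "s \<le> real i + 1" using assms by (auto simp: i_def)
  then have "i < n" using False assms by linarith
  then show ?thesis
    using i polygon_fun_eq[of i s n] by (intro exI[of _ i] exI[of _ "Suc i"] exI[of _ "s - real i"]) auto
qed

context mfg_setup
begin

subsection \<open>Measurability of path functionals\<close>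

lemma grid_floor_range:
  assumes "n0 \<le> N" "tm n0 \<le> s" "s \<le> T"
  shows "\<exists>i\<le>n0. grid_floor s = tm n0 + real i * Delta \<and> grid_floor (tm n0 + real i * Delta) = tm n0 + real i * Delta"
proof -
  have t: "tm n0 = real (N - n0) * Delta" by (simp add: tm_def)
  define i where "i = nat \<lfloor>(s - tm n0) / Delta\<rfloor>"
  have "0 \<le> (s - tm n0) / Delta" using assms Delta_pos by simp
  then have i: "int i = \<lfloor>(s - tm n0) / Delta\<rfloor>" by (simp add: i_def)
  have "tm n0 + real n0 * Delta = T" using tm_shift[of n0 n0] assms tm_0 by simp
  then have "(s - tm n0) / Delta \<le> real n0" using assms(3) Delta_pos by (simp add: divide_le_eq algebra_simps)
  then have "i \<le> n0" unfolding i_def by linarith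
  moreover have "grid_floor s = tm n0 + real i * Delta"
    using grid_floor_shift[OF t, of s] unfolding i[symmetric] by simp
  moreover have "grid_floor (tm n0 + real i * Delta) = tm n0 + real i * Delta"
    using Delta_pos by (intro grid_floor_eq[OF t]) (auto simp: algebra_simps)
  ultimately show ?thesis by blast
qed

lemma step_at_cong: "grid_floor s = grid_floor s' \<Longrightarrow> step_at t0 \<xi> s = step_at t0 \<xi> s'"
  by (simp add: step_at_def)

text \<open>The cost is determined by finitely many countably valued quantities, for every
  trajectory and not only for those that follow a walk. Measurability of the cost is deduced from
  this.\<close>

lemma path_cost_cong:
  assumes n0: "n0 \<le> N"
    and eq: "\<And>i. i \<le> n0 \<Longrightarrow> let s = tm n0 + real i * Delta in
       \<xi> (step_at (tm n0) \<xi> s) = \<xi>' (step_at (tm n0) \<xi>' s) \<and> a (step_at (tm n0) \<xi> s) = a' (step_at (tm n0) \<xi>' s) \<and>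
       refl_Y (tm n0) \<xi> s = refl_Y (tm n0) \<xi>' s \<and> refl_R (tm n0) \<xi> s = refl_R (tm n0) \<xi>' s"
  shows "path_cost (tm n0) \<xi> a = path_cost (tm n0) \<xi>' a'"
proof -
  let ?t = "tm n0"
  have all: "\<xi> (step_at ?t \<xi> s) = \<xi>' (step_at ?t \<xi>' s) \<and> a (step_at ?t \<xi> s) = a' (step_at ?t \<xi>' s) \<and>
       refl_Y ?t \<xi> s = refl_Y ?t \<xi>' s \<and> refl_R ?t \<xi> s = refl_R ?t \<xi>' s" if s: "?t \<le> s" "s \<le> T" for s
  proof -
    obtain i where i: "i \<le> n0" "grid_floor s = grid_floor (?t + real i * Delta)"
      using grid_floor_range[OF n0 s] by auto
    show ?thesis
      using eq[OF i(1)] step_at_cong[OF i(2), of ?t \<xi>] step_at_cong[OF i(2), of ?t \<xi>']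
      unfolding Let_def refl_Y_def refl_R_def by simp
  qed
  have T: "?t \<le> T" using tm_range(1)[of n0] by simp
  have 1: "(LINT s:{?t..T}|lborel. f (grid_floor s) (marg (grid_floor s)) (\<xi> (step_at ?t \<xi> s)) (a (step_at ?t \<xi> s)))
     = (LINT s:{?t..T}|lborel. f (grid_floor s) (marg (grid_floor s)) (\<xi>' (step_at ?t \<xi>' s)) (a' (step_at ?t \<xi>' s)))"
  proof (rule set_lebesgue_integral_cong)
    show "\<forall>s. s \<in> {?t..T} \<longrightarrow> f (grid_floor s) (marg (grid_floor s)) (\<xi> (step_at ?t \<xi> s)) (a (step_at ?t \<xi> s))
       = f (grid_floor s) (marg (grid_floor s)) (\<xi>' (step_at ?t \<xi>' s)) (a' (step_at ?t \<xi>' s))"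
    proof (intro allI impI)
      fix s assume "s \<in> {?t..T}"
      then have "?t \<le> s" "s \<le> T" by simp_all
      from all[OF this] show "f (grid_floor s) (marg (grid_floor s)) (\<xi> (step_at ?t \<xi> s)) (a (step_at ?t \<xi> s))
         = f (grid_floor s) (marg (grid_floor s)) (\<xi>' (step_at ?t \<xi>' s)) (a' (step_at ?t \<xi>' s))"
        by (elim conjE) (simp only:)
    qed
  qed simp
  have 2: "refl_Y ?t \<xi> (max ?t (min T s)) = refl_Y ?t \<xi>' (max ?t (min T s))"
    "refl_R ?t \<xi> (max ?t (min T s)) = refl_R ?t \<xi>' (max ?t (min T s))" for s
  proof -
    have "?t \<le> max ?t (min T s)" "max ?t (min T s) \<le> T" using T by simp_all
    from all[OF this] show "refl_Y ?t \<xi> (max ?t (min T s)) = refl_Y ?t \<xi>' (max ?t (min T s))"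
      "refl_R ?t \<xi> (max ?t (min T s)) = refl_R ?t \<xi>' (max ?t (min T s))" by blast+
  qed
  have 3: "\<xi> (step_at ?t \<xi> T) = \<xi>' (step_at ?t \<xi>' T)" using all[of T] T by blast
  show ?thesis by (simp only: path_cost_def 1 2 3)
qed

context
  fixes M :: "'w measure" and X \<alpha> :: "nat \<Rightarrow> 'w \<Rightarrow> real" and t0 x :: real
  assumes chain: "controlled_chain t0 x M X \<alpha>"
begin

lemma chain_states_countable: "countably_valued M (X n)"
  by (rule countably_valued_borel[OF chain_states_measurable[OF chain] _ chain_states[OF chain]])
    (simp add: S_eq)

lemma prefix_factor:
  assumes "\<And>\<omega> \<omega>'. \<omega> \<in> space M \<Longrightarrow> \<omega>' \<in> space M \<Longrightarrow> (\<And>i. i < n \<Longrightarrow> X i \<omega> = X i \<omega>') \<Longrightarrow> F \<omega> = F \<omega>'"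
  shows "countably_valued M F"
proof (rule countably_valued_factor[OF countably_valued_map[of n M X, OF chain_states_countable]])
  fix \<omega> \<omega>' assume \<omega>: "\<omega> \<in> space M" "\<omega>' \<in> space M" and eq: "map (\<lambda>i. X i \<omega>) [0..<n] = map (\<lambda>i. X i \<omega>') [0..<n]"
  have "X i \<omega> = X i \<omega>'" if "i < n" for i
  proof -
    have "i \<in> set [0..<n]" using that by simp
    with eq show ?thesis unfolding map_eq_conv by blast
  qed
  then show "F \<omega> = F \<omega>'" by (rule assms[OF \<omega>])
qed

lemma control_countable: "countably_valued M (\<alpha> n)"
  by (rule prefix_factor[of "Suc n"])
    (rule history_measurable_const[OF chain_control_measurable[OF chain]]; simp)

lemma clock_countable: "countably_valued M (\<lambda>\<omega>. clock t1 (\<lambda>j. X j \<omega>) n)"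
proof (rule prefix_factor[of n])
  fix \<omega> \<omega>' assume "\<And>i. i < n \<Longrightarrow> X i \<omega> = X i \<omega>'"
  then show "clock t1 (\<lambda>j. X j \<omega>) n = clock t1 (\<lambda>j. X j \<omega>') n" by (induction n) simp_all
qed

lemma step_at_countable: "countably_valued M (\<lambda>\<omega>. step_at t1 (\<lambda>j. X j \<omega>) s)"
proof (rule countably_valued_nat)
  have "Measurable.pred M (\<lambda>\<omega>. clock t1 (\<lambda>j. X j \<omega>) n = grid_floor s)" for n
    using clock_countable[of t1 n] by (simp add: pred_def countably_valued_def)
  then show "(\<lambda>\<omega>. step_at t1 (\<lambda>j. X j \<omega>) s) \<in> M \<rightarrow>\<^sub>M count_space UNIV"
    unfolding step_at_def by (rule measurable_Max_nat)
qed

lemma visited_state_countable: "countably_valued M (\<lambda>\<omega>. X (step_at t1 (\<lambda>j. X j \<omega>) s) \<omega>)"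
  by (rule countably_valued_compose[OF step_at_countable chain_states_countable])

lemma refl_countable:
  "countably_valued M (\<lambda>\<omega>. refl_Y t1 (\<lambda>j. X j \<omega>) s)" "countably_valued M (\<lambda>\<omega>. refl_R t1 (\<lambda>j. X j \<omega>) s)"
proof -
  have "countably_valued M (\<lambda>\<omega>. h * (\<Sum>j<n. if X j \<omega> = v then 1 else 0))" for n v
    by (rule prefix_factor[of n]) (rule arg_cong[where f = "(*) h"], rule sum.cong, auto)
  note * = countably_valued_compose[OF step_at_countable this]
  show "countably_valued M (\<lambda>\<omega>. refl_Y t1 (\<lambda>j. X j \<omega>) s)" "countably_valued M (\<lambda>\<omega>. refl_R t1 (\<lambda>j. X j \<omega>) s)"
    unfolding refl_Y_def refl_R_def by (rule *)+
qed

lemma path_cost_measurable: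
  assumes n0: "n0 \<le> N"
  shows "(\<lambda>\<omega>. path_cost (tm n0) (\<lambda>n. X n \<omega>) (\<lambda>n. \<alpha> n \<omega>)) \<in> borel_measurable M"
proof (rule countably_valued_measurable)
  let ?t = "tm n0"
  define G where "G i \<omega> = (let \<xi> = (\<lambda>n. X n \<omega>); s = ?t + real i * Delta in
     ((X (step_at ?t \<xi> s) \<omega>, \<alpha> (step_at ?t \<xi> s) \<omega>), (refl_Y ?t \<xi> s, refl_R ?t \<xi> s)))" for i \<omega>
  have "countably_valued M (G i)" for i
    unfolding G_def Let_def
    by (intro countably_valued_Pair visited_state_countable refl_countable
        countably_valued_compose[OF step_at_countable control_countable])
  then have "countably_valued M (\<lambda>\<omega>. map (\<lambda>i. G i \<omega>) [0..<Suc n0])" by (intro countably_valued_map)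
  then show "countably_valued M (\<lambda>\<omega>. path_cost (tm n0) (\<lambda>n. X n \<omega>) (\<lambda>n. \<alpha> n \<omega>))"
  proof (rule countably_valued_factor)
    fix \<omega> \<omega>' assume *: "map (\<lambda>i. G i \<omega>) [0..<Suc n0] = map (\<lambda>i. G i \<omega>') [0..<Suc n0]"
    have G: "G i \<omega> = G i \<omega>'" if "i \<le> n0" for i
    proof -
      have "i \<in> set [0..<Suc n0]" using that by auto
      with * show ?thesis unfolding map_eq_conv by blast
    qed
    show "path_cost (tm n0) (\<lambda>n. X n \<omega>) (\<lambda>n. \<alpha> n \<omega>) = path_cost (tm n0) (\<lambda>n. X n \<omega>') (\<lambda>n. \<alpha> n \<omega>')"
      by (rule path_cost_cong[OF n0]) (use G in \<open>simp add: G_def Let_def\<close>)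
  qed
qed simp

end

lemma interpolation_range:
  assumes "0 \<le> s" "s \<le> T"
  shows "0 \<le> \<lfloor>s / Delta\<rfloor>" "\<lfloor>s / Delta\<rfloor> \<le> int N"
proof -
  show "0 \<le> \<lfloor>s / Delta\<rfloor>" using assms Delta_pos by simp
  have "s / Delta \<le> real N" using assms Delta_pos T_eq by (simp add: divide_le_eq)
  then show "\<lfloor>s / Delta\<rfloor> \<le> int N" by linarith
qed

text \<open>The index \<open>Suc N\<close> occurs because at \<open>s = T\<close> the interpolation
  also reads the following grid point, with weight \<open>0\<close>.\<close>

lemma X_hat_cong:
  assumes "\<And>i. i \<le> Suc N \<Longrightarrow> \<xi> (step_at 0 \<xi> (real i * Delta)) = \<xi>' (step_at 0 \<xi>' (real i * Delta))"
  shows "X_hat \<xi> = X_hat \<xi>'"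
proof -
  have "interpolation \<xi> s = interpolation \<xi>' s" if s: "0 \<le> s" "s \<le> T" for s
  proof -
    obtain i where i: "\<lfloor>s / Delta\<rfloor> = int i" "i \<le> N"
      using interpolation_range[OF s] zero_le_imp_eq_int by fastforce
    then show ?thesis
      using assms[of i] assms[of "Suc i"] unfolding interpolation_def Let_def i(1)
      by (simp add: add.commute)
  qed
  then have "interpolation \<xi> (max 0 (min T s)) = interpolation \<xi>' (max 0 (min T s))" for s
    using T_pos by simp
  then show ?thesis unfolding X_hat_def by presburger
qed

lemma X_hat_measurable:
  assumes chain: "controlled_chain t0 x M X \<alpha>"
  shows "(\<lambda>\<omega>. X_hat (\<lambda>n. X n \<omega>)) \<in> borel_measurable M"
proof (rule countably_valued_measurable)
  let ?G = "\<lambda>i \<omega>. X (step_at 0 (\<lambda>j. X j \<omega>) (real i * Delta)) \<omega>"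
  have "countably_valued M (\<lambda>\<omega>. map (\<lambda>i. ?G i \<omega>) [0..<Suc (Suc N)])"
    by (intro countably_valued_map visited_state_countable[OF chain])
  then show "countably_valued M (\<lambda>\<omega>. X_hat (\<lambda>n. X n \<omega>))"
  proof (rule countably_valued_factor)
    fix \<omega> \<omega>' assume *: "map (\<lambda>i. ?G i \<omega>) [0..<Suc (Suc N)] = map (\<lambda>i. ?G i \<omega>') [0..<Suc (Suc N)]"
    show "X_hat (\<lambda>n. X n \<omega>) = X_hat (\<lambda>n. X n \<omega>')"
    proof (rule X_hat_cong)
      fix i assume "i \<le> Suc N"
      then have "i \<in> set [0..<Suc (Suc N)]" by auto
      with * show "?G i \<omega> = ?G i \<omega>'" unfolding map_eq_conv by blast
    qed
  qed
qed simp

section \<open>The interpolated chain as a polygon\<close>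

definition polygon :: "int list \<Rightarrow> (real \<Rightarrow>\<^sub>C real)" where
  "polygon ks = Bcontfun (\<lambda>s. polygon_fun N (\<lambda>i. pos (ks ! i)) (max 0 (min T s) / Delta))"

lemma tm_N: "tm N = 0"
  by (simp add: tm_def)

lemma X_hat_walk:
  assumes ks: "walk m ks" "starts \<xi> (expand m ks)" and len: "length ks = Suc N"
  shows "X_hat \<xi> = polygon ks"
proof -
  have v: "\<xi> (step_at 0 \<xi> (real i * Delta)) = pos (ks ! i)" if "i \<le> N" for i
  proof -
    have gf: "grid_floor (real i * Delta) = tm N + real i * Delta"
      using grid_floor_eq[of 0 0 i "real i * Delta"] Delta_pos by (simp add: tm_N algebra_simps)
    show ?thesis
      using step_at_index[OF ks len order_refl that gf] state_index[OF ks len order_refl that]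
      by (simp add: tm_N)
  qed
  have "interpolation \<xi> s = polygon_fun N (\<lambda>i. pos (ks ! i)) (s / Delta)" if s: "0 \<le> s" "s \<le> T" for s
  proof -
    obtain i where i: "\<lfloor>s / Delta\<rfloor> = int i" "i \<le> N"
      using interpolation_range[OF s] zero_le_imp_eq_int by fastforce
    have fl: "real i \<le> s / Delta" "s / Delta \<le> real i + 1" using i(1) by linarith+
    have int: "interpolation \<xi> s = (1 - (s / Delta - real i)) * \<xi> (step_at 0 \<xi> (real i * Delta))
        + (s / Delta - real i) * \<xi> (step_at 0 \<xi> (real (Suc i) * Delta))"
      unfolding interpolation_def Let_def i(1) by (simp add: add.commute)
    show ?thesis
    proof (cases "i < N")
      case True
      then show ?thesis unfolding int using v[of i] v[of "Suc i"] polygon_fun_eq[OF fl True] by simp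
    next
      case False
      \<comment> \<open>At the horizon the following grid point has weight \<open>0\<close>; its
        state is not described by the walk.\<close>
      then have "i = N" using i by simp
      moreover have "s / Delta \<le> real N" using s Delta_pos T_eq by (simp add: divide_le_eq)
      ultimately have "s / Delta = real N" using fl by simp
      then show ?thesis unfolding int using v[of i] \<open>i = N\<close> by (simp add: polygon_fun_end)
    qed
  qed
  then have "interpolation \<xi> (max 0 (min T s)) = polygon_fun N (\<lambda>i. pos (ks ! i)) (max 0 (min T s) / Delta)" for s
    using T_pos by simp
  then show ?thesis unfolding X_hat_def polygon_def by presburger
qed

lemma polygon_convex:
  "\<exists>i j \<theta>. i \<le> N \<and> j \<le> N \<and> 0 \<le> \<theta> \<and> \<theta> \<le> 1 \<and>
     (\<forall>z. polygon_fun N z (max 0 (min T s) / Delta) = (1 - \<theta>) * z i + \<theta> * z j)"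
proof (rule polygon_fun_convex)
  show "0 \<le> max 0 (min T s) / Delta" using Delta_pos by simp
  show "max 0 (min T s) / Delta \<le> real N" using Delta_pos T_eq T_pos by (simp add: divide_le_eq)
qed

lemma polygon_values:
  assumes "set ks \<subseteq> {0..m}" "length ks = Suc N"
  shows "polygon_fun N (\<lambda>i. pos (ks ! i)) (max 0 (min T s) / Delta) \<in> {0..L}"
proof -
  obtain i j \<theta> where *: "i \<le> N" "j \<le> N" "0 \<le> \<theta>" "\<theta> \<le> 1"
    "polygon_fun N (\<lambda>i. pos (ks ! i)) (max 0 (min T s) / Delta) = (1 - \<theta>) * pos (ks ! i) + \<theta> * pos (ks ! j)"
    using polygon_convex[of s] by blast
  have "ks ! i \<in> {0..m}" "ks ! j \<in> {0..m}"
    by (rule subsetD[OF assms(1)], rule nth_mem, use assms(2) *(1,2) in simp)+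
  then have "pos (ks ! i) \<in> {0..L}" "pos (ks ! j) \<in> {0..L}" by (auto intro: pos_range simp del: atLeastAtMost_iff)
  then show ?thesis
    unfolding *(5) using *(3,4) convexD_alt[of "{0..L}" "pos (ks ! i)" "pos (ks ! j)" \<theta>] by (simp del: atLeastAtMost_iff)
qed

lemma polygon_apply:
  assumes "set ks \<subseteq> {0..m}" "length ks = Suc N"
  shows "apply_bcontfun (polygon ks) s = polygon_fun N (\<lambda>i. pos (ks ! i)) (max 0 (min T s) / Delta)"
  unfolding polygon_def
proof (subst Bcontfun_inverse)
  have "bounded (range (\<lambda>s. polygon_fun N (\<lambda>i. pos (ks ! i)) (max 0 (min T s) / Delta)))"
    by (rule bounded_subset[of "{0..L}"]) (use polygon_values[OF assms] in auto)
  moreover have "continuous_on UNIV (\<lambda>s. polygon_fun N (\<lambda>i. pos (ks ! i)) (max 0 (min T s) / Delta))"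
    unfolding polygon_fun_def using Delta_pos by (intro continuous_intros) auto
  ultimately show "(\<lambda>s. polygon_fun N (\<lambda>i. pos (ks ! i)) (max 0 (min T s) / Delta)) \<in> bcontfun"
    by (simp add: bcontfun_def)
qed simp

lemma polygon_paths:
  assumes "set ks \<subseteq> {0..m}" "length ks = Suc N"
  shows "polygon ks \<in> paths T L"
  unfolding paths_def using polygon_values[OF assms] T_pos by (auto simp: polygon_apply[OF assms])

lemma polygon_dist:
  assumes "set ks \<subseteq> {0..m}" "length ks = Suc N" "set ks' \<subseteq> {0..m}" "length ks' = Suc N"
    and "\<And>i. i \<le> N \<Longrightarrow> \<bar>pos (ks ! i) - pos (ks' ! i)\<bar> \<le> D"
  shows "dist (polygon ks) (polygon ks') \<le> D"
proof (rule dist_bound)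
  fix s
  obtain i j \<theta> where *: "i \<le> N" "j \<le> N" "0 \<le> \<theta>" "\<theta> \<le> 1"
    "\<And>z. polygon_fun N z (max 0 (min T s) / Delta) = (1 - \<theta>) * z i + \<theta> * z j"
    using polygon_convex[of s] by blast
  have "\<bar>(1 - \<theta>) * (pos (ks ! i) - pos (ks' ! i)) + \<theta> * (pos (ks ! j) - pos (ks' ! j))\<bar> \<le> (1 - \<theta>) * D + \<theta> * D"
    using assms(5)[OF *(1)] assms(5)[OF *(2)] *(3,4)
    by (intro order_trans[OF abs_triangle_ineq] add_mono) (auto simp: abs_mult intro!: mult_left_mono)
  then show "dist (apply_bcontfun (polygon ks) s) (apply_bcontfun (polygon ks') s) \<le> D"
    by (simp add: polygon_apply assms * dist_real_def algebra_simps)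
qed

end

subsection \<open>Existence of the chain with feedback control\<close>

context mfg_setup
begin

context
  fixes fb :: "real \<Rightarrow> real \<Rightarrow> real" and n0 :: nat and k0 :: int
  assumes fb: "\<And>\<tau> x. fb \<tau> x \<in> U" and n0: "n0 \<le> N" and k0: "k0 \<in> {0..m}"
begin

definition running :: "(nat \<Rightarrow> real) \<Rightarrow> nat \<Rightarrow> bool" where
  "running \<xi> n \<longleftrightarrow> clock (tm n0) \<xi> n < T \<or> (clock (tm n0) \<xi> n = T \<and> \<xi> n \<in> {-h, L + h})"

definition fb_prob :: "(nat \<Rightarrow> real) \<Rightarrow> nat \<Rightarrow> real" where
  "fb_prob \<xi> n = (let \<tau> = clock (tm n0) \<xi> n in (h * b \<tau> (marg \<tau>) (\<xi> n) (fb \<tau> (\<xi> n)) + \<sigma>\<^sup>2) / (2 * \<sigma>\<^sup>2))"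

text \<open>
  Keeping the stopped chain constant makes every trajectory eventually constant, so that a finitely
  supported law of trajectories suffices.
\<close>

definition next_state :: "(nat \<Rightarrow> real) \<Rightarrow> nat \<Rightarrow> real pmf" where
  "next_state \<xi> n = (if \<not> running \<xi> n then return_pmf (\<xi> n)
     else if \<xi> n \<in> S0 then map_pmf (\<lambda>up. if up then \<xi> n + h else \<xi> n - h) (bernoulli_pmf (fb_prob \<xi> n))
     else return_pmf (if \<xi> n = - h then 0 else L))"

text \<open>\<open>traj n\<close> is a law on whole sequences whose coordinates after
  \<open>n\<close> repeat the state at \<open>n\<close>. All these laws live on one space, where
  they can be compared and become stationary in \<open>n\<close>.\<close>

primrec traj :: "nat \<Rightarrow> (nat \<Rightarrow> real) pmf" where
  "traj 0 = return_pmf (\<lambda>_. pos k0)"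
| "traj (Suc n) = bind_pmf (traj n) (\<lambda>\<xi>. map_pmf (\<lambda>z i. if i \<le> n then \<xi> i else z) (next_state \<xi> n))"

lemma clock_prefix: "(\<And>i. i < n \<Longrightarrow> \<xi> i = \<xi>' i) \<Longrightarrow> clock t0 \<xi> n = clock t0 \<xi>' n"
  by (induction n) simp_all

lemma next_state_prefix:
  assumes "\<And>i. i \<le> n \<Longrightarrow> \<xi> i = \<xi>' i"
  shows "next_state \<xi> n = next_state \<xi>' n" "running \<xi> n \<longleftrightarrow> running \<xi>' n"
proof -
  have "clock (tm n0) \<xi> n = clock (tm n0) \<xi>' n" "\<xi> n = \<xi>' n" using assms by (auto intro: clock_prefix)
  then show "next_state \<xi> n = next_state \<xi>' n" "running \<xi> n \<longleftrightarrow> running \<xi>' n"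
    by (simp_all only: next_state_def running_def fb_prob_def)
qed

lemma clock_grid: "\<exists>j. clock (tm n0) \<xi> n = tm n0 + real j * Delta"
proof (induction n)
  case 0
  show ?case by (intro exI[of _ 0]) simp
next
  case (Suc n)
  then obtain j where "clock (tm n0) \<xi> n = tm n0 + real j * Delta" by blast
  then show ?case by (cases "\<xi> n \<in> {-h, L + h}") (auto intro: exI[of _ j] exI[of _ "Suc j"] simp: algebra_simps)
qed

lemma S_cases:
  assumes "x \<in> S"
  obtains k where "x = pos k" "k \<in> {0..m}" | "x = pos (-1)" | "x = pos (m + 1)"
proof -
  obtain k where k: "x = pos k" "k \<in> {-1..m + 1}" using assms unfolding S_eq by blast
  then have "k \<in> {0..m} \<or> k = -1 \<or> k = m + 1" by auto
  then show ?thesis using k that by blast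
qed

lemma S0_not_reflection: "x \<in> S0 \<Longrightarrow> x \<notin> {-h, L + h}"
  unfolding S0_eq using pos_in_reflection by force

lemma next_state_kernel:
  assumes run: "running \<xi> n" and \<xi>: "\<xi> n \<in> S"
  shows "pmf (next_state \<xi> n) z
    = kernel (clock (tm n0) \<xi> n) (marg (clock (tm n0) \<xi> n)) (fb (clock (tm n0) \<xi> n) (\<xi> n)) (\<xi> n) z"
proof -
  let ?\<tau> = "clock (tm n0) \<xi> n"
  let ?u = "fb ?\<tau> (\<xi> n)" and ?p = "fb_prob \<xi> n"
  show ?thesis
    using \<xi>
  proof (cases rule: S_cases)
    case (1 k)
    have "?\<tau> \<in> {0..T0}"
    proof -
      have "0 \<le> ?\<tau>" using clock_mono[of 0 n "tm n0" \<xi>] tm_range(1)[of n0] by simp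
      moreover have "?\<tau> \<le> T" using run by (auto simp: running_def)
      ultimately show ?thesis using T_le by simp
    qed
    then have "\<bar>b ?\<tau> (marg ?\<tau>) (pos k) ?u\<bar> \<le> c_B"
      by (rule b_bound[OF _ marg_prob pos_range[OF 1(2)] fb])
    then have "\<bar>h * b ?\<tau> (marg ?\<tau>) (pos k) ?u\<bar> \<le> \<sigma>\<^sup>2"
    proof -
      assume "\<bar>b ?\<tau> (marg ?\<tau>) (pos k) ?u\<bar> \<le> c_B"
      then have "h * \<bar>b ?\<tau> (marg ?\<tau>) (pos k) ?u\<bar> \<le> h * c_B" using h_pos by (intro mult_left_mono) auto
      then show ?thesis using h_B unfolding abs_mult abs_of_pos[OF h_pos] by linarith
    qed
    then have p: "0 \<le> ?p" "?p \<le> 1"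
      using \<sigma>_pos unfolding fb_prob_def Let_def 1(1) by (auto simp: divide_simps abs_le_iff)
    have ne: "pos k + h \<noteq> pos k - h" using h_pos by simp
    have "pmf (next_state \<xi> n) z = (if z = pos k + h then ?p else if z = pos k - h then 1 - ?p else 0)"
    proof -
      have "next_state \<xi> n = map_pmf (\<lambda>up. if up then pos k + h else pos k - h) (bernoulli_pmf ?p)"
        using run 1(2) unfolding next_state_def 1(1) by (simp only: pos_in_S0 not_True_eq_False if_False if_True)
      moreover have "pmf (map_pmf (\<lambda>up. if up then pos k + h else pos k - h) (bernoulli_pmf ?p)) z
        = (if z = pos k + h then ?p else if z = pos k - h then 1 - ?p else 0)"
      proof -
        have "(\<lambda>up. if up then pos k + h else pos k - h) -` {z}
          = (if z = pos k + h then {True} else if z = pos k - h then {False} else {})"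
          using ne by (auto split: if_splits)
        then show ?thesis using p by (simp add: pmf_map measure_pmf_single)
      qed
      ultimately show ?thesis by simp
    qed
    moreover have "1 - ?p = (- h * b ?\<tau> (marg ?\<tau>) (pos k) ?u + \<sigma>\<^sup>2) / (2 * \<sigma>\<^sup>2)"
      using \<sigma>_pos unfolding fb_prob_def Let_def 1(1) by (simp add: field_simps)
    ultimately show ?thesis
      using 1(2) unfolding 1(1) kernel_def pos_in_S0 by (simp add: fb_prob_def Let_def 1(1))
  next
    case 2
    have "pos (-1) \<noteq> L + h" unfolding reflection_states pos_eq_iff using m_pos by simp
    moreover have "pos (-1) \<notin> S0" unfolding pos_in_S0 by simp
    ultimately show ?thesis
      using run unfolding next_state_def kernel_def 2 by simp
  next
    case 3
    have "pos (m + 1) \<notin> S0" "pos (m + 1) \<noteq> - h"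
      unfolding pos_in_S0 reflection_states pos_eq_iff using m_pos by simp_all
    moreover have "pos (m + 1) = L + h" by (simp only: reflection_states)
    ultimately show ?thesis
      using run unfolding next_state_def kernel_def 3 by simp
  qed
qed

lemma next_state_in_S:
  assumes "\<xi> n \<in> S" "z \<in> set_pmf (next_state \<xi> n)"
  shows "z \<in> S" and "running \<xi> n \<Longrightarrow> \<xi> n \<notin> S0 \<Longrightarrow> z \<in> S0"
proof -
  have ends: "pos 0 \<in> S0" "pos m \<in> S0" unfolding pos_in_S0 using m_pos by simp_all
  show "running \<xi> n \<Longrightarrow> \<xi> n \<notin> S0 \<Longrightarrow> z \<in> S0"
    using assms(2) ends L_eq by (auto simp: next_state_def split: if_splits)
  have inS: "S0 \<subseteq> S" by (auto simp: S_def)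
  show "z \<in> S"
  proof (cases "running \<xi> n \<and> \<xi> n \<in> S0")
    case True
    then obtain k where k: "\<xi> n = pos k" "k \<in> {0..m}" unfolding S0_eq by blast
    have "z = pos (k + 1) \<or> z = pos (k - 1)"
      using assms(2) True k(1) by (auto simp: next_state_def algebra_simps split: if_splits)
    moreover have "pos (k + 1) \<in> S" "pos (k - 1) \<in> S" unfolding S_eq using k(2) by (intro imageI; simp)+
    ultimately show ?thesis by metis
  next
    case False
    then show ?thesis
      using assms ends L_eq inS by (auto simp: next_state_def split: if_splits)
  qed
qed

text \<open>The last claim bounds the running time. A reflection step is always preceded by a step
  that advances the clock, so the clock moves in at least half of the steps; the extra
  \<open>Delta\<close> at a reflection state pays in advance for the reflection. Consequently no
  trajectory is running after more than \<open>2 * n0\<close> steps.\<close>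

lemma traj_support:
  assumes "\<xi> \<in> set_pmf (traj n)"
  shows "\<xi> 0 = pos k0" "\<xi> i \<in> S" "i \<ge> n \<Longrightarrow> \<xi> i = \<xi> n"
    and "running \<xi> n \<Longrightarrow> real n * Delta + (if \<xi> n \<in> S0 then 0 else Delta) \<le> 2 * (clock (tm n0) \<xi> n - tm n0)"
proof -
  have "\<xi> 0 = pos k0 \<and> (\<forall>i. \<xi> i \<in> S) \<and> (\<forall>i\<ge>n. \<xi> i = \<xi> n) \<and>
    (running \<xi> n \<longrightarrow> real n * Delta + (if \<xi> n \<in> S0 then 0 else Delta) \<le> 2 * (clock (tm n0) \<xi> n - tm n0))"
    using assms
  proof (induction n arbitrary: \<xi>)
    case 0
    then show ?case using k0 pos_in_S0[of k0] by (auto simp: S_def)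
  next
    case (Suc n)
    from Suc.prems obtain \<xi>' z where \<xi>': "\<xi>' \<in> set_pmf (traj n)" and z: "z \<in> set_pmf (next_state \<xi>' n)"
      and \<xi>: "\<xi> = (\<lambda>i. if i \<le> n then \<xi>' i else z)" by auto
    note IH = Suc.IH[OF \<xi>']
    have S: "\<xi>' n \<in> S" "z \<in> S" using IH next_state_in_S(1)[OF _ z] by blast+
    have pre: "running \<xi> n \<longleftrightarrow> running \<xi>' n" by (rule next_state_prefix) (simp add: \<xi>)
    have cl: "clock (tm n0) \<xi> n = clock (tm n0) \<xi>' n" by (rule clock_prefix) (simp add: \<xi>)
    have zz: "\<xi> (Suc n) = z" "\<xi> n = \<xi>' n" by (simp_all add: \<xi>)
    have "real (Suc n) * Delta + (if \<xi> (Suc n) \<in> S0 then 0 else Delta) \<le> 2 * (clock (tm n0) \<xi> (Suc n) - tm n0)"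
      if run: "running \<xi> (Suc n)"
    proof -
      have "running \<xi>' n"
      proof (rule ccontr)
        assume not: "\<not> running \<xi>' n"
        then have "z = \<xi>' n" using z by (simp add: next_state_def)
        then show False
          using not run Delta_pos unfolding running_def clock.simps cl zz
          by (auto split: if_splits)
      qed
      then have bound: "real n * Delta + (if \<xi>' n \<in> S0 then 0 else Delta) \<le> 2 * (clock (tm n0) \<xi>' n - tm n0)"
        using IH by blast
      show ?thesis
      proof (cases "\<xi>' n \<in> S0")
        case True
        then have "clock (tm n0) \<xi> (Suc n) = clock (tm n0) \<xi>' n + Delta"
          using S0_not_reflection[OF True] zz cl by simp
        then show ?thesis using bound True Delta_pos by (auto simp: algebra_simps)
      next
        case False
        then have "\<xi>' n \<in> {-h, L + h}" using S by (auto simp: S_def)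
        then have "clock (tm n0) \<xi> (Suc n) = clock (tm n0) \<xi>' n" using zz cl by simp
        moreover have "z \<in> S0" using next_state_in_S(2)[OF S(1) z \<open>running \<xi>' n\<close> False] .
        ultimately show ?thesis using bound False zz by (simp add: algebra_simps)
      qed
    qed
    moreover have "\<xi> 0 = pos k0"
    proof -
      have "\<xi>' 0 = pos k0" using IH by blast
      then show ?thesis by (simp add: \<xi>)
    qed
    moreover have "\<forall>i. \<xi> i \<in> S"
    proof -
      have "\<xi>' i \<in> S" for i using IH by blast
      then show ?thesis using S(2) by (simp add: \<xi>)
    qed
    moreover have "\<forall>i\<ge>Suc n. \<xi> i = \<xi> (Suc n)" by (simp add: \<xi>)
    ultimately show ?case by blast
  qed
  then show "\<xi> 0 = pos k0" "\<xi> i \<in> S" "i \<ge> n \<Longrightarrow> \<xi> i = \<xi> n"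
    "running \<xi> n \<Longrightarrow> real n * Delta + (if \<xi> n \<in> S0 then 0 else Delta) \<le> 2 * (clock (tm n0) \<xi> n - tm n0)"
    by blast+
qed

lemma traj_stopped:
  assumes "\<xi> \<in> set_pmf (traj n)" "2 * n0 < n"
  shows "\<not> running \<xi> n"
proof
  assume run: "running \<xi> n"
  have "clock (tm n0) \<xi> n \<le> T" using run by (auto simp: running_def)
  moreover have "T - tm n0 = real n0 * Delta" using tm_shift[of n0 n0] n0 tm_0 by simp
  moreover have "real n * Delta \<le> 2 * (clock (tm n0) \<xi> n - tm n0)"
    using traj_support(4)[OF assms(1) run] Delta_pos by (auto split: if_splits)
  ultimately have "real n * Delta \<le> real (2 * n0) * Delta" by simp
  then have "real n \<le> real (2 * n0)" using Delta_pos mult_le_cancel_right_pos by blast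
  then show False using assms(2) by linarith
qed

lemma traj_stable: "Suc (2 * n0) \<le> n \<Longrightarrow> traj n = traj (Suc (2 * n0))"
proof (induction n rule: dec_induct)
  case (step n)
  have "map_pmf (\<lambda>z i. if i \<le> n then \<xi> i else z) (next_state \<xi> n) = return_pmf \<xi>" if "\<xi> \<in> set_pmf (traj n)" for \<xi>
  proof -
    have "next_state \<xi> n = return_pmf (\<xi> n)" using traj_stopped[OF that] step by (simp add: next_state_def)
    moreover have "(\<lambda>i. if i \<le> n then \<xi> i else \<xi> n) = \<xi>"
    proof (rule ext)
      fix i
      show "(if i \<le> n then \<xi> i else \<xi> n) = \<xi> i"
        using traj_support(3)[OF that, of i] by (cases "i \<le> n") simp_all
    qed
    ultimately show ?thesis by (simp only: map_return_pmf)
  qed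
  then have "traj (Suc n) = bind_pmf (traj n) return_pmf" unfolding traj.simps by (intro bind_pmf_cong) auto
  then show ?case using step by (simp add: bind_return_pmf')
qed simp

lemma traj_prefix_integral:
  fixes \<Psi> :: "(nat \<Rightarrow> real) \<Rightarrow> ennreal"
  assumes "n \<le> l" and \<Psi>: "\<And>\<xi> \<xi>'. (\<And>i. i \<le> n \<Longrightarrow> \<xi> i = \<xi>' i) \<Longrightarrow> \<Psi> \<xi> = \<Psi> \<xi>'"
  shows "(\<integral>\<^sup>+ \<xi>. \<Psi> \<xi> \<partial>traj l) = (\<integral>\<^sup>+ \<xi>. \<Psi> \<xi> \<partial>traj n)"
  using assms(1)
proof (induction l rule: dec_induct)
  case (step l)
  have "\<Psi> (\<lambda>i. if i \<le> l then \<xi> i else z) = \<Psi> \<xi>" for \<xi> z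
    using step by (intro \<Psi>) auto
  then show ?case using step.IH by (simp add: nn_integral_map_pmf measure_pmf.emeasure_space_1)
qed simp

text \<open>The Markov property in integrated form, where \<open>\<kappa>\<close> plays the part of
  an event of the history. Any later law \<open>traj l\<close> may be used, since functionals of a
  prefix do not see the transitions after it.\<close>

lemma traj_step_integral:
  fixes \<kappa> :: "(nat \<Rightarrow> real) \<Rightarrow> ennreal"
  assumes \<kappa>: "\<And>\<xi> \<xi>'. (\<And>i. i \<le> n \<Longrightarrow> \<xi> i = \<xi>' i) \<Longrightarrow> \<kappa> \<xi> = \<kappa> \<xi>'" and l: "Suc n \<le> l"
  shows "(\<integral>\<^sup>+ \<xi>. \<kappa> \<xi> * indicator {z} (\<xi> (Suc n)) \<partial>traj l) = (\<integral>\<^sup>+ \<xi>. \<kappa> \<xi> * ennreal (pmf (next_state \<xi> n) z) \<partial>traj l)"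
proof -
  have "(\<integral>\<^sup>+ \<xi>. \<kappa> \<xi> * indicator {z} (\<xi> (Suc n)) \<partial>traj l) = (\<integral>\<^sup>+ \<xi>. \<kappa> \<xi> * indicator {z} (\<xi> (Suc n)) \<partial>traj (Suc n))"
  proof (rule traj_prefix_integral[OF l])
    fix \<xi> \<xi>' :: "nat \<Rightarrow> real" assume eq: "\<And>i. i \<le> Suc n \<Longrightarrow> \<xi> i = \<xi>' i"
    have "\<kappa> \<xi> = \<kappa> \<xi>'" by (rule \<kappa>) (rule eq, simp)
    then show "\<kappa> \<xi> * indicator {z} (\<xi> (Suc n)) = \<kappa> \<xi>' * indicator {z} (\<xi>' (Suc n))"
      using eq[of "Suc n"] by simp
  qed
  also have "\<dots> = (\<integral>\<^sup>+ \<xi>. (\<integral>\<^sup>+ z'. \<kappa> \<xi> * indicator {z} z' \<partial>next_state \<xi> n) \<partial>traj n)"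
  proof -
    have "\<kappa> (\<lambda>i. if i \<le> n then \<xi> i else z') = \<kappa> \<xi>" for \<xi> z' by (rule \<kappa>) simp
    then show ?thesis by (simp add: nn_integral_map_pmf)
  qed
  also have "\<dots> = (\<integral>\<^sup>+ \<xi>. \<kappa> \<xi> * ennreal (pmf (next_state \<xi> n) z) \<partial>traj n)"
    by (simp add: nn_integral_cmult emeasure_pmf_single)
  also have "\<dots> = (\<integral>\<^sup>+ \<xi>. \<kappa> \<xi> * ennreal (pmf (next_state \<xi> n) z) \<partial>traj l)"
  proof (rule traj_prefix_integral[symmetric])
    fix \<xi> \<xi>' :: "nat \<Rightarrow> real" assume "\<And>i. i \<le> n \<Longrightarrow> \<xi> i = \<xi>' i"
    then have "\<kappa> \<xi> = \<kappa> \<xi>'" "next_state \<xi> n = next_state \<xi>' n" by (auto intro: \<kappa> next_state_prefix)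
    then show "\<kappa> \<xi> * ennreal (pmf (next_state \<xi> n) z) = \<kappa> \<xi>' * ennreal (pmf (next_state \<xi>' n) z)" by simp
  qed (use l in simp)
  finally show ?thesis .
qed

lemma controlled_chain_exists:
  "\<exists>(M :: (nat \<Rightarrow> real) measure) X \<alpha>. controlled_chain (tm n0) (pos k0) M X \<alpha> \<and>
     (\<forall>n \<omega>. \<alpha> n \<omega> = fb (clock (tm n0) (\<lambda>j. X j \<omega>) n) (X n \<omega>))"
proof -
  define Q where "Q = traj (Suc (2 * n0))"
  \<comment> \<open>State space and initial value are demanded at every point of the sample space,
    not almost surely; points outside the support are therefore read as some fixed trajectory in
    it.\<close>
  define clean where "clean \<omega> = (if \<omega> \<in> set_pmf Q then \<omega> else (SOME \<omega>. \<omega> \<in> set_pmf Q))" for \<omega>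
  have clean: "clean \<omega> \<in> set_pmf Q" for \<omega>
    unfolding clean_def using set_pmf_not_empty[of Q] some_in_eq[of "set_pmf Q"] by auto
  have clean_id: "\<omega> \<in> set_pmf Q \<Longrightarrow> clean \<omega> = \<omega>" for \<omega> by (simp add: clean_def)
  define M where "M = measure_pmf Q"
  define X where "X n \<omega> = clean \<omega> n" for n \<omega>
  define \<alpha> where "\<alpha> n \<omega> = fb (clock (tm n0) (\<lambda>j. X j \<omega>) n) (X n \<omega>)" for n \<omega>
  have Xc: "(\<lambda>j. X j \<omega>) = clean \<omega>" for \<omega> by (simp add: X_def)
  have support: "\<xi> 0 = pos k0" "\<xi> i \<in> S" if "\<xi> \<in> set_pmf Q" for \<xi> i
    using traj_support(1,2)[OF that[unfolded Q_def]] by blast+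
  have XS: "X n \<omega> \<in> S" for n \<omega> unfolding X_def by (rule support[OF clean])
  have sp: "space M = UNIV" by (simp add: M_def)
  have X_meas: "X n \<in> borel_measurable M" for n by (simp add: M_def)
  have history_factor: "F \<in> borel_measurable (history M X \<alpha> n)"
    if F: "\<And>\<omega> \<omega>'. (\<And>i. i \<le> n \<Longrightarrow> X i \<omega> = X i \<omega>') \<Longrightarrow> F \<omega> = F \<omega>'" for F :: "(nat \<Rightarrow> real) \<Rightarrow> real" and n
  proof (rule countably_valued_measurable)
    have "countably_valued (history M X \<alpha> n) (X i)" if "i < Suc n" for i
      using that XS by (intro countably_valued_borel[OF state_history_measurable, of _ _ S]) (auto simp: S_eq)
    then have "countably_valued (history M X \<alpha> n) (\<lambda>\<omega>. map (\<lambda>i. X i \<omega>) [0..<Suc n])"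
      by (rule countably_valued_map)
    then show "countably_valued (history M X \<alpha> n) F"
    proof (rule countably_valued_factor)
      fix \<omega> \<omega>' assume eq: "map (\<lambda>i. X i \<omega>) [0..<Suc n] = map (\<lambda>i. X i \<omega>') [0..<Suc n]"
      have "X i \<omega> = X i \<omega>'" if "i \<le> n" for i
      proof -
        have "i \<in> set [0..<Suc n]" using that by auto
        with eq show ?thesis unfolding map_eq_conv by blast
      qed
      then show "F \<omega> = F \<omega>'" by (rule F)
    qed
  qed simp
  have \<alpha>_prefix: "\<alpha> n \<omega> = \<alpha> n \<omega>'" if "\<And>i. i \<le> n \<Longrightarrow> X i \<omega> = X i \<omega>'" for n \<omega> \<omega>'
  proof -
    have "clock (tm n0) (\<lambda>j. X j \<omega>) n = clock (tm n0) (\<lambda>j. X j \<omega>') n" using that by (intro clock_prefix) auto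
    then show ?thesis using that[of n] by (simp add: \<alpha>_def)
  qed
  have \<alpha>_meas: "\<alpha> n \<in> borel_measurable (history M X \<alpha> n)" for n
    using \<alpha>_prefix by (rule history_factor)
  have cond: "AE \<omega> in M. real_cond_exp M (history M X \<alpha> n) (indicator {\<omega>' \<in> space M. X (Suc n) \<omega>' = z}) \<omega>
      = pmf (next_state (clean \<omega>) n) z" for n z
  proof -
    let ?F = "history M X \<alpha> n"
    define E where "E = {\<omega>' \<in> space M. X (Suc n) \<omega>' = z}"
    define gg where "gg \<omega> = pmf (next_state (clean \<omega>) n) z" for \<omega>
    have fin: "finite_measure M" unfolding M_def by (rule measure_pmf.finite_measure)
    interpret F: finite_measure_subalgebra M ?F
      by (intro finite_measure_subalgebra.intro finite_measure_subalgebra_axioms.intro fin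
          history_subalgebra X_meas \<alpha>_meas)
    have g_bound: "0 \<le> gg \<omega>" "gg \<omega> \<le> 1" for \<omega> by (simp_all add: gg_def pmf_le_1)
    have "AE \<omega> in M. real_cond_exp M ?F (indicator E) \<omega> = gg \<omega>"
    proof (rule F.real_cond_exp_charact)
      show "gg \<in> borel_measurable ?F"
      proof (rule history_factor)
        fix \<omega> \<omega>' assume "\<And>i. i \<le> n \<Longrightarrow> X i \<omega> = X i \<omega>'"
        then have "next_state (clean \<omega>) n = next_state (clean \<omega>') n"
          by (intro next_state_prefix) (simp add: X_def)
        then show "gg \<omega> = gg \<omega>'" by (simp add: gg_def)
      qed
      show "integrable M (indicator E :: _ \<Rightarrow> real)"
        unfolding M_def by (rule measure_pmf.integrable_const_bound[where B = 1]) auto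
      show "integrable M gg"
        unfolding M_def by (rule measure_pmf.integrable_const_bound[where B = 1]) (use g_bound in auto)
      fix A assume A: "A \<in> sets ?F"
      \<comment> \<open>The indicator of \<open>A\<close>, rewritten on the support as a function of
        the coordinates up to \<open>n\<close>; this is possible because sets of the history cannot
        separate trajectories with the same prefix.\<close>
      define \<kappa> :: "(nat \<Rightarrow> real) \<Rightarrow> ennreal" where
        "\<kappa> \<xi> = (if \<exists>\<omega>\<in>A \<inter> set_pmf Q. \<forall>i\<le>n. \<omega> i = \<xi> i then 1 else 0)" for \<xi>
      have inv: "\<omega> \<in> A \<longleftrightarrow> \<omega>' \<in> A" if "\<omega> \<in> set_pmf Q" "\<omega>' \<in> set_pmf Q" "\<forall>i\<le>n. \<omega> i = \<omega>' i" for \<omega> \<omega>'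
      proof (rule history_set_invariant[OF A])
        have X: "X i \<omega> = X i \<omega>'" if "i \<le> n" for i
          using that \<open>\<forall>i\<le>n. \<omega> i = \<omega>' i\<close> by (simp add: X_def clean_id \<open>\<omega> \<in> set_pmf Q\<close> \<open>\<omega>' \<in> set_pmf Q\<close>)
        then show "i \<le> n \<Longrightarrow> X i \<omega> = X i \<omega>'" for i .
        show "i < n \<Longrightarrow> \<alpha> i \<omega> = \<alpha> i \<omega>'" for i using X by (intro \<alpha>_prefix) auto
      qed (simp_all add: sp)
      have \<kappa>A: "\<kappa> \<omega> = indicator A \<omega>" if \<omega>: "\<omega> \<in> set_pmf Q" for \<omega>
      proof (cases "\<omega> \<in> A")
        case True
        then have "\<exists>\<omega>'\<in>A \<inter> set_pmf Q. \<forall>i\<le>n. \<omega>' i = \<omega> i" using \<omega> by blast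
        then show ?thesis using True by (simp add: \<kappa>_def)
      next
        case False
        then have "\<not> (\<exists>\<omega>'\<in>A \<inter> set_pmf Q. \<forall>i\<le>n. \<omega>' i = \<omega> i)" using inv \<omega> by blast
        then show ?thesis using False by (simp add: \<kappa>_def)
      qed
      have \<kappa>_prefix: "\<kappa> \<xi> = \<kappa> \<xi>'" if "\<And>i. i \<le> n \<Longrightarrow> \<xi> i = \<xi>' i" for \<xi> \<xi>'
        using that unfolding \<kappa>_def by simp
      \<comment> \<open>Late enough for the law to be stationary and for the transition at
        \<open>n\<close> to have been made.\<close>
      define l where "l = max (Suc n) (Suc (2 * n0))"
      have Q_l: "Q = traj l" unfolding Q_def by (rule traj_stable[symmetric]) (simp add: l_def)
      have "(\<integral>\<^sup>+ \<omega>. ennreal (indicator A \<omega> *\<^sub>R indicator E \<omega>) \<partial>Q) = (\<integral>\<^sup>+ \<omega>. \<kappa> \<omega> * indicator {z} (\<omega> (Suc n)) \<partial>Q)"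
      proof (rule nn_integral_cong_AE, rule AE_pmfI)
        fix \<omega> assume \<omega>: "\<omega> \<in> set_pmf Q"
        have "\<omega> \<in> E \<longleftrightarrow> \<omega> (Suc n) = z" using \<omega> by (simp add: E_def sp X_def clean_id)
        then show "ennreal (indicator A \<omega> *\<^sub>R indicator E \<omega>) = \<kappa> \<omega> * indicator {z} (\<omega> (Suc n))"
          unfolding \<kappa>A[OF \<omega>] by (simp add: indicator_def)
      qed
      also have "\<dots> = (\<integral>\<^sup>+ \<omega>. \<kappa> \<omega> * ennreal (pmf (next_state \<omega> n) z) \<partial>Q)"
        unfolding Q_l by (rule traj_step_integral) (auto intro: \<kappa>_prefix simp: l_def)
      also have "\<dots> = (\<integral>\<^sup>+ \<omega>. ennreal (indicator A \<omega> *\<^sub>R gg \<omega>) \<partial>Q)"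
      proof (rule nn_integral_cong_AE, rule AE_pmfI)
        fix \<omega> assume \<omega>: "\<omega> \<in> set_pmf Q"
        show "\<kappa> \<omega> * ennreal (pmf (next_state \<omega> n) z) = ennreal (indicator A \<omega> *\<^sub>R gg \<omega>)"
          unfolding \<kappa>A[OF \<omega>] gg_def clean_id[OF \<omega>] by (simp add: indicator_def)
      qed
      finally have "enn2real (\<integral>\<^sup>+ \<omega>. ennreal (indicator A \<omega> *\<^sub>R indicator E \<omega>) \<partial>M)
         = enn2real (\<integral>\<^sup>+ \<omega>. ennreal (indicator A \<omega> *\<^sub>R gg \<omega>) \<partial>M)"
        by (simp add: M_def)
      then show "(\<integral>\<omega>\<in>A. indicator E \<omega> \<partial>M) = (\<integral>\<omega>\<in>A. gg \<omega> \<partial>M)"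
        unfolding set_lebesgue_integral_def
        by (subst (1 2) integral_eq_nn_integral) (auto simp: M_def g_bound indicator_def)
    qed
    then show ?thesis unfolding E_def gg_def .
  qed
  have "controlled_chain (tm n0) (pos k0) M X \<alpha>"
    unfolding controlled_chain_def
  proof (intro conjI allI ballI)
    show "prob_space M" unfolding M_def by (rule measure_pmf.prob_space_axioms)
    show "X n \<in> borel_measurable M" "X n \<omega> \<in> S" for n \<omega> by (rule X_meas, rule XS)
    show "X 0 \<omega> = pos k0" for \<omega> unfolding X_def by (rule support[OF clean])
    show "\<alpha> n \<in> borel_measurable (history M X \<alpha> n)" "\<alpha> n \<omega> \<in> U" for n \<omega>
      by (rule \<alpha>_meas) (simp add: \<alpha>_def fb)
    fix n z
    show "AE \<omega> in M. let \<tau> = clock (tm n0) (\<lambda>j. X j \<omega>) n in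
           \<tau> < T \<or> \<tau> = T \<and> X n \<omega> \<in> {-h, L + h} \<longrightarrow>
           real_cond_exp M (history M X \<alpha> n) (indicator {\<omega>' \<in> space M. X (Suc n) \<omega>' = z}) \<omega>
             = kernel \<tau> (marg \<tau>) (\<alpha> n \<omega>) (X n \<omega>) z"
      using cond[of n z]
    proof eventually_elim
      case (elim \<omega>)
      have "clean \<omega> n \<in> S" by (rule support[OF clean])
      then show ?case
        unfolding Let_def elim \<alpha>_def Xc using next_state_kernel[of "clean \<omega>" n z]
        by (simp add: running_def X_def)
    qed
  qed
  then show ?thesis using \<alpha>_def by blast
qed

end

end

subsection \<open>The value function\<close>

context mfg_setup
begin

text \<open>Built from the recursion \<open>val\<close>, not from \<open>V\<close>, so that a chain
  attaining the minimum is available before \<open>V\<close> is known. Clamping makes it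
  \<open>U\<close>-valued for all arguments, as the construction of the chain requires.\<close>

definition feedback :: "real \<Rightarrow> real \<Rightarrow> real" where
  "feedback \<tau> x = (let n = nat \<lfloor>(T - \<tau>) / Delta\<rfloor> - 1; k = clamp m \<lfloor>x / h\<rfloor> in ad n k (G.val_slope n k))"

lemma feedback_in: "feedback \<tau> x \<in> U"
proof -
  have "clamp m \<lfloor>x / h\<rfloor> \<in> {0..m}" by (rule clamp_range) (use m_pos in simp)
  then show ?thesis unfolding feedback_def Let_def by (rule G.a_in)
qed

lemma feedback_eq:
  assumes "Suc n \<le> N" "k \<in> {0..m}"
  shows "feedback (tm (Suc n)) (pos k) = ad n k (G.val_slope n k)"
proof -
  have "T = tm (Suc n) + real (Suc n) * Delta"
    using tm_shift[of "Suc n" "Suc n"] assms tm_0 by simp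
  then have 1: "(T - tm (Suc n)) / Delta = real (Suc n)" using Delta_pos by (simp add: divide_eq_eq)
  have 2: "pos k / h = of_int k" using h_pos by simp
  show ?thesis unfolding feedback_def Let_def 1 2 floor_of_nat floor_of_int nat_int clamp_id[OF assms(2)] by simp
qed

lemma node_state:
  assumes "walk m ks" "length ks + n = n0" "n0 \<le> N" and \<xi>: "starts \<xi> (expand m ks)"
  shows "clock (tm n0) \<xi> (length (expand m ks) - 1) = tm (Suc n)" "\<xi> (length (expand m ks) - 1) = pos (last ks)"
    "Suc n \<le> N"
proof -
  have ne: "ks \<noteq> []" "expand m ks \<noteq> []" using walk_nonempty[OF assms(1)] by (auto simp: expand_nonempty)
  then have len: "0 < length ks" by simp
  then have n: "Suc n = n0 - (length ks - 1)" using assms(2) by linarith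
  show "clock (tm n0) \<xi> (length (expand m ks) - 1) = tm (Suc n)"
    unfolding clock_expand[OF assms(1) \<xi>] n using assms(2,3) by (intro tm_shift[symmetric]) auto
  show "\<xi> (length (expand m ks) - 1) = pos (last ks)"
    using starts_last[OF \<xi> ne(2)] by (simp add: last_expand)
  show "Suc n \<le> N" using n len assms by linarith
qed

lemma J_tree:
  fixes M :: "'w measure"
  assumes chain: "controlled_chain (tm n0) (pos k0) M X \<alpha>" and n0: "n0 \<le> N" and k0: "k0 \<in> {0..m}"
    and u: "\<And>ks. u ks \<in> U"
    and \<alpha>: "\<And>ks \<omega>. walk m ks \<Longrightarrow> \<omega> \<in> cyl M X (expand m ks) \<Longrightarrow> \<alpha> (length (expand m ks) - 1) \<omega> = u ks"
  shows "J (tm n0) M X \<alpha> = tree u n0 (walk_cost n0 u) [k0]"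
  unfolding J_def
proof (rule has_bochner_integral_integral_eq, rule chain_integral[OF chain n0 k0 u])
  show "\<alpha> (length (expand m ks) - 1) \<omega> = u ks" if "walk m ks" "\<omega> \<in> cyl M X (expand m ks)" for ks \<omega>
    by (rule \<alpha>[OF that])
  show "(\<lambda>\<omega>. path_cost (tm n0) (\<lambda>n. X n \<omega>) (\<lambda>n. \<alpha> n \<omega>)) \<in> borel_measurable M"
    by (rule path_cost_measurable[OF chain n0])
  fix ks \<omega> assume ks: "walk m ks" "length ks = Suc n0" "\<omega> \<in> cyl M X (expand m ks)"
  then have st: "starts (\<lambda>n. X n \<omega>) (expand m ks)" and \<omega>: "\<omega> \<in> space M" by (auto simp: cyl_def)
  show "path_cost (tm n0) (\<lambda>n. X n \<omega>) (\<lambda>n. \<alpha> n \<omega>) = walk_cost n0 u ks"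
  proof (rule path_cost_walk[OF ks(1) st ks(2) n0])
    fix i assume "i < n0"
    then have i: "i < length ks" using ks(2) by simp
    have "\<omega> \<in> cyl M X (expand m (take (Suc i) ks))"
      using starts_take[OF ks(1) st i] \<omega> by (simp add: cyl_def)
    then show "\<alpha> (index ks i) \<omega> = u (take (Suc i) ks)"
      unfolding index_def[OF ks(1) st ks(2) n0] by (rule \<alpha>[OF walk_take[OF ks(1) i]])
  qed
qed

lemma running_cost_start: "running_cost n0 u [k0] = 0"
  by (simp add: running_cost_def)

text \<open>The infimum is attained: under \<open>feedback\<close> the tree of costs is evaluated
  exactly by \<open>tree_cost_eq\<close>, and every other chain is bounded below by
  \<open>tree_cost_ge\<close>.\<close>

lemma V_eq:
  assumes n0: "n0 \<le> N" and k0: "k0 \<in> {0..m}"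
  shows "V (tm n0) (pos k0) = G.val n0 k0"
  unfolding V_def
proof (rule cInf_eq_minimum)
  obtain M :: "(nat \<Rightarrow> real) measure" and X \<alpha> where chain: "controlled_chain (tm n0) (pos k0) M X \<alpha>"
    and \<alpha>: "\<And>n \<omega>. \<alpha> n \<omega> = feedback (clock (tm n0) (\<lambda>j. X j \<omega>) n) (X n \<omega>)"
    using controlled_chain_exists[where fb = feedback, OF feedback_in n0 k0] by blast
  \<comment> \<open>The feedback at walks with an empty cylinder: \<open>tree_cost_eq\<close> speaks
    of all walks, including those the chain never follows.\<close>
  define d where "d ks = (let k = clamp m (last ks) in ad (n0 - length ks) k (G.val_slope (n0 - length ks) k))" for ks
  have d: "d ks \<in> U" for ks
    unfolding d_def Let_def by (rule G.a_in, rule clamp_range) (use m_pos in simp)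
  obtain u where u: "\<And>ks. u ks \<in> U"
    "\<And>ks \<omega>. walk m ks \<Longrightarrow> \<omega> \<in> cyl M X (expand m ks) \<Longrightarrow> \<alpha> (length (expand m ks) - 1) \<omega> = u ks"
    "\<And>ks. walk m ks \<Longrightarrow> cyl M X (expand m ks) = {} \<Longrightarrow> u ks = d ks"
    using chain_control_on_walks[OF chain, of d, OF d] by blast
  have "tree u n0 (walk_cost n0 u) [k0] = running_cost n0 u [k0] + G.val n0 (last [k0])"
  proof (rule tree_cost_eq[OF _ walk.start[OF k0]])
    fix ks n assume ks: "walk m ks" "length ks + n = n0"
    have n: "n0 - length ks = n" using ks(2) by simp
    show "u ks = ad n (last ks) (G.val_slope n (last ks))"
    proof (cases "cyl M X (expand m ks) = {}")
      case True
      then show ?thesis using u(3)[OF ks(1)] n clamp_id[OF walk_last_m[OF ks(1)]] by (simp add: d_def Let_def)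
    next
      case False
      then obtain \<omega> where \<omega>: "\<omega> \<in> cyl M X (expand m ks)" by blast
      then have st: "starts (\<lambda>n. X n \<omega>) (expand m ks)" by (simp add: cyl_def)
      show ?thesis
        unfolding u(2)[OF ks(1) \<omega>, symmetric] \<alpha> node_state[OF ks n0 st]
        by (rule feedback_eq[OF node_state(3)[OF ks n0 st] walk_last_m[OF ks(1)]])
    qed
  qed simp
  then have "J (tm n0) M X \<alpha> = G.val n0 k0"
    using J_tree[OF chain n0 k0 u(1) u(2)] by (simp add: running_cost_start)
  then show "G.val n0 k0 \<in> {J (tm n0) M X \<alpha> | (M :: (nat \<Rightarrow> real) measure) X \<alpha>. controlled_chain (tm n0) (pos k0) M X \<alpha>}"
    using chain by (intro CollectI exI[of _ M] exI[of _ X] exI[of _ \<alpha>] conjI) simp_all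
next
  fix j assume "j \<in> {J (tm n0) M X \<alpha> | (M :: (nat \<Rightarrow> real) measure) X \<alpha>. controlled_chain (tm n0) (pos k0) M X \<alpha>}"
  then obtain M :: "(nat \<Rightarrow> real) measure" and X \<alpha> where chain: "controlled_chain (tm n0) (pos k0) M X \<alpha>"
    and j: "j = J (tm n0) M X \<alpha>" by blast
  obtain u0 where u0: "u0 \<in> U" using U_nonempty by blast
  obtain u where u: "\<And>ks. u ks \<in> U"
    "\<And>ks \<omega>. walk m ks \<Longrightarrow> \<omega> \<in> cyl M X (expand m ks) \<Longrightarrow> \<alpha> (length (expand m ks) - 1) \<omega> = u ks"
    "\<And>ks. walk m ks \<Longrightarrow> cyl M X (expand m ks) = {} \<Longrightarrow> u ks = u0"
    by (rule chain_control_on_walks[OF chain, of "\<lambda>_. u0", OF u0]) metis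
  show "G.val n0 k0 \<le> j"
    using tree_cost_ge[OF u(1) walk.start[OF k0], of n0 n0] J_tree[OF chain n0 k0 u(1) u(2)]
    by (simp add: j running_cost_start)
qed

lemma V_ext_eq:
  assumes "n \<le> N" "k \<in> {-1..m + 1}"
  shows "V_ext (tm n) (pos k) = G.ext n (G.val n) k"
proof -
  have ends: "pos k = L + h \<longleftrightarrow> k = m + 1" "pos k = - h \<longleftrightarrow> k = -1"
    unfolding reflection_states pos_eq_iff by simp_all
  have V: "V (tm n) L = G.val n m" "V (tm n) 0 = G.val n 0" "k \<in> {0..m} \<Longrightarrow> V (tm n) (pos k) = G.val n k"
    using V_eq[OF assms(1), of m] V_eq[OF assms(1), of 0] V_eq[OF assms(1), of k] m_pos unfolding L_eq by simp_all
  consider "k = m + 1" | "k = -1" | "k \<in> {0..m}" using assms(2) by fastforce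
  then show ?thesis
  proof cases
    case 1
    then show ?thesis unfolding V_ext_def ends V by (simp add: G.ext_def rd_def)
  next
    case 2
    then show ?thesis unfolding V_ext_def ends V using m_pos by (simp add: G.ext_def yd_def)
  next
    case 3
    then show ?thesis unfolding V_ext_def ends V(3)[OF 3] by (simp add: G.ext_def)
  qed
qed

lemma opt_control_eq:
  assumes "Suc n \<le> N" "k \<in> {0..m}"
  shows "opt_control (tm (Suc n)) (pos k) = ad n k (G.val_slope n k)"
proof -
  have gf: "grid_floor (tm (Suc n)) = tm (Suc n)"
    using grid_floor_range[of "Suc n" "tm (Suc n)"] assms(1) grid_floor_eq[of 0 0 "N - Suc n" "tm (Suc n)"] Delta_pos
    by (simp add: tm_def algebra_simps)
  have pm: "pos k + h = pos (k + 1)" "pos k - h = pos (k - 1)" by (simp_all add: algebra_simps)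
  have "D_V (tm (Suc n)) (pos k) = G.val_slope n k"
    unfolding D_V_def tm_Suc[OF assms(1)] pm G.slope_def using assms by (simp add: V_ext_eq del: of_int_add of_int_diff)
  then show ?thesis unfolding opt_control_def gf theta_def ad_def by simp
qed

subsection \<open>The law of the optimal chain\<close>

lemma tree_cong:
  assumes "walk m ks"
    and "\<And>ks'. walk m ks' \<Longrightarrow> length ks' = length ks + n \<Longrightarrow> F ks' = F' ks'"
    and "\<And>ks'. walk m ks' \<Longrightarrow> length ks' < length ks + n \<Longrightarrow> u ks' = u' ks'"
  shows "tree u n F ks = tree u' n F' ks"
  using assms
proof (induction n arbitrary: ks)
  case 0
  then show ?case by simp
next
  case (Suc n)
  have "tree u n F (ks @ [k]) = tree u' n F' (ks @ [k])" if "walk m (ks @ [k])" for k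
    by (rule Suc.IH[OF that]) (use Suc.prems(2,3) in auto)
  moreover have "walk m (ks @ [clamp m (last ks + 1)])" "walk m (ks @ [clamp m (last ks - 1)])"
    using Suc.prems(1) by (auto intro: walk.intros)
  moreover have "u ks = u' ks" using Suc.prems(1) by (intro Suc.prems(3)) auto
  ultimately show ?case by simp
qed

definition k_start :: int where "k_start = \<lfloor>x0 / h\<rfloor>"

lemma k_start_range: "k_start \<in> {0..m}"
proof -
  have "0 \<le> x0 / h" "x0 / h \<le> L / h" using x0_range h_pos by (auto simp: divide_right_mono)
  then show ?thesis by (auto simp: k_start_def m_def intro: floor_mono)
qed

definition opt_walk_control :: "int list \<Rightarrow> real" where
  "opt_walk_control ks = (let n = N - length ks; k = clamp m (last ks) in ad n k (G.val_slope n k))"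

lemma opt_walk_control_in: "opt_walk_control ks \<in> U"
  unfolding opt_walk_control_def Let_def by (rule G.a_in, rule clamp_range) (use m_pos in simp)

text \<open>The tree does not mention the chain or its sample space, so all optimal chains give the
  same expectations. An optimal chain prescribes the control at states of the segment before
  \<open>T\<close> only; the expansions of walks with steps to come end in such states.\<close>

lemma optimal_integral:
  fixes M :: "'w measure"
  assumes opt: "optimal_chain M X \<alpha>"
    and meas: "F' \<in> borel_measurable M"
    and F: "\<And>ks \<omega>. walk m ks \<Longrightarrow> length ks = Suc N \<Longrightarrow> \<omega> \<in> cyl M X (expand m ks) \<Longrightarrow> F' \<omega> = F ks"
  shows "has_bochner_integral M F' (tree opt_walk_control N F [k_start])"
proof -
  have chain: "controlled_chain (tm N) (pos k_start) M X \<alpha>"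
    using opt by (simp add: optimal_chain_def tm_N k_start_def)
  obtain u where u: "\<And>ks. u ks \<in> U"
    "\<And>ks \<omega>. walk m ks \<Longrightarrow> \<omega> \<in> cyl M X (expand m ks) \<Longrightarrow> \<alpha> (length (expand m ks) - 1) \<omega> = u ks"
    "\<And>ks. walk m ks \<Longrightarrow> cyl M X (expand m ks) = {} \<Longrightarrow> u ks = opt_walk_control ks"
    using chain_control_on_walks[OF chain, of opt_walk_control, OF opt_walk_control_in] by blast
  have "u ks = opt_walk_control ks" if ks: "walk m ks" "length ks < length [k_start] + N" for ks
  proof (cases "cyl M X (expand m ks) = {}")
    case False
    then obtain \<omega> where \<omega>: "\<omega> \<in> cyl M X (expand m ks)" by blast
    then have st: "starts (\<lambda>n. X n \<omega>) (expand m ks)" and sp: "\<omega> \<in> space M" by (auto simp: cyl_def)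
    define n where "n = N - length ks"
    have n: "length ks + n = N" using ks(2) by (simp add: n_def)
    note node = node_state[OF ks(1) n order_refl st]
    have k: "last ks \<in> {0..m}" by (rule walk_last_m[OF ks(1)])
    have "tm (Suc n) < T" using tm_Suc[OF node(3)] Delta_pos tm_range(1)[of n] by auto
    moreover have "clock 0 (\<lambda>j. X j \<omega>) (length (expand m ks) - 1) = tm (Suc n)"
      using node(1) by (simp only: tm_N)
    moreover have "X (length (expand m ks) - 1) \<omega> \<in> S0" unfolding node(2) pos_in_S0 by (rule k)
    ultimately have "\<alpha> (length (expand m ks) - 1) \<omega> = opt_control (tm (Suc n)) (pos (last ks))"
      using opt sp unfolding optimal_chain_def Let_def node(2)[symmetric] by metis
    also have "\<dots> = opt_walk_control ks"
      unfolding opt_control_eq[OF node(3) k] by (simp add: opt_walk_control_def clamp_id[OF k] n_def Let_def)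
    finally show ?thesis unfolding u(2)[OF ks(1) \<omega>] .
  qed (use u(3)[OF ks(1)] in simp)
  then have "tree u N F [k_start] = tree opt_walk_control N F [k_start]"
    by (intro tree_cong walk.start k_start_range) auto
  moreover have "has_bochner_integral M F' (tree u N F [k_start])"
    by (rule chain_integral[OF chain order_refl k_start_range u(1) u(2) meas F])
  ultimately show ?thesis by simp
qed

section \<open>The law of the optimal walk\<close>

primrec walks :: "(int list \<Rightarrow> real) \<Rightarrow> nat \<Rightarrow> int list \<Rightarrow> int list pmf" where
  "walks u 0 ks = return_pmf ks"
| "walks u (Suc n) ks = bind_pmf (bernoulli_pmf (G.prob_up n (last ks) (u ks)))
     (\<lambda>up. walks u n (ks @ [clamp m (if up then last ks + 1 else last ks - 1)]))"

lemma walk_extend: "walk m ks \<Longrightarrow> walk m (ks @ [clamp m (if up then last ks + 1 else last ks - 1)])"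
  by (auto intro: walk.intros)

text \<open>Nonnegativity is carried along in the induction because \<open>ennreal\<close> is
  additive on nonnegative summands only.\<close>

lemma walks_tree:
  assumes "walk m ks" "\<And>ks. u ks \<in> U"
  shows "emeasure (walks u n ks) A = ennreal (tree u n (indicator A) ks) \<and> 0 \<le> tree u n (indicator A) ks"
  using assms(1)
proof (induction n arbitrary: ks)
  case 0
  then show ?case by (simp add: emeasure_return_pmf ennreal_indicator)
next
  case (Suc n)
  let ?p = "G.prob_up n (last ks) (u ks)"
  have p: "0 \<le> ?p" "?p \<le> 1" using G.prob_up_range[OF walk_last_m[OF Suc.prems] assms(2), of n ks] by auto
  note IH = Suc.IH[OF walk_extend[OF Suc.prems]]
  show ?case
    using p IH[of True] IH[of False]
    by (simp add: nn_integral_bernoulli_pmf ennreal_mult' ennreal_plus mult.commute)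
qed

lemma walks_support:
  assumes "walk m ks" "ks' \<in> set_pmf (walks u n ks)"
  shows "walk m ks' \<and> length ks' = length ks + n"
  using assms
proof (induction n arbitrary: ks)
  case (Suc n)
  then obtain up where "ks' \<in> set_pmf (walks u n (ks @ [clamp m (if up then last ks + 1 else last ks - 1)]))"
    by auto
  from Suc.IH[OF walk_extend[OF Suc.prems(1)] this] show ?case by simp
qed simp

text \<open>The default value is needed because measurability requires a path for every list.\<close>

definition path_of :: "int list \<Rightarrow> (real \<Rightarrow>\<^sub>C real)" where
  "path_of ks = polygon (if set ks \<subseteq> {0..m} \<and> length ks = Suc N then ks else replicate (Suc N) 0)"

lemma path_of_paths: "path_of ks \<in> paths T L"
  unfolding path_of_def using m_pos by (intro polygon_paths) auto

lemma path_of_walk: "walk m ks \<Longrightarrow> length ks = Suc N \<Longrightarrow> path_of ks = polygon ks"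
  using walk_range[of m ks] m_pos by (simp add: path_of_def)

definition walk_law :: "int list pmf" where
  "walk_law = walks opt_walk_control N [k_start]"

definition path_law :: "(real \<Rightarrow>\<^sub>C real) measure" where
  "path_law = distr walk_law (path_space T L) path_of"

lemma path_of_measurable: "path_of \<in> measure_pmf p \<rightarrow>\<^sub>M path_space T L"
  by (auto simp: measurable_def path_of_paths)

lemma optimal_law:
  fixes M :: "'w measure"
  assumes opt: "optimal_chain M X \<alpha>"
  shows "restrict_space (distr M borel (\<lambda>\<omega>. X_hat (\<lambda>n. X n \<omega>))) (paths T L) = path_law"
proof (rule measure_eqI)
  let ?Y = "\<lambda>\<omega>. X_hat (\<lambda>n. X n \<omega>)"
  have chain: "controlled_chain (tm N) (pos k_start) M X \<alpha>"
    using opt by (simp add: optimal_chain_def tm_N k_start_def)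
  interpret prob_space M by (rule chain_prob_space[OF chain])
  have Y[measurable]: "?Y \<in> borel_measurable M" by (rule X_hat_measurable[OF chain])
  have pc: "paths T L \<in> sets borel" by (rule borel_closed[OF closed_paths])
  show "sets (restrict_space (distr M borel ?Y) (paths T L)) = sets path_law"
    by (simp add: path_law_def path_space_def cong: sets_restrict_space_cong)
  fix A assume "A \<in> sets (restrict_space (distr M borel ?Y) (paths T L))"
  then have A: "A \<in> sets (restrict_space borel (paths T L))"
    by (simp cong: sets_restrict_space_cong)
  then have Ab: "A \<in> sets borel" "A \<subseteq> paths T L"
    using pc by (auto simp: sets_restrict_space)
  have "has_bochner_integral M (\<lambda>\<omega>. indicator A (?Y \<omega>) :: real)
      (tree opt_walk_control N (indicator {ks. path_of ks \<in> A}) [k_start])"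
  proof (rule optimal_integral[OF opt])
    show "(\<lambda>\<omega>. indicator A (?Y \<omega>) :: real) \<in> borel_measurable M" using Ab by measurable
    fix ks \<omega> assume ks: "walk m ks" "length ks = Suc N" "\<omega> \<in> cyl M X (expand m ks)"
    then have "starts (\<lambda>n. X n \<omega>) (expand m ks)" by (simp add: cyl_def)
    then have "?Y \<omega> = path_of ks" using X_hat_walk[OF ks(1) _ ks(2)] path_of_walk[OF ks(1,2)] by simp
    then show "indicator A (?Y \<omega>) = (indicator {ks. path_of ks \<in> A} ks :: real)" by (simp add: indicator_def)
  qed
  then have "(\<integral>\<omega>. indicator A (?Y \<omega>) \<partial>M) = tree opt_walk_control N (indicator {ks. path_of ks \<in> A}) [k_start]"
    by (rule has_bochner_integral_integral_eq)
  moreover have "(\<integral>\<omega>. indicator A (?Y \<omega>) \<partial>M) = measure M (?Y -` A \<inter> space M)"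
  proof -
    have "(\<integral>\<omega>. indicator A (?Y \<omega>) \<partial>M) = (\<integral>\<omega>. indicator (?Y -` A \<inter> space M) \<omega> \<partial>M :: real)"
      by (intro Bochner_Integration.integral_cong) (auto simp: indicator_def)
    then show ?thesis using measurable_sets[OF Y Ab(1)] by simp
  qed
  ultimately have "emeasure M (?Y -` A \<inter> space M) = emeasure walk_law {ks. path_of ks \<in> A}"
    using walks_tree[where u = opt_walk_control and n = N and A = "{ks. path_of ks \<in> A}",
        OF walk.start[OF k_start_range] opt_walk_control_in]
    by (simp add: emeasure_eq_measure walk_law_def)
  moreover have "emeasure (restrict_space (distr M borel ?Y) (paths T L)) A = emeasure M (?Y -` A \<inter> space M)"
    using pc Ab by (subst emeasure_restrict_space) (auto simp: emeasure_distr)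
  moreover have "emeasure path_law A = emeasure walk_law {ks. path_of ks \<in> A}"
    unfolding path_law_def using A
    by (subst emeasure_distr[OF path_of_measurable]) (auto simp: path_space_def vimage_def)
  ultimately show "emeasure (restrict_space (distr M borel ?Y) (paths T L)) A = emeasure path_law A"
    by simp
qed

text \<open>\<open>feedback\<close> and \<open>opt_control\<close> are matched at grid states and at
  grid times before the horizon; the clock of the chain runs through grid times, so these are the
  cases that occur.\<close>

lemma optimal_chain_exists: "\<exists>(M :: (nat \<Rightarrow> real) measure) X \<alpha>. optimal_chain M X \<alpha>"
proof -
  obtain M :: "(nat \<Rightarrow> real) measure" and X \<alpha> where chain: "controlled_chain (tm N) (pos k_start) M X \<alpha>"
    and \<alpha>: "\<And>n \<omega>. \<alpha> n \<omega> = feedback (clock (tm N) (\<lambda>j. X j \<omega>) n) (X n \<omega>)"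
    using controlled_chain_exists[where fb = feedback, OF feedback_in order_refl k_start_range] by blast
  have "\<alpha> n \<omega> = opt_control (clock 0 (\<lambda>j. X j \<omega>) n) (X n \<omega>)"
    if "clock 0 (\<lambda>j. X j \<omega>) n < T" "X n \<omega> \<in> S0" for n \<omega>
  proof -
    obtain k where k: "X n \<omega> = pos k" "k \<in> {0..m}" using \<open>X n \<omega> \<in> S0\<close> unfolding S0_eq by blast
    obtain j where j: "clock 0 (\<lambda>j. X j \<omega>) n = real j * Delta"
      using clock_grid[where fb = feedback and \<xi> = "\<lambda>j. X j \<omega>" and n = n, OF feedback_in order_refl k_start_range]
      by (auto simp: tm_N)
    have "real j * Delta < real N * Delta" using that(1) j T_eq by simp
    then have "j < N" using Delta_pos by simp
    then have "real j * Delta = tm (Suc (N - Suc j))" by (simp add: tm_def)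
    then have c: "clock 0 (\<lambda>j. X j \<omega>) n = tm (Suc (N - Suc j))" using j by simp
    have le: "Suc (N - Suc j) \<le> N" using \<open>j < N\<close> by simp
    show ?thesis
      unfolding \<alpha> tm_N c k(1) feedback_eq[OF le k(2)] opt_control_eq[OF le k(2)] ..
  qed
  then have "optimal_chain M X \<alpha>"
    using chain unfolding optimal_chain_def Let_def tm_N k_start_def by blast
  then show ?thesis by blast
qed

lemma Phi_eq: "Phi = path_law"
  unfolding Phi_def
proof (rule the_equality)
  show "\<exists>(M :: (nat \<Rightarrow> real) measure) X \<alpha>. optimal_chain M X \<alpha> \<and>
     path_law = restrict_space (distr M borel (\<lambda>\<omega>. X_hat (\<lambda>n. X n \<omega>))) (paths T L)"
    using optimal_chain_exists optimal_law by metis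
next
  fix \<mu> assume "\<exists>(M :: (nat \<Rightarrow> real) measure) X \<alpha>. optimal_chain M X \<alpha> \<and>
     \<mu> = restrict_space (distr M borel (\<lambda>\<omega>. X_hat (\<lambda>n. X n \<omega>))) (paths T L)"
  then show "\<mu> = path_law" using optimal_law by blast
qed

end

subsection \<open>Coupling two walks\<close>

lemma bool_pmf_eqI:
  assumes "pmf p True = pmf q True"
  shows "p = q"
proof (rule pmf_eqI)
  fix i show "pmf p i = pmf q i" using assms by (cases i) (auto simp: pmf_False_conv_True)
qed

lemma bernoulli_coupling_aux:
  assumes "0 \<le> p" "p \<le> q" "q \<le> (1::real)"
  shows "\<exists>c :: (bool \<times> bool) pmf. map_pmf fst c = bernoulli_pmf p \<and> map_pmf snd c = bernoulli_pmf q \<and>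
     emeasure c {x. fst x \<noteq> snd x} = ennreal (q - p)"
proof -
  have pq1: "0 \<le> p / q" "p / q \<le> 1" using assms by (auto simp: divide_le_eq_1)
  have pq2: "q * (p / q) = p" using assms by (cases "q = 0") auto
  have pq3: "q * (1 - p / q) = q - p" unfolding right_diff_distrib pq2 by simp
  note pq = pq1 pq2 pq3
  \<comment> \<open>Thinning: a success of the more likely variable is kept for the other one with
    probability \<open>p / q\<close>. The two then differ with probability
    \<open>q * (1 - p / q) = q - p\<close>; for \<open>q = 0\<close> the quotient is
    \<open>0\<close>, which does no harm.\<close>
  define c where "c = bind_pmf (bernoulli_pmf q)
    (\<lambda>v. if v then map_pmf (\<lambda>u. (u, True)) (bernoulli_pmf (p / q)) else return_pmf (False, False))"
  have "pmf (map_pmf fst c) True = p"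
  proof -
    have "map_pmf fst c = bind_pmf (bernoulli_pmf q) (\<lambda>v. if v then bernoulli_pmf (p / q) else return_pmf False)"
      unfolding c_def map_bind_pmf by (rule bind_pmf_cong) (auto simp: map_pmf_comp)
    then have "pmf (map_pmf fst c) True = (\<integral>v. pmf (if v then bernoulli_pmf (p / q) else return_pmf False) True \<partial>bernoulli_pmf q)"
      by (simp only: pmf_bind)
    also have "\<dots> = (p / q) * q + 0 * (1 - q)"
      using assms pq1 by (subst integral_bernoulli_pmf) simp_all
    also have "\<dots> = p" using pq2 by (simp only: mult.commute mult_zero_left add_0_right)
    finally show ?thesis .
  qed
  moreover have "pmf (map_pmf snd c) True = q"
  proof -
    have "map_pmf snd c = bind_pmf (bernoulli_pmf q) return_pmf"
      unfolding c_def map_bind_pmf by (rule bind_pmf_cong) (auto simp: map_pmf_comp)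
    then show ?thesis using assms by (simp add: bind_return_pmf')
  qed
  moreover have "emeasure c {x. fst x \<noteq> snd x} = ennreal (q - p)"
  proof -
    have "(\<lambda>u. (u, True)) -` {x. fst x \<noteq> snd x} = {False}" by auto
    then have "emeasure (map_pmf (\<lambda>u. (u, True)) (bernoulli_pmf (p / q))) {x. fst x \<noteq> snd x} = ennreal (1 - p / q)"
      using pq by (simp add: emeasure_pmf_single)
    moreover have "emeasure (return_pmf (False, False)) {x. fst x \<noteq> snd x} = 0"
      by (simp add: emeasure_return_pmf)
    ultimately have "emeasure c {x. fst x \<noteq> snd x} = ennreal (1 - p / q) * ennreal q"
      unfolding c_def emeasure_bind_pmf using assms by (subst nn_integral_bernoulli_pmf) auto
    also have "\<dots> = ennreal ((1 - p / q) * q)" using pq1 by (intro ennreal_mult'[symmetric]) simp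
    also have "(1 - p / q) * q = q - p" using pq3 by (simp only: mult.commute)
    finally show ?thesis .
  qed
  ultimately show ?thesis
    using assms by (intro exI[of _ c] conjI bool_pmf_eqI) auto
qed

lemma bernoulli_coupling:
  assumes "p \<in> {0..1}" "q \<in> {0..1::real}"
  shows "\<exists>c :: (bool \<times> bool) pmf. map_pmf fst c = bernoulli_pmf p \<and> map_pmf snd c = bernoulli_pmf q \<and>
     emeasure c {x. fst x \<noteq> snd x} = ennreal \<bar>p - q\<bar>"
proof (cases "p \<le> q")
  case True
  then show ?thesis using bernoulli_coupling_aux[of p q] assms by auto
next
  case False
  then obtain c :: "(bool \<times> bool) pmf" where c: "map_pmf fst c = bernoulli_pmf q" "map_pmf snd c = bernoulli_pmf p"
    "emeasure c {x. fst x \<noteq> snd x} = ennreal (p - q)"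
    using bernoulli_coupling_aux[of q p] assms by auto
  let ?s = "\<lambda>x :: bool \<times> bool. (snd x, fst x)"
  have "?s -` {x. fst x \<noteq> snd x} = {x. fst x \<noteq> snd x}" by auto
  then show ?thesis
    using c False by (intro exI[of _ "map_pmf ?s c"]) (simp add: map_pmf_comp)
qed

definition bernoulli_coupled :: "real \<Rightarrow> real \<Rightarrow> (bool \<times> bool) pmf" where
  "bernoulli_coupled p q = (SOME c. map_pmf fst c = bernoulli_pmf p \<and> map_pmf snd c = bernoulli_pmf q \<and>
     emeasure c {x. fst x \<noteq> snd x} = ennreal \<bar>p - q\<bar>)"

lemma bernoulli_coupled:
  assumes "p \<in> {0..1}" "q \<in> {0..1}"
  shows "map_pmf fst (bernoulli_coupled p q) = bernoulli_pmf p"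
    and "map_pmf snd (bernoulli_coupled p q) = bernoulli_pmf q"
    and "emeasure (bernoulli_coupled p q) {x. fst x \<noteq> snd x} = ennreal \<bar>p - q\<bar>"
  using someI_ex[OF bernoulli_coupling[OF assms]] unfolding bernoulli_coupled_def by blast+

lemma clamp_nonexpanding: "\<bar>clamp m k - clamp m k'\<bar> \<le> \<bar>k - k'\<bar>"
  by (auto simp: clamp_def)

locale mfg_setup_pair =
  A: mfg_setup L \<sigma> T0 U b f g y r x0 T h \<nu> c R + B: mfg_setup L \<sigma> T0 U b f g y r x0 T h \<nu>' c R
  for L \<sigma> T0 :: real and U :: "real set"
    and b f :: "real \<Rightarrow> real measure \<Rightarrow> real \<Rightarrow> real \<Rightarrow> real"
    and g :: "real measure \<Rightarrow> real \<Rightarrow> real"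
    and y r :: "real \<Rightarrow> real measure \<Rightarrow> real"
    and x0 T h :: real and \<nu> \<nu>' :: "(real \<Rightarrow>\<^sub>C real) measure" and c R :: real +
  fixes c\<^sub>\<alpha> :: real
  assumes c\<^sub>\<alpha>_nonneg: "0 \<le> c\<^sub>\<alpha>"
    and alpha_lip: "\<lbrakk>t \<in> {0..T0}; \<eta> \<in> space (prob_algebra (segment_space L));
        \<eta>' \<in> space (prob_algebra (segment_space L)); x \<in> {0..L}; x' \<in> {0..L}\<rbrakk> \<Longrightarrow>
       \<bar>A.alpha_hat t \<eta> x p - A.alpha_hat t \<eta>' x' p'\<bar> \<le> c\<^sub>\<alpha> * (W1 \<eta> \<eta>' + \<bar>x - x'\<bar> + \<bar>p - p'\<bar>)"
begin

abbreviation W :: real where "W \<equiv> W1 \<nu> \<nu>'"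

lemma W1_marg: "W1 (A.marg t) (B.marg t) \<le> W"
  by (rule W1_marginal_le[OF less_imp_le[OF A.L_pos] A.\<nu>_prob B.\<nu>_prob])

lemma data_lip:
  assumes "t \<in> {0..T0}" "x \<in> {0..L}" "x' \<in> {0..L}" "a \<in> U" "a' \<in> U"
  shows "\<bar>f t (A.marg t) x a - f t (B.marg t) x' a'\<bar> + \<bar>g (A.marg t) x - g (B.marg t) x'\<bar>
      + \<bar>b t (A.marg t) x a - b t (B.marg t) x' a'\<bar> \<le> c * (W + \<bar>x - x'\<bar> + \<bar>a - a'\<bar>)"
proof -
  have "c * (\<bar>t - t\<bar> + W1 (A.marg t) (B.marg t) + \<bar>x - x'\<bar> + \<bar>a - a'\<bar>) \<le> c * (W + \<bar>x - x'\<bar> + \<bar>a - a'\<bar>)"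
    using W1_marg[of t] A.c_nonneg by (intro mult_left_mono) auto
  then show ?thesis
    using A.lip[OF assms(1,1) A.marg_prob B.marg_prob assms(2-5), of t t] by linarith
qed

lemma flux_eq: "B.yd = A.yd" "B.rd = A.rd"
proof -
  have "y (A.tm n) (B.marg (A.tm n)) = y (A.tm n) (A.marg (A.tm n)) \<and> r (A.tm n) (B.marg (A.tm n)) = r (A.tm n) (A.marg (A.tm n))" for n
    using A.flux_independent A.tm_range(2)[of n] A.marg_prob B.marg_prob unfolding A.A2_def by blast
  then show "B.yd = A.yd" "B.rd = A.rd"
    by (auto simp: A.yd_def B.yd_def A.rd_def B.rd_def)
qed

sublocale P: grid_problem_pair A.m h \<sigma> A.Delta U A.fd A.bd A.gd A.yd A.rd A.ad c R A.c_B B.fd B.bd B.gd B.ad W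
proof (intro grid_problem_pair.intro grid_problem_pair_axioms.intro)
  show "grid_problem A.m h \<sigma> A.Delta U A.fd A.bd A.gd A.yd A.rd A.ad c R A.c_B" by (rule A.grid)
  show "grid_problem A.m h \<sigma> A.Delta U B.fd B.bd B.gd A.yd A.rd B.ad c R A.c_B"
    using B.grid unfolding flux_eq .
  show "0 \<le> W" by (rule W1_nonneg)
  obtain u where u: "u \<in> U" using A.U_nonempty by blast
  show "\<bar>A.fd n k u - B.fd n k u\<bar> \<le> c * W" "\<bar>A.bd n k u - B.bd n k u\<bar> \<le> c * W"
    if "k \<in> {0..A.m}" "u \<in> U" for n k u
    using data_lip[OF A.tm_range(2)[of "Suc n"] A.pos_range[OF that(1)] A.pos_range[OF that(1)] that(2) that(2)]
    unfolding A.fd_def B.fd_def A.bd_def B.bd_def by auto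
  show "\<bar>A.gd k - B.gd k\<bar> \<le> c * W" if "k \<in> {0..A.m}" for k
    using data_lip[OF A.tm_range(2)[of 0] A.pos_range[OF that(1)] A.pos_range[OF that(1)] u u]
    unfolding A.gd_def B.gd_def A.tm_0 by auto
qed

text \<open>
  The singularity at the horizon is that of the second differences of the value function; being of
  order \<open>1 / sqrt\<close>, it is integrable.
\<close>

definition drift_lip :: "nat \<Rightarrow> real" where
  "drift_lip n = c * (1 + c\<^sub>\<alpha> * (1 + (A.G.slope_const (2 * T0) ((max c R + 1) * exp (c * (2 * T0))) / (h * sqrt (real n + 1)) + 2 * R / L)))"

lemma slope_const_nonneg: "0 \<le> A.G.slope_const (2 * T0) ((max c R + 1) * exp (c * (2 * T0)))"
  unfolding A.G.slope_const_def
  using A.c_nonneg A.G.R_nonneg A.G.B_nonneg A.h_pos A.m_pos A.T_pos A.T_le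
  by (intro add_nonneg_nonneg mult_nonneg_nonneg divide_nonneg_nonneg) auto

lemma drift_lip_nonneg: "0 \<le> drift_lip n"
  unfolding drift_lip_def
  using slope_const_nonneg A.c_nonneg c\<^sub>\<alpha>_nonneg A.h_pos A.G.R_nonneg A.L_pos
  by (intro mult_nonneg_nonneg add_nonneg_nonneg divide_nonneg_nonneg) auto

lemma Delta_le_T: "A.Delta \<le> T"
proof -
  have "1 * A.Delta \<le> real A.N * A.Delta" using A.N_pos A.Delta_pos by (intro mult_right_mono) auto
  then show ?thesis by (simp add: A.T_eq)
qed

context
  assumes small: "12 * A.c_B * sqrt (2 * T) \<le> \<sigma>"
begin

text \<open>The Lipschitz bounds are composed: the drift depends on the control by (A1), the control
  on the slope by (A3), and the slope on state and measure by
  \<open>feedback_slope_diff\<close>.\<close>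

lemma optimal_drift_diff:
  assumes n: "Suc n \<le> A.N" and k: "k \<in> {0..A.m}" "k' \<in> {0..A.m}"
  shows "\<bar>A.bd n k (A.ad n k (A.G.val_slope n k)) - B.bd n k' (B.ad n k' (B.G.val_slope n k'))\<bar>
     \<le> drift_lip n * (W + \<bar>A.pos k - A.pos k'\<bar>)"
proof -
  let ?K = "(max c R + 1) * exp (c * (2 * T0))" and ?\<tau> = "2 * T0"
  let ?E = "A.G.slope_const ?\<tau> ?K / (h * sqrt (real n + 1)) + 2 * R / L"
  let ?d = "\<bar>A.pos k - A.pos k'\<bar>"
  have d: "?d = h * \<bar>k - k'\<bar>"
    unfolding left_diff_distrib[symmetric] abs_mult using A.h_pos by simp
  \<comment> \<open>\<open>N + 1\<close> steps take the time \<open>T + Delta\<close>, and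
    \<open>Delta\<close> is at most \<open>T\<close>; this is the origin of \<open>2 * T0\<close> in
    the constants.\<close>
  have time: "real (A.N + 1) * A.Delta \<le> 2 * T" using Delta_le_T by (simp add: distrib_right A.T_eq)
  have K: "A.G.lip_const i \<le> ?K" if "i \<le> A.N" for i
  proof (rule A.G.lip_const_le)
    have "real i * A.Delta \<le> real (A.N + 1) * A.Delta" using that A.Delta_pos by (intro mult_right_mono) auto
    then show "real i * A.Delta \<le> 2 * T0" using time A.T_le by linarith
  qed
  have sq: "12 * A.c_B * sqrt (real (A.N + 1) * A.Delta) \<le> \<sigma>"
  proof -
    have "12 * A.c_B * sqrt (real (A.N + 1) * A.Delta) \<le> 12 * A.c_B * sqrt (2 * T)"
      using time A.G.B_nonneg by (intro mult_left_mono) auto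
    then show ?thesis using small by linarith
  qed
  have slope: "\<bar>A.G.val_slope n k - B.G.val_slope n k'\<bar> \<le> ?E * (?d + W)"
    using P.feedback_slope_diff[OF K sq _ _ k, of ?\<tau> n] time A.T_le n
    unfolding d flux_eq by (simp add: A.L_eq mult.commute[of h])
  have alpha: "\<bar>A.ad n k (A.G.val_slope n k) - B.ad n k' (B.G.val_slope n k')\<bar> \<le> c\<^sub>\<alpha> * (W + ?d + ?E * (?d + W))"
  proof -
    have "\<bar>A.ad n k (A.G.val_slope n k) - B.ad n k' (B.G.val_slope n k')\<bar>
      \<le> c\<^sub>\<alpha> * (W1 (A.marg (A.tm (Suc n))) (B.marg (A.tm (Suc n))) + ?d + \<bar>A.G.val_slope n k - B.G.val_slope n k'\<bar>)"
      unfolding A.ad_def B.ad_def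
      by (rule alpha_lip[OF A.tm_range(2) A.marg_prob B.marg_prob A.pos_range[OF k(1)] A.pos_range[OF k(2)]])
    also have "\<dots> \<le> c\<^sub>\<alpha> * (W + ?d + ?E * (?d + W))"
      using slope W1_marg c\<^sub>\<alpha>_nonneg by (intro mult_left_mono add_mono) auto
    finally show ?thesis .
  qed
  have "\<bar>A.bd n k (A.ad n k (A.G.val_slope n k)) - B.bd n k' (B.ad n k' (B.G.val_slope n k'))\<bar>
     \<le> c * (W + ?d + \<bar>A.ad n k (A.G.val_slope n k) - B.ad n k' (B.G.val_slope n k')\<bar>)"
    using data_lip[OF A.tm_range(2)[of "Suc n"] A.pos_range[OF k(1)] A.pos_range[OF k(2)]
        A.G.a_in[OF k(1), of n "A.G.val_slope n k"] B.G.a_in[OF k(2), of n "B.G.val_slope n k'"]]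
    unfolding A.bd_def B.bd_def by linarith
  also have "\<dots> \<le> c * (W + ?d + c\<^sub>\<alpha> * (W + ?d + ?E * (?d + W)))"
    using alpha A.c_nonneg by (intro mult_left_mono add_left_mono) auto
  also have "\<dots> = drift_lip n * (W + ?d)"
    unfolding drift_lip_def by (simp add: distrib_left distrib_right add.commute)
  finally show ?thesis .
qed

section \<open>The coupled pair of walks\<close>

primrec coupled_walks :: "nat \<Rightarrow> int list \<times> int list \<Rightarrow> (int list \<times> int list) pmf" where
  "coupled_walks 0 s = return_pmf s"
| "coupled_walks (Suc n) s = bind_pmf
     (bernoulli_coupled (A.G.prob_up n (last (fst s)) (A.opt_walk_control (fst s)))
        (B.G.prob_up n (last (snd s)) (B.opt_walk_control (snd s))))
     (\<lambda>v. coupled_walks n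
        (fst s @ [clamp A.m (if fst v then last (fst s) + 1 else last (fst s) - 1)],
         snd s @ [clamp A.m (if snd v then last (snd s) + 1 else last (snd s) - 1)]))"

lemma coupled_prob_range:
  assumes "walk A.m ks" "walk A.m ks'"
  shows "A.G.prob_up n (last ks) (A.opt_walk_control ks) \<in> {0..1}"
    "B.G.prob_up n (last ks') (B.opt_walk_control ks') \<in> {0..1}"
  by (rule A.G.prob_up_range[OF A.walk_last_m[OF assms(1)] A.opt_walk_control_in])
    (rule B.G.prob_up_range[OF B.walk_last_m[OF assms(2)] B.opt_walk_control_in])

lemma coupled_walks_marginals:
  assumes "walk A.m (fst s)" "walk A.m (snd s)"
  shows "map_pmf fst (coupled_walks n s) = A.walks A.opt_walk_control n (fst s)
    \<and> map_pmf snd (coupled_walks n s) = B.walks B.opt_walk_control n (snd s)"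
  using assms
proof (induction n arbitrary: s)
  case (Suc n)
  note bc = bernoulli_coupled[OF coupled_prob_range(1)[OF Suc.prems, of n] coupled_prob_range(2)[OF Suc.prems, of n]]
  have IH: "map_pmf fst (coupled_walks n (fst s @ [clamp A.m (if v then last (fst s) + 1 else last (fst s) - 1)],
         snd s @ [clamp A.m (if v' then last (snd s) + 1 else last (snd s) - 1)]))
       = A.walks A.opt_walk_control n (fst s @ [clamp A.m (if v then last (fst s) + 1 else last (fst s) - 1)])"
    "map_pmf snd (coupled_walks n (fst s @ [clamp A.m (if v then last (fst s) + 1 else last (fst s) - 1)],
         snd s @ [clamp A.m (if v' then last (snd s) + 1 else last (snd s) - 1)]))
       = B.walks B.opt_walk_control n (snd s @ [clamp A.m (if v' then last (snd s) + 1 else last (snd s) - 1)])" for v v'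
    using Suc.IH[of "(fst s @ [clamp A.m (if v then last (fst s) + 1 else last (fst s) - 1)],
         snd s @ [clamp A.m (if v' then last (snd s) + 1 else last (snd s) - 1)])"]
      A.walk_extend[OF Suc.prems(1), of v] B.walk_extend[OF Suc.prems(2), of v'] by simp_all
  show ?case
    unfolding coupled_walks.simps A.walks.simps B.walks.simps map_bind_pmf IH
    by (simp only: bc(1,2)[symmetric] bind_map_pmf)
qed simp

lemma coupled_walks_support:
  assumes "walk A.m (fst s)" "walk A.m (snd s)" "s' \<in> set_pmf (coupled_walks n s)"
  shows "walk A.m (fst s')" "walk A.m (snd s')" "length (fst s') = length (fst s) + n" "length (snd s') = length (snd s) + n"
proof -
  have "fst s' \<in> set_pmf (A.walks A.opt_walk_control n (fst s))" "snd s' \<in> set_pmf (B.walks B.opt_walk_control n (snd s))"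
    using assms(3) coupled_walks_marginals[OF assms(1,2), of n] by (metis imageI pmf.set_map)+
  then show "walk A.m (fst s')" "walk A.m (snd s')" "length (fst s') = length (fst s) + n" "length (snd s') = length (snd s) + n"
    using A.walks_support[OF assms(1)] B.walks_support[OF assms(2)] by blast+
qed

definition separation :: "int list \<times> int list \<Rightarrow> real" where
  "separation s = (MAX i\<in>{..<length (fst s)}. \<bar>A.pos (fst s ! i) - A.pos (snd s ! i)\<bar>)"

lemma separation_ge: "i < length (fst s) \<Longrightarrow> \<bar>A.pos (fst s ! i) - A.pos (snd s ! i)\<bar> \<le> separation s"
  unfolding separation_def by (intro Max_ge) auto

lemma separation_snoc:
  assumes "length ks = length ks'" "ks \<noteq> []"
  shows "separation (ks @ [k], ks' @ [k']) = max (separation (ks, ks')) \<bar>A.pos k - A.pos k'\<bar>"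
proof -
  have "(\<lambda>i. \<bar>A.pos ((ks @ [k]) ! i) - A.pos ((ks' @ [k']) ! i)\<bar>) ` {..<length (ks @ [k])}
    = insert \<bar>A.pos k - A.pos k'\<bar> ((\<lambda>i. \<bar>A.pos (ks ! i) - A.pos (ks' ! i)\<bar>) ` {..<length ks})"
    using assms(1) by (auto simp: lessThan_Suc nth_append image_iff)
  moreover have "(\<lambda>i. \<bar>A.pos (ks ! i) - A.pos (ks' ! i)\<bar>) ` {..<length ks} \<noteq> {}" using assms(2) by (simp add: lessThan_empty_iff)
  ultimately show ?thesis unfolding separation_def by (simp add: max.commute)
qed

text \<open>The running maximum of the distance stays the same when both walks move alike, since
  \<open>clamp\<close> does not expand, and it grows by at most \<open>2 * h\<close> otherwise.
  Hence the supremum is estimated inside the expectation, with no maximal inequality. Adding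
  \<open>W\<close> makes the recursion homogeneous: one step multiplies by
  \<open>1 + Delta * drift_lip\<close>.\<close>

lemma coupled_separation:
  assumes "walk A.m (fst s)" "walk A.m (snd s)" "length (fst s) = length (snd s)" "length (fst s) + n = Suc A.N"
  shows "(\<integral>\<^sup>+ s'. ennreal (W + separation s') \<partial>coupled_walks n s)
    \<le> ennreal ((\<Prod>i<n. 1 + A.Delta * drift_lip i) * (W + separation s))"
  using assms
proof (induction n arbitrary: s)
  case (Suc n)
  obtain ks ks' where s: "s = (ks, ks')" by (cases s)
  have ks: "walk A.m ks" "walk A.m ks'" "length ks = length ks'" using Suc.prems by (auto simp: s)
  have ne: "ks \<noteq> []" "ks' \<noteq> []" using walk_nonempty ks by blast+
  have k: "last ks \<in> {0..A.m}" "last ks' \<in> {0..A.m}" using A.walk_last_m[OF ks(1)] A.walk_last_m[OF ks(2)] .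
  let ?p = "A.G.prob_up n (last ks) (A.opt_walk_control ks)" and ?q = "B.G.prob_up n (last ks') (B.opt_walk_control ks')"
  let ?d = "\<bar>A.pos (last ks) - A.pos (last ks')\<bar>"
  have len: "A.N - length ks = n" "A.N - length ks' = n" "Suc n \<le> A.N"
    using Suc.prems(4) ks(3) ne(1) by (auto simp: s Suc_le_eq neq_Nil_conv)
  have u: "A.opt_walk_control ks = A.ad n (last ks) (A.G.val_slope n (last ks))"
    "B.opt_walk_control ks' = B.ad n (last ks') (B.G.val_slope n (last ks'))"
    unfolding A.opt_walk_control_def B.opt_walk_control_def Let_def len clamp_id[OF k(1)] clamp_id[OF k(2)] by simp_all
  have d: "?d \<le> separation s"
    using separation_ge[of "length ks - 1" s] ne ks(3) by (simp add: s last_conv_nth)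
  have sep0: "0 \<le> separation s" using d by linarith
  have pq: "2 * h * \<bar>?p - ?q\<bar> \<le> A.Delta * drift_lip n * (W + separation s)"
  proof -
    have drift: "\<bar>A.bd n (last ks) (A.opt_walk_control ks) - B.bd n (last ks') (B.opt_walk_control ks')\<bar> \<le> drift_lip n * (W + ?d)"
      unfolding u by (rule optimal_drift_diff[OF len(3) k])
    have "?p - ?q = h / (2 * \<sigma>\<^sup>2) * (A.bd n (last ks) (A.opt_walk_control ks) - B.bd n (last ks') (B.opt_walk_control ks'))"
      unfolding A.G.prob_up_def B.G.prob_up_def using A.\<sigma>_pos by (simp add: field_simps)
    then have "\<bar>?p - ?q\<bar> \<le> h / (2 * \<sigma>\<^sup>2) * (drift_lip n * (W + ?d))"
      using drift A.h_pos by (simp add: abs_mult divide_right_mono mult_left_mono)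
    also have "\<dots> \<le> h / (2 * \<sigma>\<^sup>2) * (drift_lip n * (W + separation s))"
      using d drift_lip_nonneg[of n] A.h_pos by (intro mult_left_mono) auto
    finally have "2 * h * \<bar>?p - ?q\<bar> \<le> 2 * h * (h / (2 * \<sigma>\<^sup>2) * (drift_lip n * (W + separation s)))"
      using A.h_pos by (intro mult_left_mono) auto
    also have "\<dots> = A.Delta * drift_lip n * (W + separation s)"
      by (simp add: A.Delta_def power2_eq_square)
    finally show ?thesis .
  qed
  let ?\<Pi> = "\<Prod>i<n. 1 + A.Delta * drift_lip i"
  let ?c = "bernoulli_coupled ?p ?q"
  let ?next = "\<lambda>v. (ks @ [clamp A.m (if fst v then last ks + 1 else last ks - 1)],
         ks' @ [clamp A.m (if snd v then last ks' + 1 else last ks' - 1)])"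
  have \<Pi>: "0 \<le> ?\<Pi>" using drift_lip_nonneg A.Delta_pos by (intro prod_nonneg) auto
  have step: "separation (?next v) \<le> separation s + 2 * h * (if fst v \<noteq> snd v then 1 else 0)" for v
  proof -
    let ?a = "clamp A.m (if fst v then last ks + 1 else last ks - 1)"
    let ?b = "clamp A.m (if snd v then last ks' + 1 else last ks' - 1)"
    have "\<bar>?a - ?b\<bar> \<le> \<bar>last ks - last ks'\<bar> + (if fst v \<noteq> snd v then 2 else 0)"
      by (rule order_trans[OF clamp_nonexpanding]) auto
    then have "\<bar>real_of_int ?a - real_of_int ?b\<bar> \<le> \<bar>real_of_int (last ks) - real_of_int (last ks')\<bar> + (if fst v \<noteq> snd v then 2 else 0)"
      by (auto split: if_splits)
    then have "\<bar>real_of_int ?a - real_of_int ?b\<bar> * h \<le> (\<bar>real_of_int (last ks) - real_of_int (last ks')\<bar> + (if fst v \<noteq> snd v then 2 else 0)) * h"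
      using A.h_pos by (intro mult_right_mono) auto
    then have "\<bar>A.pos ?a - A.pos ?b\<bar> \<le> ?d + 2 * h * (if fst v \<noteq> snd v then 1 else 0)"
      using A.h_pos unfolding left_diff_distrib[symmetric] abs_mult by (auto simp: algebra_simps split: if_splits)
    then show ?thesis
      using d A.h_pos separation_snoc[OF ks(3) ne(1), of ?a ?b] by (auto simp: s)
  qed
  have "(\<integral>\<^sup>+ s'. ennreal (W + separation s') \<partial>coupled_walks (Suc n) s)
     = (\<integral>\<^sup>+ v. (\<integral>\<^sup>+ s'. ennreal (W + separation s') \<partial>coupled_walks n (?next v)) \<partial>?c)"
    unfolding s coupled_walks.simps fst_conv snd_conv nn_integral_bind_pmf ..
  also have "\<dots> \<le> (\<integral>\<^sup>+ v. ennreal (?\<Pi> * (W + separation (?next v))) \<partial>?c)"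
    using Suc.prems(4) ks A.walk_extend[OF ks(1)] A.walk_extend[OF ks(2)]
    by (intro nn_integral_mono Suc.IH) (auto simp: s)
  also have "\<dots> \<le> (\<integral>\<^sup>+ v. ennreal (?\<Pi> * (W + separation s)) + ennreal (?\<Pi> * (2 * h)) * indicator {x. fst x \<noteq> snd x} v \<partial>?c)"
  proof (rule nn_integral_mono)
    fix v
    have "?\<Pi> * (W + separation (?next v)) \<le> ?\<Pi> * (W + separation s) + ?\<Pi> * (2 * h) * (if fst v \<noteq> snd v then 1 else 0)"
      using mult_left_mono[OF step[of v] \<Pi>] by (simp add: algebra_simps)
    then have "ennreal (?\<Pi> * (W + separation (?next v)))
       \<le> ennreal (?\<Pi> * (W + separation s) + ?\<Pi> * (2 * h) * (if fst v \<noteq> snd v then 1 else 0))"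
      by (rule ennreal_leI)
    also have "\<dots> = ennreal (?\<Pi> * (W + separation s)) + ennreal (?\<Pi> * (2 * h)) * indicator {x. fst x \<noteq> snd x} v"
      using \<Pi> A.h_pos sep0 W1_nonneg[of \<nu> \<nu>'] by (subst ennreal_plus) (auto simp: indicator_def)
    finally show "ennreal (?\<Pi> * (W + separation (?next v)))
       \<le> ennreal (?\<Pi> * (W + separation s)) + ennreal (?\<Pi> * (2 * h)) * indicator {x. fst x \<noteq> snd x} v" .
  qed
  also have "\<dots> = ennreal (?\<Pi> * (W + separation s)) + ennreal (?\<Pi> * (2 * h)) * ennreal \<bar>?p - ?q\<bar>"
    using bernoulli_coupled(3)[OF coupled_prob_range(1)[OF ks(1,2), of n] coupled_prob_range(2)[OF ks(1,2), of n]]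
    by (simp add: nn_integral_add nn_integral_cmult measure_pmf.emeasure_space_1)
  also have "\<dots> = ennreal (?\<Pi> * (W + separation s + 2 * h * \<bar>?p - ?q\<bar>))"
    using \<Pi> A.h_pos sep0 W1_nonneg[of \<nu> \<nu>']
    by (simp add: ennreal_mult'[symmetric] ennreal_plus[symmetric] distrib_left mult.assoc del: ennreal_plus)
  also have "\<dots> \<le> ennreal (?\<Pi> * (W + separation s + A.Delta * drift_lip n * (W + separation s)))"
    using pq \<Pi> by (intro ennreal_leI mult_left_mono add_left_mono)
  also have "?\<Pi> * (W + separation s + A.Delta * drift_lip n * (W + separation s))
     = (\<Prod>i<Suc n. 1 + A.Delta * drift_lip i) * (W + separation s)"
    by (simp add: algebra_simps)
  finally show ?case .
qed simp

text \<open>The singular parts of the exponents sum to at most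
  \<open>Delta / h * 2 * sqrt N\<close>, times constants, and this equals
  \<open>2 * sqrt T / \<sigma>\<close>. The whole exponent thus tends to \<open>0\<close> with
  \<open>T\<close>, uniformly in \<open>h\<close>.\<close>

lemma drift_product:
  defines "C \<equiv> A.G.slope_const (2 * T0) ((max c R + 1) * exp (c * (2 * T0)))"
  shows "(\<Prod>i<A.N. 1 + A.Delta * drift_lip i)
    \<le> exp (c * (1 + c\<^sub>\<alpha> * (1 + 2 * R / L)) * T + 2 * c * c\<^sub>\<alpha> * C / \<sigma> * sqrt T)"
proof -
  have "(\<Prod>i<A.N. 1 + A.Delta * drift_lip i) \<le> (\<Prod>i<A.N. exp (A.Delta * drift_lip i))"
    using drift_lip_nonneg A.Delta_pos by (intro prod_mono) (auto intro: exp_ge_add_one_self)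
  also have "\<dots> = exp (\<Sum>i<A.N. A.Delta * drift_lip i)" by (simp add: exp_sum)
  also have "(\<Sum>i<A.N. A.Delta * drift_lip i)
     = (\<Sum>i<A.N. c * (1 + c\<^sub>\<alpha> * (1 + 2 * R / L)) * A.Delta + c * c\<^sub>\<alpha> * C * (A.Delta / h) * (1 / sqrt (real i + 1)))"
    unfolding drift_lip_def C_def[symmetric] by (intro sum.cong refl) (simp add: algebra_simps)
  also have "\<dots> = c * (1 + c\<^sub>\<alpha> * (1 + 2 * R / L)) * (real A.N * A.Delta) + c * c\<^sub>\<alpha> * C * (A.Delta / h) * (\<Sum>i<A.N. 1 / sqrt (real i + 1))"
    unfolding sum.distrib sum_distrib_left[symmetric] by simp
  also have "\<dots> \<le> c * (1 + c\<^sub>\<alpha> * (1 + 2 * R / L)) * (real A.N * A.Delta) + c * c\<^sub>\<alpha> * C * (A.Delta / h) * (2 * sqrt (real A.N))"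
    using A.c_nonneg c\<^sub>\<alpha>_nonneg slope_const_nonneg A.Delta_pos A.h_pos unfolding C_def
    by (intro add_left_mono mult_left_mono sum_inverse_sqrt mult_nonneg_nonneg) auto
  also have "\<dots> = c * (1 + c\<^sub>\<alpha> * (1 + 2 * R / L)) * T + 2 * c * c\<^sub>\<alpha> * C / \<sigma> * sqrt T"
  proof -
    have "sqrt T = sqrt (real A.N * A.Delta)" by (simp only: A.T_eq)
    also have "\<dots> = sqrt (real A.N) * (h / \<sigma>)"
      unfolding real_sqrt_mult using A.h_pos A.\<sigma>_pos by (simp add: A.Delta_def real_sqrt_divide)
    finally have "sqrt T = sqrt (real A.N) * (h / \<sigma>)" .
    then have "A.Delta / h * sqrt (real A.N) = sqrt T / \<sigma>"
      using A.h_pos A.\<sigma>_pos by (simp add: A.Delta_def power2_eq_square)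
    then have "c * c\<^sub>\<alpha> * C * (A.Delta / h) * (2 * sqrt (real A.N)) = c * c\<^sub>\<alpha> * C * 2 * (sqrt T / \<sigma>)"
      by (metis mult.assoc mult.left_commute)
    then show ?thesis unfolding A.T_eq by simp
  qed
  finally show ?thesis by simp
qed

text \<open>The coupled walks are mapped to polygons, which yields a coupling of the two path laws
  with cost at most the expected separation. The bound \<open>3 / 2\<close> is for \<open>W\<close>
  plus the separation, so subtracting \<open>W\<close> leaves the factor
  \<open>1 / 2\<close>.\<close>

lemma W1_Phi_le:
  assumes contr: "c * (1 + c\<^sub>\<alpha> * (1 + 2 * R / L)) * T
     + 2 * c * c\<^sub>\<alpha> * A.G.slope_const (2 * T0) ((max c R + 1) * exp (c * (2 * T0))) / \<sigma> * sqrt T \<le> ln (3 / 2)"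
  shows "W1 A.Phi B.Phi \<le> W / 2"
proof -
  let ?s = "([A.k_start], [A.k_start])"
  let ?Q = "coupled_walks A.N ?s"
  let ?P = "path_space T L"
  have start: "walk A.m (fst ?s)" "walk A.m (snd ?s)" using A.k_start_range by (auto intro: walk.start)
  note marg = coupled_walks_marginals[OF start, of A.N]
  have W0: "0 \<le> W" by (rule W1_nonneg)
  have "separation ?s = 0" by (simp add: separation_def lessThan_Suc)
  then have "(\<integral>\<^sup>+ s'. ennreal (W + separation s') \<partial>?Q) \<le> ennreal ((\<Prod>i<A.N. 1 + A.Delta * drift_lip i) * W)"
    using coupled_separation[OF start, of A.N] by simp
  also have "\<dots> \<le> ennreal (3 / 2 * W)"
  proof (intro ennreal_leI mult_right_mono W0)
    have "(\<Prod>i<A.N. 1 + A.Delta * drift_lip i) \<le> exp (ln (3 / 2))"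
      using drift_product contr by (meson exp_le_cancel_iff order_trans)
    then show "(\<Prod>i<A.N. 1 + A.Delta * drift_lip i) \<le> 3 / 2" by simp
  qed
  finally have total: "(\<integral>\<^sup>+ s'. ennreal (W + separation s') \<partial>?Q) \<le> ennreal (3 / 2 * W)" .
  have sep0: "0 \<le> separation s'" if "s' \<in> set_pmf ?Q" for s'
    using separation_ge[of 0 s'] coupled_walks_support(3)[OF start that] by (simp add: order_trans[OF abs_ge_zero])
  have "ennreal W + (\<integral>\<^sup>+ s'. ennreal (separation s') \<partial>?Q) = (\<integral>\<^sup>+ s'. ennreal W + ennreal (separation s') \<partial>?Q)"
    by (simp add: nn_integral_add measure_pmf.emeasure_space_1)
  also have "\<dots> = (\<integral>\<^sup>+ s'. ennreal (W + separation s') \<partial>?Q)"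
    using W0 sep0 by (intro nn_integral_cong_AE AE_pmfI) (simp add: ennreal_plus)
  also have "\<dots> \<le> ennreal W + ennreal (W / 2)"
    using total W0 by (simp add: ennreal_plus[symmetric] del: ennreal_plus)
  finally have sep: "(\<integral>\<^sup>+ s'. ennreal (separation s') \<partial>?Q) \<le> ennreal (W / 2)"
    by (simp add: ennreal_add_left_cancel_le)
  define \<pi> where "\<pi> = distr ?Q (?P \<Otimes>\<^sub>M ?P) (\<lambda>s. (A.path_of (fst s), B.path_of (snd s)))"
  have pm: "(\<lambda>s. (A.path_of (fst s), B.path_of (snd s))) \<in> measure_pmf ?Q \<rightarrow>\<^sub>M ?P \<Otimes>\<^sub>M ?P"
    by (intro measurable_Pair) (auto simp: measurable_def A.path_of_paths B.path_of_paths)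
  have sets: "sets A.path_law = sets ?P" "sets B.path_law = sets ?P"
    by (simp_all add: A.path_law_def B.path_law_def)
  have "\<pi> \<in> couplings A.path_law B.path_law"
    unfolding couplings_def
  proof (intro CollectI conjI)
    have "sets (A.path_law \<Otimes>\<^sub>M B.path_law) = sets (?P \<Otimes>\<^sub>M ?P)"
      using sets by (rule sets_pair_measure_cong)
    then show "\<pi> \<in> space (prob_algebra (A.path_law \<Otimes>\<^sub>M B.path_law))"
      by (simp add: space_prob_algebra \<pi>_def measure_pmf.prob_space_distr[OF pm])
    have "distr \<pi> A.path_law fst = distr \<pi> ?P fst" by (rule distr_cong) (simp_all add: sets)
    also have "\<dots> = distr ?Q ?P (A.path_of \<circ> fst)"
      unfolding \<pi>_def by (subst distr_distr[OF measurable_fst pm]) (simp add: comp_def)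
    also have "\<dots> = distr (map_pmf fst ?Q) ?P A.path_of"
      unfolding map_pmf_rep_eq by (rule distr_distr[symmetric]) (auto simp: measurable_def A.path_of_paths)
    also have "\<dots> = A.path_law" using marg by (simp add: A.path_law_def A.walk_law_def)
    finally show "distr \<pi> A.path_law fst = A.path_law" .
    have "distr \<pi> B.path_law snd = distr \<pi> ?P snd" by (rule distr_cong) (simp_all add: sets)
    also have "\<dots> = distr ?Q ?P (B.path_of \<circ> snd)"
      unfolding \<pi>_def by (subst distr_distr[OF measurable_snd pm]) (simp add: comp_def)
    also have "\<dots> = distr (map_pmf snd ?Q) ?P B.path_of"
      unfolding map_pmf_rep_eq by (rule distr_distr[symmetric]) (auto simp: measurable_def B.path_of_paths)
    also have "\<dots> = B.path_law" using marg by (simp add: B.path_law_def B.walk_law_def)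
    finally show "distr \<pi> B.path_law snd = B.path_law" .
  qed
  moreover have "(\<integral>\<^sup>+ p. ennreal (dist (fst p) (snd p)) \<partial>\<pi>) \<le> ennreal (W / 2)"
  proof -
    have "(\<integral>\<^sup>+ p. ennreal (dist (fst p) (snd p)) \<partial>\<pi>) \<le> (\<integral>\<^sup>+ s. ennreal (dist (A.path_of (fst s)) (B.path_of (snd s))) \<partial>?Q)"
      unfolding \<pi>_def by (rule order_trans[OF nn_integral_distr_le[OF pm]]) simp
    also have "\<dots> \<le> (\<integral>\<^sup>+ s. ennreal (separation s) \<partial>?Q)"
    proof (intro nn_integral_mono_AE AE_pmfI ennreal_leI)
      fix s assume s: "s \<in> set_pmf ?Q"
      note supp = coupled_walks_support[OF start s]
      have len: "length (fst s) = Suc A.N" "length (snd s) = Suc A.N" using supp(3,4) by simp_all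
      have range: "set (fst s) \<subseteq> {0..A.m}" "set (snd s) \<subseteq> {0..A.m}"
        using walk_range[OF _ supp(1)] walk_range[OF _ supp(2)] A.m_pos by simp_all
      have "dist (A.polygon (fst s)) (A.polygon (snd s)) \<le> separation s"
        by (rule A.polygon_dist[OF range(1) len(1) range(2) len(2)]) (rule separation_ge, simp add: len)
      then show "dist (A.path_of (fst s)) (B.path_of (snd s)) \<le> separation s"
        using A.path_of_walk[OF supp(1) len(1)] B.path_of_walk[OF supp(2) len(2)] by simp
    qed
    also note sep
    finally show ?thesis .
  qed
  ultimately show ?thesis
    unfolding A.Phi_eq B.Phi_eq by (rule W1_le) (use W0 in simp)
qed

end

end

subsection \<open>Constants uniform in the horizon, the step and the measure\<close>

lemma W1_segment_le:
  assumes "0 \<le> L" "\<eta> \<in> space (prob_algebra (segment_space L))" "\<eta>' \<in> space (prob_algebra (segment_space L))"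
  shows "W1 \<eta> \<eta>' \<le> L"
proof (rule W1_le_diameter)
  have "space \<eta> = {0..L}" "space \<eta>' = {0..L}"
    using assms sets_eq_imp_space_eq[of \<eta> "segment_space L"] sets_eq_imp_space_eq[of \<eta>' "segment_space L"]
    by (auto simp: space_prob_algebra)
  then show "dist x y \<le> L" if "x \<in> space \<eta>" "y \<in> space \<eta>'" for x y
    using that by (auto simp: dist_real_def)
qed (use assms in \<open>auto simp: space_prob_algebra\<close>)

text \<open>The bounds come from comparison with a reference point: time \<open>0\<close>, the Dirac
  measure at \<open>0\<close>, state \<open>0\<close> and some control \<open>u0\<close>. It is at
  bounded distance from every argument, because \<open>W1\<close> is at most \<open>L\<close> on the
  segment and \<open>U\<close> is bounded. Boundedness of \<open>b\<close> also ensures that the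
  supremum \<open>c_B\<close> is an upper bound.\<close>

lemma mfg_constants:
  fixes L T0 :: real and U :: "real set"
    and b f :: "real \<Rightarrow> real measure \<Rightarrow> real \<Rightarrow> real \<Rightarrow> real"
    and g :: "real measure \<Rightarrow> real \<Rightarrow> real"
    and y r :: "real \<Rightarrow> real measure \<Rightarrow> real"
  assumes "L > 0" "T0 > 0" "compact U" and A1: "mfg.A1 L T0 U b f g y r"
  defines "P \<equiv> space (prob_algebra (segment_space L))"
  obtains c R where "0 \<le> c"
    and "\<And>t t' \<eta> \<eta>' x x' a a'. \<lbrakk>t \<in> {0..T0}; t' \<in> {0..T0}; \<eta> \<in> P; \<eta>' \<in> P; x \<in> {0..L}; x' \<in> {0..L}; a \<in> U; a' \<in> U\<rbrakk> \<Longrightarrow>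
       \<bar>f t \<eta> x a - f t' \<eta>' x' a'\<bar> + \<bar>g \<eta> x - g \<eta>' x'\<bar> + \<bar>b t \<eta> x a - b t' \<eta>' x' a'\<bar>
         + \<bar>y t \<eta> - y t' \<eta>'\<bar> + \<bar>r t \<eta> - r t' \<eta>'\<bar>
       \<le> c * (\<bar>t - t'\<bar> + W1 \<eta> \<eta>' + \<bar>x - x'\<bar> + \<bar>a - a'\<bar>)"
    and "\<And>t \<eta>. \<lbrakk>t \<in> {0..T0}; \<eta> \<in> P\<rbrakk> \<Longrightarrow> \<bar>y t \<eta>\<bar> \<le> R \<and> \<bar>r t \<eta>\<bar> \<le> R"
    and "\<And>t \<eta> x a. \<lbrakk>t \<in> {0..T0}; \<eta> \<in> P; x \<in> {0..L}; a \<in> U\<rbrakk> \<Longrightarrow> \<bar>b t \<eta> x a\<bar> \<le> mfg.c_B L T0 U b"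
    and "0 \<le> R" "0 \<le> mfg.c_B L T0 U b"
proof -
  obtain c0 where c0: "\<forall>t\<in>{0..T0}. \<forall>t'\<in>{0..T0}. \<forall>\<eta>\<in>P. \<forall>\<eta>'\<in>P. \<forall>x\<in>{0..L}. \<forall>x'\<in>{0..L}. \<forall>a\<in>U. \<forall>a'\<in>U.
       \<bar>f t \<eta> x a - f t' \<eta>' x' a'\<bar> + \<bar>g \<eta> x - g \<eta>' x'\<bar> + \<bar>b t \<eta> x a - b t' \<eta>' x' a'\<bar>
         + \<bar>y t \<eta> - y t' \<eta>'\<bar> + \<bar>r t \<eta> - r t' \<eta>'\<bar>
       \<le> c0 * (\<bar>t - t'\<bar> + W1 \<eta> \<eta>' + \<bar>x - x'\<bar> + \<bar>a - a'\<bar>)"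
    using A1 unfolding mfg.A1_def mfg.A1_lipschitz_def P_def by blast
  define c where "c = \<bar>c0\<bar>"
  have c: "0 \<le> c" by (simp add: c_def)
  have lip: "\<bar>f t \<eta> x a - f t' \<eta>' x' a'\<bar> + \<bar>g \<eta> x - g \<eta>' x'\<bar> + \<bar>b t \<eta> x a - b t' \<eta>' x' a'\<bar>
         + \<bar>y t \<eta> - y t' \<eta>'\<bar> + \<bar>r t \<eta> - r t' \<eta>'\<bar>
       \<le> c * (\<bar>t - t'\<bar> + W1 \<eta> \<eta>' + \<bar>x - x'\<bar> + \<bar>a - a'\<bar>)"
    if "t \<in> {0..T0}" "t' \<in> {0..T0}" "\<eta> \<in> P" "\<eta>' \<in> P" "x \<in> {0..L}" "x' \<in> {0..L}" "a \<in> U" "a' \<in> U"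
    for t t' \<eta> \<eta>' x x' a a'
  proof -
    have "c0 * (\<bar>t - t'\<bar> + W1 \<eta> \<eta>' + \<bar>x - x'\<bar> + \<bar>a - a'\<bar>) \<le> c * (\<bar>t - t'\<bar> + W1 \<eta> \<eta>' + \<bar>x - x'\<bar> + \<bar>a - a'\<bar>)"
      using W1_nonneg[of \<eta> \<eta>'] unfolding c_def by (intro mult_right_mono abs_ge_self) auto
    then show ?thesis using c0[rule_format, OF that] by linarith
  qed
  define \<eta>0 where "\<eta>0 = return (segment_space L) (0::real)"
  have \<eta>0: "\<eta>0 \<in> P"
    using assms(1) by (auto simp: P_def space_prob_algebra \<eta>0_def intro!: prob_space_return)
  have z: "0 \<in> {0..T0}" "0 \<in> {0..L}" using assms by auto
  obtain u0 where u0: "u0 \<in> U"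
    using A1 z \<eta>0 unfolding mfg.A1_def mfg.A1_minimizer_def P_def is_arg_min_def by blast
  obtain D where D: "\<And>a. a \<in> U \<Longrightarrow> \<bar>a\<bar> \<le> D"
    using compact_imp_bounded[OF \<open>compact U\<close>] unfolding bounded_iff by auto
  have W: "W1 \<eta> \<eta>' \<le> L" if "\<eta> \<in> P" "\<eta>' \<in> P" for \<eta> \<eta>'
    using W1_segment_le[of L \<eta> \<eta>'] that assms(1) by (simp add: P_def)
  have drop: "\<bar>q\<bar> \<le> K" "\<bar>s\<bar> \<le> K" "\<bar>v\<bar> \<le> K" if "\<bar>n\<bar> + \<bar>p\<bar> + \<bar>q\<bar> + \<bar>s\<bar> + \<bar>v\<bar> \<le> K" for n p q s v K :: real
    using that by linarith+
  define R where "R = \<bar>y 0 \<eta>0\<bar> + \<bar>r 0 \<eta>0\<bar> + c * (T0 + L)"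
  have R: "\<bar>y t \<eta>\<bar> \<le> R \<and> \<bar>r t \<eta>\<bar> \<le> R" if "t \<in> {0..T0}" "\<eta> \<in> P" for t \<eta>
  proof -
    have "c * (\<bar>t - 0\<bar> + W1 \<eta> \<eta>0 + \<bar>0 - 0\<bar> + \<bar>u0 - u0\<bar>) \<le> c * (T0 + L)"
      using that W[OF that(2) \<eta>0] c by (intro mult_left_mono) auto
    note drop(2,3)[OF order_trans[OF lip[OF that(1) z(1) that(2) \<eta>0 z(2) z(2) u0 u0] this]]
    then have "\<bar>y t \<eta>\<bar> \<le> \<bar>y 0 \<eta>0\<bar> + c * (T0 + L)" "\<bar>r t \<eta>\<bar> \<le> \<bar>r 0 \<eta>0\<bar> + c * (T0 + L)"
      using abs_triangle_ineq2[of "y t \<eta>" "y 0 \<eta>0"] abs_triangle_ineq2[of "r t \<eta>" "r 0 \<eta>0"] by auto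
    then show ?thesis unfolding R_def using abs_ge_zero[of "y 0 \<eta>0"] abs_ge_zero[of "r 0 \<eta>0"] by auto
  qed
  have b: "\<bar>b t \<eta> x a\<bar> \<le> \<bar>b 0 \<eta>0 0 u0\<bar> + c * (T0 + L + L + 2 * D)"
    if "t \<in> {0..T0}" "\<eta> \<in> P" "x \<in> {0..L}" "a \<in> U" for t \<eta> x a
  proof -
    have "\<bar>t - 0\<bar> \<le> T0" "\<bar>x - 0\<bar> \<le> L" using that(1,3) by auto
    moreover have "\<bar>a - u0\<bar> \<le> 2 * D" using D[OF that(4)] D[OF u0] by linarith
    ultimately have "c * (\<bar>t - 0\<bar> + W1 \<eta> \<eta>0 + \<bar>x - 0\<bar> + \<bar>a - u0\<bar>) \<le> c * (T0 + L + L + 2 * D)"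
      using W[OF that(2) \<eta>0] c by (intro mult_left_mono add_mono) auto
    note drop(1)[OF order_trans[OF lip[OF that(1) z(1) that(2) \<eta>0 that(3) z(2) that(4) u0] this]]
    then show ?thesis using abs_triangle_ineq2[of "b t \<eta> x a" "b 0 \<eta>0 0 u0"] by auto
  qed
  let ?B = "{\<bar>b t \<eta> x u\<bar> | t \<eta> x u. t \<in> {0..T0} \<and> \<eta> \<in> P \<and> x \<in> {0..L} \<and> u \<in> U}"
  have "bdd_above ?B"
    by (rule bdd_aboveI[of _ "\<bar>b 0 \<eta>0 0 u0\<bar> + c * (T0 + L + L + 2 * D)"]) (use b in auto)
  then have B: "\<bar>b t \<eta> x a\<bar> \<le> mfg.c_B L T0 U b" if "t \<in> {0..T0}" "\<eta> \<in> P" "x \<in> {0..L}" "a \<in> U" for t \<eta> x a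
    unfolding mfg.c_B_def P_def[symmetric] using that by (intro cSup_upper) blast+
  have "0 \<le> R" using R[OF z(1) \<eta>0] by linarith
  moreover have "0 \<le> mfg.c_B L T0 U b" using B[OF z(1) \<eta>0 z(2) u0] by linarith
  ultimately show ?thesis using that c lip R B by blast
qed

theorem proposition3p7:
  fixes L \<sigma> T0 x0 :: real
    and U :: "real set"
    and b f :: "real \<Rightarrow> real measure \<Rightarrow> real \<Rightarrow> real \<Rightarrow> real"
    and g :: "real measure \<Rightarrow> real \<Rightarrow> real"
    and y r :: "real \<Rightarrow> real measure \<Rightarrow> real"
  assumes "L > 0" and "\<sigma> > 0" and "T0 > 0" and "compact U"
    and "mfg.A1 L T0 U b f g y r"
    and "mfg.A2 L T0 y r"
    and "mfg.A3 L T0 U b f"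
    and "x0 \<in> {0..L}"
  shows "\<exists>T_hat h_hat q. 0 < T_hat \<and> T_hat \<le> T0 \<and> 0 < h_hat \<and> 0 < q \<and> q < 1 \<and>
    (\<forall>T. 0 < T \<and> T \<le> T_hat \<longrightarrow>
      (\<forall>\<nu>\<in>space (prob_algebra (path_space T L)). \<forall>\<nu>'\<in>space (prob_algebra (path_space T L)).
        \<forall>h. mfg.admissible_step L \<sigma> T0 U b T h \<and> h < min h_hat T_hat \<longrightarrow>
          (W1 (mfg_chain.Phi L \<sigma> U b f g y r x0 T h \<nu>)
              (mfg_chain.Phi L \<sigma> U b f g y r x0 T h \<nu>'))\<^sup>2
            \<le> q * (h\<^sup>2 + (W1 \<nu> \<nu>')\<^sup>2)))"
proof -
  let ?B = "mfg.c_B L T0 U b"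
  let ?P = "space (prob_algebra (segment_space L))"
  obtain c R where c: "0 \<le> c" and R: "0 \<le> R" and B: "0 \<le> ?B"
    and lip: "\<And>t t' \<eta> \<eta>' x x' a a'. \<lbrakk>t \<in> {0..T0}; t' \<in> {0..T0}; \<eta> \<in> ?P; \<eta>' \<in> ?P; x \<in> {0..L}; x' \<in> {0..L}; a \<in> U; a' \<in> U\<rbrakk> \<Longrightarrow>
       \<bar>f t \<eta> x a - f t' \<eta>' x' a'\<bar> + \<bar>g \<eta> x - g \<eta>' x'\<bar> + \<bar>b t \<eta> x a - b t' \<eta>' x' a'\<bar>
         + \<bar>y t \<eta> - y t' \<eta>'\<bar> + \<bar>r t \<eta> - r t' \<eta>'\<bar>
       \<le> c * (\<bar>t - t'\<bar> + W1 \<eta> \<eta>' + \<bar>x - x'\<bar> + \<bar>a - a'\<bar>)"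
    and yr: "\<And>t \<eta>. \<lbrakk>t \<in> {0..T0}; \<eta> \<in> ?P\<rbrakk> \<Longrightarrow> \<bar>y t \<eta>\<bar> \<le> R \<and> \<bar>r t \<eta>\<bar> \<le> R"
    and b: "\<And>t \<eta> x a. \<lbrakk>t \<in> {0..T0}; \<eta> \<in> ?P; x \<in> {0..L}; a \<in> U\<rbrakk> \<Longrightarrow> \<bar>b t \<eta> x a\<bar> \<le> ?B"
    by (rule mfg_constants[OF assms(1,3,4,5)]) blast
  obtain c1 where c1: "\<forall>t\<in>{0..T0}. \<forall>\<eta>\<in>?P. \<forall>\<eta>'\<in>?P. \<forall>x\<in>{0..L}. \<forall>x'\<in>{0..L}. \<forall>p p'.
       \<bar>mfg.alpha_hat U b f t \<eta> x p - mfg.alpha_hat U b f t \<eta>' x' p'\<bar> \<le> c1 * (W1 \<eta> \<eta>' + \<bar>x - x'\<bar> + \<bar>p - p'\<bar>)"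
    using assms(7) unfolding mfg.A3_def by blast
  define c\<^sub>\<alpha> where "c\<^sub>\<alpha> = \<bar>c1\<bar>"
  have c\<^sub>\<alpha>: "0 \<le> c\<^sub>\<alpha>" by (simp add: c\<^sub>\<alpha>_def)
  have alpha: "\<bar>mfg.alpha_hat U b f t \<eta> x p - mfg.alpha_hat U b f t \<eta>' x' p'\<bar> \<le> c\<^sub>\<alpha> * (W1 \<eta> \<eta>' + \<bar>x - x'\<bar> + \<bar>p - p'\<bar>)"
    if "t \<in> {0..T0}" "\<eta> \<in> ?P" "\<eta>' \<in> ?P" "x \<in> {0..L}" "x' \<in> {0..L}" for t \<eta> \<eta>' x x' p p'
  proof -
    have "c1 * (W1 \<eta> \<eta>' + \<bar>x - x'\<bar> + \<bar>p - p'\<bar>) \<le> c\<^sub>\<alpha> * (W1 \<eta> \<eta>' + \<bar>x - x'\<bar> + \<bar>p - p'\<bar>)"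
      using W1_nonneg[of \<eta> \<eta>'] unfolding c\<^sub>\<alpha>_def by (intro mult_right_mono abs_ge_self) auto
    then show ?thesis using c1[rule_format, OF that, of p p'] by linarith
  qed
  define K where "K = (max c R + 1) * exp (c * (2 * T0))"
  \<comment> \<open>\<open>slope_const\<close> at \<open>2 * T0\<close> with the length
    \<open>L\<close> in place of \<open>h * m\<close>; in this form it can be named before
    \<open>h\<close> is given.\<close>
  define C where "C = 2 * (c + 3 * R) + 4 * (c * (1 + K) + 2 * ?B * R / L + 3 * c) * (2 * T0)"
  define C1 where "C1 = c * (1 + c\<^sub>\<alpha> * (1 + 2 * R / L))"
  define C2 where "C2 = 2 * c * c\<^sub>\<alpha> * C / \<sigma>"
  define \<kappa> where "\<kappa> = ln (3 / 2 :: real)"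
  have nonneg: "0 \<le> K" "0 \<le> C" "0 \<le> C1" "0 \<le> C2"
  proof -
    show K: "0 \<le> K" using c by (simp add: K_def)
    show C: "0 \<le> C" unfolding C_def
      using c R B K assms(1,3) by (intro add_nonneg_nonneg mult_nonneg_nonneg divide_nonneg_nonneg) auto
    show "0 \<le> C1" unfolding C1_def
      using c R c\<^sub>\<alpha> assms(1) by (intro add_nonneg_nonneg mult_nonneg_nonneg divide_nonneg_nonneg) auto
    show "0 \<le> C2" unfolding C2_def
      using c c\<^sub>\<alpha> C assms(2) by (intro mult_nonneg_nonneg divide_nonneg_nonneg) auto
  qed
  have \<kappa>: "0 < \<kappa>" by (simp add: \<kappa>_def)
  \<comment> \<open>The bound \<open>1\<close> gives \<open>T \<le> sqrt T\<close>, so that the term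
    with \<open>C1\<close> is absorbed by the root; the next one then keeps the exponent of the
    contraction below \<open>ln (3 / 2)\<close>, and the last one is the smallness condition of the
    Gronwall argument. The added \<open>1\<close>s keep the denominators positive.\<close>
  define T_hat where "T_hat = min (min T0 1) (min ((\<kappa> / (C1 + C2 + 1))\<^sup>2) ((\<sigma> / (12 * ?B + 1))\<^sup>2 / 2))"
  have T_hat: "0 < T_hat" "T_hat \<le> T0"
    using assms(2,3) \<kappa> nonneg B by (auto simp: T_hat_def zero_less_divide_iff add_nonneg_pos)
  \<comment> \<open>The factor \<open>1 / 4\<close> is the square of the contraction factor
    \<open>1 / 2\<close> for \<open>W1\<close>.\<close>
  have main: "(W1 (mfg_chain.Phi L \<sigma> U b f g y r x0 T h \<nu>) (mfg_chain.Phi L \<sigma> U b f g y r x0 T h \<nu>'))\<^sup>2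
      \<le> 1 / 4 * (h\<^sup>2 + (W1 \<nu> \<nu>')\<^sup>2)"
    if T: "0 < T" "T \<le> T_hat" and \<nu>: "\<nu> \<in> space (prob_algebra (path_space T L))"
      and \<nu>': "\<nu>' \<in> space (prob_algebra (path_space T L))" and h: "mfg.admissible_step L \<sigma> T0 U b T h"
    for T h \<nu> \<nu>'
  proof -
    have TT: "T \<le> T0" "T \<le> 1" "T \<le> (\<kappa> / (C1 + C2 + 1))\<^sup>2" "2 * T \<le> (\<sigma> / (12 * ?B + 1))\<^sup>2"
      using T(2) by (auto simp: T_hat_def)
    have inst: "mfg_setup L \<sigma> T0 U b f g y r x0 T h \<nu> c R" if "\<nu> \<in> space (prob_algebra (path_space T L))" for \<nu>
    proof
      show "mfg.A1_minimizer L T0 U b f" using assms(5) by (simp add: mfg.A1_def)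
    qed (use assms T TT c lip yr b h that in auto)
    interpret mfg_setup_pair L \<sigma> T0 U b f g y r x0 T h \<nu> \<nu>' c R c\<^sub>\<alpha>
      by (intro mfg_setup_pair.intro mfg_setup_pair_axioms.intro inst \<nu> \<nu>' c\<^sub>\<alpha> alpha)
    have "A.G.slope_const (2 * T0) K = C"
      using A.L_eq by (simp add: A.G.slope_const_def C_def mult.commute)
    moreover have "C1 * T + C2 * sqrt T \<le> \<kappa>"
    proof -
      have s: "sqrt T \<le> \<kappa> / (C1 + C2 + 1)"
        using TT(3) \<kappa> nonneg T(1) by (intro real_le_lsqrt) auto
      have "T \<le> sqrt T"
        using T(1) TT(2) by (intro real_le_rsqrt) (auto simp: power2_eq_square mult_left_le)
      then have "C1 * T + C2 * sqrt T \<le> C1 * sqrt T + C2 * sqrt T"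
        using nonneg by (intro add_right_mono mult_left_mono) auto
      also have "\<dots> \<le> (C1 + C2 + 1) * sqrt T" using T(1) by (simp add: distrib_right)
      also have "\<dots> \<le> (C1 + C2 + 1) * (\<kappa> / (C1 + C2 + 1))"
        using s nonneg by (intro mult_left_mono) auto
      also have "\<dots> = \<kappa>" using nonneg by simp
      finally show ?thesis .
    qed
    moreover have "12 * A.c_B * sqrt (2 * T) \<le> \<sigma>"
    proof -
      have "sqrt (2 * T) \<le> \<sigma> / (12 * ?B + 1)"
        using TT(4) T(1) B assms(2) by (intro real_le_lsqrt) auto
      then have "(12 * ?B + 1) * sqrt (2 * T) \<le> \<sigma>" using B by (simp add: field_simps)
      moreover have "0 \<le> sqrt (2 * T)" using T(1) by simp
      ultimately show ?thesis unfolding distrib_right mult_1_left by linarith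
    qed
    ultimately have "W1 A.Phi B.Phi \<le> W1 \<nu> \<nu>' / 2"
      by (intro W1_Phi_le) (simp_all add: C1_def C2_def K_def \<kappa>_def)
    then have "(W1 A.Phi B.Phi)\<^sup>2 \<le> (W1 \<nu> \<nu>' / 2)\<^sup>2"
      by (intro power_mono W1_nonneg)
    also have "\<dots> \<le> 1 / 4 * (h\<^sup>2 + (W1 \<nu> \<nu>')\<^sup>2)" by (simp add: power_divide)
    finally show ?thesis .
  qed
  show ?thesis
  proof (rule exI[of _ T_hat], rule exI[of _ 1], rule exI[of _ "1 / 4"], intro conjI allI ballI impI)
    fix T h \<nu> \<nu>' assume "0 < T \<and> T \<le> T_hat" "\<nu> \<in> space (prob_algebra (path_space T L))"
      "\<nu>' \<in> space (prob_algebra (path_space T L))" "mfg.admissible_step L \<sigma> T0 U b T h \<and> h < min 1 T_hat"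
    then show "(W1 (mfg_chain.Phi L \<sigma> U b f g y r x0 T h \<nu>) (mfg_chain.Phi L \<sigma> U b f g y r x0 T h \<nu>'))\<^sup>2
        \<le> 1 / 4 * (h\<^sup>2 + (W1 \<nu> \<nu>')\<^sup>2)"
      by (intro main) auto
  qed (use T_hat in auto)
qed


end
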